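(* Let $e^{i\theta_1},\ldots,e^{i\theta_n}$ be the eigenvalues of the $n\times n$ CMV matrix $\mathcal{C}$ and $\mu_1,\ldots,\mu_n$ the masses that the spectral measure of $(\mathcal{C},e_1)$ gives to them. Let $f$ be a polynomial and $F(z)=2\,\mathrm{Re}\,zf'(z)$. Under the flow generated by the Hamiltonian $\phi(B)=\mathrm{Im}\,\mathrm{tr}\{f(B)\}$, $$\partial_t\log[\mu_j]=\{\phi,\log[\mu_j]\}=F(e^{i\theta_j})-\sum_{l=1}^nF(e^{i\theta_l})\mu_l .$$ Consequently, $$\mu_j(t)=\frac{\exp[F(e^{i\theta_j})t]\,\mu_j(0)}{\sum_{l=1}^n\exp[F(e^{i\theta_l})t]\,\mu_l(0)},$$ and, on the manifold of CMV matrices with fixed determinant, for any $j,l\in\{1,\ldots,n-1\}$, $$\{\theta_l,\tfrac12\log[\mu_j/\mu_n]\}=\delta_{jl}.$$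
   Context: CMV matrices: given $\alpha_0,\ldots,\alpha_{n-2}$ in the open unit disk and $\alpha_{n-1}$ on the unit circle $S^1$, put $\rho_k=\sqrt{1-|\alpha_k|^2}$, $\Xi_k=\begin{bmatrix}\bar\alpha_k&\rho_k\\ \rho_k&-\alpha_k\end{bmatrix}$ for $0\le k\le n-2$, $\Xi_{-1}=[1]$, $\Xi_{n-1}=[\bar\alpha_{n-1}]$. The CMV matrix is $\mathcal{C}=\mathcal{L}\mathcal{M}$ with $n\times n$ block-diagonal $\mathcal{L}=\mathrm{diag}(\Xi_0,\Xi_2,\ldots)$, $\mathcal{M}=\mathrm{diag}(\Xi_{-1},\Xi_1,\Xi_3,\ldots)$. Its $n$ eigenvalues are distinct and $e_1=[1,0,\dots,0]^T$ is cyclic; the spectral measure $d\mu$ of $(\mathcal{C},e_1)$ satisfies $\langle e_1|h(\mathcal{C})e_1\rangle=\int h\,d\mu=\sum_j h(e^{i\theta_j})\mu_j$ with all $\mu_j>0$, $\sum\mu_j=1$. The functions $\theta_j,\mu_j$ are (locally, after a smooth choice of labelling) smooth functions on the manifold of CMV matrices. Bracket: let $\mathfrak{g}$ be the $n\times n$ complex matrices viewed as a real manifold. Write $\mathfrak{g}=\mathfrak{l}\oplus\mathfrak{a}$, with $\mathfrak{a}=\{A:A=-A^\dagger\}$ and $\mathfrak{l}$ the lower triangular matrices with real diagonal; $\pi_{\mathfrak l},\pi_{\mathfrak a}$ are the projections and $R=\pi_{\mathfrak l}-\pi_{\mathfrak a}$. Let $\langle X,Y\rangle=\mathrm{Im}\,\mathrm{tr}(XY)$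 and define $\nabla\phi$ by $\frac{d}{dt}|_{t=0}\phi(B+tC)=\langle\nabla\phi|_B,C\rangle$. The (Gelfand--Dikij) Poisson bracket is, with $X=\nabla\phi|_B$, $Y=\nabla\psi|_B$, $$\{\phi,\psi\}|_B=\tfrac12\langle R(XB),YB\rangle-\tfrac12\langle R(BX),BY\rangle .$$ The manifold of CMV matrices with fixed determinant is a symplectic leaf, so the bracket restricts to functions on it. The flow generated by $\phi$ satisfies $\dot\psi=\{\phi,\psi\}$ for all $\psi$; it leaves the eigenvalues invariant when $\phi=\mathrm{Im}\,\mathrm{tr} f$. *)

theory Defs
  imports "HOL-Analysis.Analysis" "HOL-Computational_Algebra.Polynomial"
begin

text \<open>
  The \<open>n \<times> n\<close> matrices are \<open>'n cmat\<close> with \<open>n = CARD('n)\<close>. The index type carries a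
  linear order, and \<open>pos i\<close> is the zero-based number of the row or column \<open>i\<close>.
\<close>

type_synonym 'n cmat = "((complex, 'n) vec, 'n) vec"

definition pos :: "'n::{finite,linorder} \<Rightarrow> nat" where
  "pos i = card {k. k < i}"

definition e1 :: "complex^'n::{finite,linorder}" where
  "e1 = (\<chi> i. if pos i = 0 then 1 else 0)"


subsection \<open>CMV matrices\<close>

definition rho :: "(nat \<Rightarrow> complex) \<Rightarrow> nat \<Rightarrow> real" where
  "rho \<alpha> k = sqrt (1 - (cmod (\<alpha> k))\<^sup>2)"

text \<open>
  \<open>Xi_at \<alpha> k r s\<close> is the entry in row \<open>r\<close> and column \<open>s\<close> of the block \<open>\<Xi>\<^sub>k\<close> placed in the rows and
  columns \<open>k, k + 1\<close>. For \<open>k = n - 1\<close> only the index \<open>k\<close> is in range, so that the block is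
  truncated to its corner \<open>[cnj (\<alpha> (n - 1))]\<close>, as it should be.
\<close>

definition Xi_at :: "(nat \<Rightarrow> complex) \<Rightarrow> nat \<Rightarrow> nat \<Rightarrow> nat \<Rightarrow> complex" where
  "Xi_at \<alpha> k r s =
    (if r = k \<and> s = k then cnj (\<alpha> k)
     else if r = k \<and> s = k + 1 \<or> r = k + 1 \<and> s = k then complex_of_real (rho \<alpha> k)
     else if r = k + 1 \<and> s = k + 1 then - \<alpha> k
     else 0)"

definition cmv_L :: "(nat \<Rightarrow> complex) \<Rightarrow> 'n::{finite,linorder} cmat" where
  "cmv_L \<alpha> = (\<chi> i j. \<Sum>k | k < CARD('n) \<and> even k. Xi_at \<alpha> k (pos i) (pos j))"

text \<open>The first summand is the block \<open>\<Xi>\<^sub>-\<^sub>1 = [1]\<close>.\<close>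

definition cmv_M :: "(nat \<Rightarrow> complex) \<Rightarrow> 'n::{finite,linorder} cmat" where
  "cmv_M \<alpha> = (\<chi> i j. (if pos i = 0 \<and> pos j = 0 then 1 else 0) +
                     (\<Sum>k | k < CARD('n) \<and> odd k. Xi_at \<alpha> k (pos i) (pos j)))"

definition cmv :: "(nat \<Rightarrow> complex) \<Rightarrow> 'n::{finite,linorder} cmat" where
  "cmv \<alpha> = cmv_L \<alpha> ** cmv_M \<alpha>"

definition CMV :: "('n::{finite,linorder} cmat) set" where
  "CMV = {cmv \<alpha> | \<alpha>. (\<forall>k < CARD('n) - 1. cmod (\<alpha> k) < 1) \<and> cmod (\<alpha> (CARD('n) - 1)) = 1}"


subsection \<open>Eigenvalues and the spectral measure\<close>

definition mat_power :: "'n::finite cmat \<Rightarrow> nat \<Rightarrow> 'n cmat" where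
  "mat_power A k = (((**) A) ^^ k) (mat 1)"

definition poly_mat :: "complex poly \<Rightarrow> 'n::finite cmat \<Rightarrow> 'n cmat" where
  "poly_mat p A = (\<Sum>k\<le>degree p. mat (coeff p k) ** mat_power A k)"

definition eigenvalues :: "'n::finite cmat \<Rightarrow> complex set" where
  "eigenvalues A = {z. \<exists>v. v \<noteq> 0 \<and> A *v v = z *s v}"

definition cinner :: "complex^'n \<Rightarrow> complex^'n \<Rightarrow> complex" where
  "cinner v w = (\<Sum>i\<in>UNIV. cnj (v $ i) * w $ i)"

text \<open>
  The measure with \<open>\<langle>v | h(A) v\<rangle> = \<integral> h \<partial>M\<close> for all \<open>h\<close>, intended for diagonalizable \<open>A\<close>: there the
  functional calculus is \<open>h(A) = p(A)\<close> for any polynomial \<open>p\<close> that agrees with \<open>h\<close> on the spectrum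
  of \<open>A\<close>.
\<close>

definition spectral_measure :: "'n::finite cmat \<Rightarrow> complex^'n \<Rightarrow> complex measure" where
  "spectral_measure A v = (THE M. sets M = sets borel \<and> finite_measure M \<and>
     (\<forall>h\<in>borel_measurable borel. \<forall>p. (\<forall>z\<in>eigenvalues A. poly p z = h z) \<longrightarrow>
        cinner v (poly_mat p A *v v) = (LINT z|M. h z)))"

text \<open>
  For a family \<open>A\<close> of \<open>n \<times> n\<close> matrices parametrized by \<open>S\<close> (a set of matrices, or an interval of
  times along a curve), \<open>\<theta> 1, \<dots>, \<theta> n\<close> label the \<open>n\<close> eigenvalues \<open>cis (\<theta> j x)\<close> of \<open>A x\<close> consistently,
  and \<open>\<mu> j x\<close> is the mass that the spectral measure of \<open>(A x, e1)\<close> gives to the \<open>j\<close>-th one.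
  Only continuity is demanded of the labelling; as the eigenvalues of a CMV matrix are simple, it
  then is as smooth as \<open>A\<close> is.
\<close>

definition spectral_labelling ::
  "('x::topological_space \<Rightarrow> 'n::{finite,linorder} cmat) \<Rightarrow> 'x set \<Rightarrow>
   (nat \<Rightarrow> 'x \<Rightarrow> real) \<Rightarrow> (nat \<Rightarrow> 'x \<Rightarrow> real) \<Rightarrow> bool" where
  "spectral_labelling A S \<theta> \<mu> \<longleftrightarrow>
     (\<forall>j\<in>{1..CARD('n)}. continuous_on S (\<theta> j)) \<and>
     (\<forall>x\<in>S. eigenvalues (A x) = (\<lambda>j. cis (\<theta> j x)) ` {1..CARD('n)}) \<and>
     (\<forall>x\<in>S. \<forall>j\<in>{1..CARD('n)}. \<mu> j x = measure (spectral_measure (A x) e1) {cis (\<theta> j x)})"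


subsection \<open>The Gelfand--Dikij bracket\<close>

definition antihermitian :: "('n::finite cmat) set" where
  "antihermitian = {A. \<forall>i j. A $ i $ j = - cnj (A $ j $ i)}"

definition lower_real_diag :: "('n::{finite,linorder} cmat) set" where
  "lower_real_diag = {A. (\<forall>i j. i < j \<longrightarrow> A $ i $ j = 0) \<and> (\<forall>i. A $ i $ i \<in> \<real>)}"

definition proj_l :: "'n::{finite,linorder} cmat \<Rightarrow> 'n cmat" where
  "proj_l X = (THE P. P \<in> lower_real_diag \<and> X - P \<in> antihermitian)"

definition proj_a :: "'n::{finite,linorder} cmat \<Rightarrow> 'n cmat" where
  "proj_a X = (THE P. P \<in> antihermitian \<and> X - P \<in> lower_real_diag)"

definition R_op :: "'n::{finite,linorder} cmat \<Rightarrow> 'n cmat" where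
  "R_op X = proj_l X - proj_a X"

definition pairing :: "'n::finite cmat \<Rightarrow> 'n cmat \<Rightarrow> real" where
  "pairing X Y = Im (trace (X ** Y))"

text \<open>
  \<open>X\<close> is a gradient at \<open>B\<close> of \<open>\<phi>\<close> as a function on \<open>S\<close>. For \<open>S = UNIV\<close> there is at most one, namely
  \<open>\<nabla>\<phi>\<close> at \<open>B\<close>. For a submanifold \<open>S\<close>, these \<open>X\<close> are the gradients at \<open>B\<close> of the extensions of \<open>\<phi>\<close>
  from \<open>S\<close> to all matrices.
\<close>

definition has_gradient_on ::
  "('n::{finite,linorder} cmat \<Rightarrow> real) \<Rightarrow> 'n cmat \<Rightarrow> 'n cmat \<Rightarrow>
   ('n cmat) set \<Rightarrow> bool" where
  "has_gradient_on \<phi> X B S \<longleftrightarrow> (\<phi> has_derivative (\<lambda>C. pairing X C)) (at B within S)"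

definition gd_bracket :: "'n::{finite,linorder} cmat \<Rightarrow> 'n cmat \<Rightarrow> 'n cmat \<Rightarrow> real"
  where
  "gd_bracket B X Y =
     1/2 * pairing (R_op (X ** B)) (Y ** B) - 1/2 * pairing (R_op (B ** X)) (B ** Y)"

text \<open>
  The bracket \<open>{\<phi>, \<psi>}\<close> of functions on \<open>S\<close> exists at \<open>B\<close> and has the value \<open>c\<close>: both functions are
  differentiable at \<open>B\<close>, and every way of extending them off \<open>S\<close> gives the value \<open>c\<close>. For
  \<open>S = UNIV\<close> this is the bracket on the space of all matrices, and for a Poisson submanifold \<open>S\<close>
  (such as a symplectic leaf) it is the restricted bracket.
\<close>

definition has_bracket_on ::
  "('n::{finite,linorder} cmat) set \<Rightarrow> ('n cmat \<Rightarrow> real) \<Rightarrow> ('n cmat \<Rightarrow> real) \<Rightarrow>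
   'n cmat \<Rightarrow> real \<Rightarrow> bool" where
  "has_bracket_on S \<phi> \<psi> B c \<longleftrightarrow>
     (\<exists>X. has_gradient_on \<phi> X B S) \<and> (\<exists>Y. has_gradient_on \<psi> Y B S) \<and>
     (\<forall>X Y. has_gradient_on \<phi> X B S \<longrightarrow> has_gradient_on \<psi> Y B S \<longrightarrow> gd_bracket B X Y = c)"

text \<open>The curve \<open>B\<close> on the time interval \<open>T\<close> satisfies \<open>\<psi>' = {\<phi>, \<psi>}\<close> for all \<open>\<psi>\<close>.\<close>

definition flow_curve ::
  "('n::{finite,linorder} cmat \<Rightarrow> real) \<Rightarrow> (real \<Rightarrow> 'n cmat) \<Rightarrow> real set \<Rightarrow> bool" where
  "flow_curve \<phi> B T \<longleftrightarrow>
     (\<forall>t\<in>T. \<forall>\<psi> c. has_bracket_on UNIV \<phi> \<psi> (B t) c \<longrightarrow>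
        ((\<lambda>s. \<psi> (B s)) has_real_derivative c) (at t within T))"

definition hamiltonian :: "complex poly \<Rightarrow> 'n::finite cmat \<Rightarrow> real" where
  "hamiltonian f B = Im (trace (poly_mat f B))"

definition F_fun :: "complex poly \<Rightarrow> complex \<Rightarrow> real" where
  "F_fun f z = 2 * Re (z * poly (pderiv f) z)"

end

theory Submission
  imports Defs "HOL-Computational_Algebra.Fundamental_Theorem_Algebra"
begin

text \<open>
  Writing the bracket as \<open>\<langle>\<nabla>\<psi>, V\<rangle>\<close> with a Hamiltonian vector field \<open>V\<close>, the gradient \<open>X = g(C)\<close> of a
  spectral function gives the Lax form \<open>V = [A, C]\<close> with \<open>A = \<pi>\<^sub>a(C g(C))\<close>. Hence the
  eigenprojections move by \<open>E\<^sub>j' = [A, E\<^sub>j]\<close>, and the corner entry \<open>\<mu>\<^sub>j\<close> of \<open>E\<^sub>j\<close> satisfies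
  \<open>\<mu>\<^sub>j' = (G\<^sub>j - \<Sum> G\<^sub>k \<mu>\<^sub>k) \<mu>\<^sub>j\<close> with \<open>G\<^sub>j = 2 Re (z\<^sub>j g(z\<^sub>j))\<close>, because the first row of \<open>A\<close> is that
  of \<open>C g(C)\<close> up to the diagonal entry. For the canonical relations, \<open>\<theta>\<^sub>l\<close> has the gradient
  \<open>E\<^sub>l / z\<^sub>l\<close>, which is again a polynomial in \<open>C\<close>.

  The bracket of functions on the CMV matrices does not depend on the extensions because every
  Hamiltonian vector field is tangent to the set of CMV matrices of fixed determinant. The bracket
  is multiplicative, so this reduces to the two factors of a CMV matrix, and by unitarity
  to their \<open>2 \<times> 2\<close> blocks, where it is a computation.
\<close>

text \<open>Two obstacles shape the argument. The labelling is only continuous and derivatives are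
  taken within a set that is not open, so the differentiability of \<theta> and \<mu> has to be
  produced by hand. An exact identity for eigenvalue differences supplies a slope that is continuous
  at the base point; the eigenprojections are Lagrange polynomials of the matrix with coefficients
  rational in the eigenvalues, and so inherit differentiability. The second obstacle is that a flow
  curve is known to be a CMV matrix only at time 0. Unitarity and the spectrum are carried along the
  curve by one conservation law: if \<open>A\<close> is antihermitian, then M' = [A, M] preserves
  the norm of M. It is applied to \<open>adj B ** B - mat 1\<close> and to the polynomial of
  \<open>B\<close> that vanishes on the initial spectrum. To keep everything inside one ring,
  eigenvectors appear as nonzero matrices \<open>M\<close> with
  \<open>A ** M = mat a ** M\<close>.\<close>

definition adj :: "'n::finite cmat \<Rightarrow> 'n cmat" where
  "adj A = (\<chi> i j. cnj (A $ j $ i))"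

lemma adj_nth [simp]: "adj A $ i $ j = cnj (A $ j $ i)"
  by (simp add: adj_def)

section \<open>Algebra of complex matrices and their adjoints\<close>

lemma cmat_eqI: "(\<And>i j. (A :: 'n::finite cmat) $ i $ j = B $ i $ j) \<Longrightarrow> A = B"
  by (simp add: vec_eq_iff)

lemma mult_nth: "(A ** B) $ i $ j = (\<Sum>k\<in>UNIV. A $ i $ k * B $ k $ j)"
  by (simp add: matrix_matrix_mult_def)

lemma mat_nth: "mat c $ i $ j = (if i = j then c else 0)"
  by (simp add: mat_def)

lemma mat_mult_nth [simp]: "(mat c ** A) $ i $ j = c * (A :: 'n::finite cmat) $ i $ j"
proof -
  have "(mat c ** A) $ i $ j = (\<Sum>k\<in>UNIV. if i = k then c * A $ k $ j else 0)"
    unfolding mult_nth mat_nth by (intro sum.cong refl) simp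
  then show ?thesis by simp
qed

lemma mult_mat_nth [simp]: "(A ** mat c) $ i $ j = c * (A :: 'n::finite cmat) $ i $ j"
proof -
  have "(A ** mat c) $ i $ j = (\<Sum>k\<in>UNIV. if k = j then c * A $ i $ k else 0)"
    unfolding mult_nth mat_nth by (intro sum.cong refl) simp
  then show ?thesis by simp
qed

lemma mat_commute: "A ** mat c = mat c ** (A :: 'n::finite cmat)"
  by (rule cmat_eqI) simp

lemma mat_left_commute: "(A :: 'n::finite cmat) ** (mat c ** B) = mat c ** (A ** (B :: 'n cmat))"
  by (simp only: matrix_mul_assoc mat_commute[of A])

lemma mat_mult_mat: "mat c ** mat d = (mat (c * d) :: 'n::finite cmat)"
  by (rule cmat_eqI) (simp add: mat_nth)

lemma mat_add: "mat (c + d) = (mat c + mat d :: 'n::finite cmat)"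
  by (rule cmat_eqI) (simp add: mat_nth)

lemma matrix_add_rdistrib: "(A + B :: 'n::finite cmat) ** C = A ** C + B ** (C :: 'n cmat)"
  by (rule cmat_eqI) (simp add: mult_nth algebra_simps sum.distrib)

lemma matrix_sub_ldistrib: "(A :: 'n::finite cmat) ** (B - C) = A ** B - A ** (C :: 'n cmat)"
  by (rule cmat_eqI) (simp add: mult_nth algebra_simps sum_subtractf)

lemma matrix_sub_rdistrib: "(A - B :: 'n::finite cmat) ** C = A ** C - B ** (C :: 'n cmat)"
  by (rule cmat_eqI) (simp add: mult_nth algebra_simps sum_subtractf)

lemma matrix_sum_ldistrib:
  "(A :: 'n::finite cmat) ** (\<Sum>x\<in>S. f x) = (\<Sum>x\<in>S. A ** (f x :: 'n cmat))"
  by (rule cmat_eqI) (simp add: mult_nth sum_distrib_left sum.swap[of _ S])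

lemma matrix_mult_0 [simp]: "A ** 0 = (0 :: 'n::finite cmat)" "0 ** A = (0 :: 'n::finite cmat)"
  by (simp_all add: vec_eq_iff mult_nth)

lemma matrix_minus_mult:
  fixes A B :: "'n::finite cmat"
  shows "(- A) ** B = - (A ** B)" "A ** (- B) = - (A ** B)"
  by (simp_all add: vec_eq_iff mult_nth sum_negf)

lemmas matrix_ring_simps = matrix_add_ldistrib matrix_add_rdistrib matrix_sub_ldistrib
  matrix_sub_rdistrib matrix_minus_mult matrix_mul_assoc

lemma adj_adj [simp]: "adj (adj A) = A"
  by (rule cmat_eqI) simp

lemma adj_mult: "adj (A ** B) = adj B ** adj A"
  by (rule cmat_eqI) (simp add: mult_nth mult.commute)

lemma adj_diff: "adj (A - B) = adj A - adj B"
  by (rule cmat_eqI) simp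

lemma adj_mat: "adj (mat c) = mat (cnj c)"
  by (rule cmat_eqI) (simp add: mat_nth)

lemma trace_mult: "trace (A ** B) = (\<Sum>i\<in>UNIV. \<Sum>j\<in>UNIV. A $ i $ j * B $ j $ i)"
  by (simp add: trace_def mult_nth)

lemma trace_mult_commute: "trace (A ** B) = trace (B ** (A :: 'n::finite cmat))"
  by (rule trace_mul_sym)

text \<open>The diagonal entries of \<open>adj A ** A\<close> are the squared norms of the columns
  of \<open>A\<close>. This definiteness replaces that of the scalar product once eigenvectors are
  matrices.\<close>

lemma adj_mult_self_eq_0: "adj A ** A = 0 \<longleftrightarrow> A = (0 :: 'n::finite cmat)"
proof
  assume h: "adj A ** A = 0"
  have "A $ i $ j = 0" for i j
  proof -
    have "(\<Sum>k\<in>UNIV. cnj (A $ k $ j) * A $ k $ j) = (adj A ** A) $ j $ j"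
      by (simp add: mult_nth)
    also have "\<dots> = 0" by (simp add: h)
    finally have "(\<Sum>k\<in>UNIV. (cmod (A $ k $ j))\<^sup>2) = (0 :: real)"
      by (metis (no_types, lifting) complex_norm_square mult.commute of_real_eq_0_iff of_real_sum sum.cong)
    then show ?thesis by (simp add: sum_nonneg_eq_0_iff)
  qed
  then show "A = 0" by (simp add: cmat_eqI)
qed simp

subsection \<open>Polynomials of matrices\<close>

lemma mat_power_0 [simp]: "mat_power A 0 = mat 1"
  by (simp add: mat_power_def)

lemma mat_power_Suc [simp]: "mat_power A (Suc k) = A ** mat_power A k"
  by (simp add: mat_power_def)

lemma poly_mat_0 [simp]: "poly_mat 0 A = 0"
  by (simp add: poly_mat_def)

lemma poly_mat_bound:
  assumes "degree p \<le> N"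
  shows "poly_mat p A = (\<Sum>k\<le>N. mat (coeff p k) ** mat_power A k)"
  unfolding poly_mat_def using assms
  by (intro sum.mono_neutral_left) (auto simp: coeff_eq_0 not_le)

lemma poly_mat_pCons: "poly_mat (pCons c p) A = mat c + A ** poly_mat p A"
proof -
  have "poly_mat (pCons c p) A = (\<Sum>k\<le>Suc (degree p). mat (coeff (pCons c p) k) ** mat_power A k)"
    by (rule poly_mat_bound) (simp add: degree_pCons_le)
  also have "\<dots> = mat c + A ** poly_mat p A"
    by (subst sum.atMost_Suc_shift)
      (simp add: poly_mat_def matrix_sum_ldistrib mat_left_commute)
  finally show ?thesis .
qed

lemma poly_mat_add: "poly_mat (p + q) A = poly_mat p A + poly_mat q A"
proof -
  let ?N = "max (degree p) (degree q)"
  have "poly_mat (p + q) A = (\<Sum>k\<le>?N. mat (coeff (p + q) k) ** mat_power A k)"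
    by (rule poly_mat_bound) (simp add: degree_add_le_max)
  then show ?thesis
    by (simp add: poly_mat_bound[of p ?N] poly_mat_bound[of q ?N] mat_add matrix_add_rdistrib
        sum.distrib)
qed

lemma poly_mat_smult: "poly_mat (smult c p) A = mat c ** poly_mat p A"
proof -
  have "poly_mat (smult c p) A = (\<Sum>k\<le>degree p. mat (coeff (smult c p) k) ** mat_power A k)"
    by (rule poly_mat_bound) (simp add: degree_smult_le)
  then show ?thesis
    by (simp add: poly_mat_def matrix_sum_ldistrib mat_mult_mat[symmetric] matrix_mul_assoc)
qed

lemma poly_mat_diff: "poly_mat (p - q) A = poly_mat p A - poly_mat q A"
proof -
  have "poly_mat (p - q) A + poly_mat q A = poly_mat (p - q + q) A"
    by (rule poly_mat_add[symmetric])
  then show ?thesis by (simp add: algebra_simps)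
qed

lemma poly_mat_mult: "poly_mat (p * q) A = poly_mat p A ** poly_mat q A"
  by (induction p) (simp_all add: poly_mat_pCons poly_mat_add poly_mat_smult matrix_ring_simps)

lemma poly_mat_1 [simp]: "poly_mat 1 A = mat 1"
  by (simp add: one_pCons poly_mat_pCons)

lemma poly_mat_sum: "poly_mat (\<Sum>x\<in>S. p x) A = (\<Sum>x\<in>S. poly_mat (p x) A)"
  by (induction S rule: infinite_finite_induct) (simp_all add: poly_mat_add)

lemma poly_mat_X: "poly_mat [:0, 1:] A = A"
  by (simp add: poly_mat_pCons)

lemma poly_mat_linear: "poly_mat [:c, 1:] A = mat c + A"
  by (simp add: poly_mat_pCons)

lemma poly_mat_commute: "poly_mat p A ** poly_mat q A = poly_mat q A ** poly_mat p A"
  by (metis mult.commute poly_mat_mult)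

subsection \<open>The projections and the bracket\<close>

lemma antihermitian_Int_lower_real_diag:
  assumes "Z \<in> antihermitian" "Z \<in> lower_real_diag"
  shows "Z = 0"
proof (rule cmat_eqI)
  fix i j
  have a: "Z $ i $ j = - cnj (Z $ j $ i)" for i j
    using assms(1) unfolding antihermitian_def by blast
  have b: "Z $ i $ j = 0" if "i < j" for i j
    using assms(2) that unfolding lower_real_diag_def by blast
  have c: "Im (Z $ i $ i) = 0" for i
    using assms(2) unfolding lower_real_diag_def complex_is_Real_iff by blast
  have d: "Re (Z $ i $ i) = 0" for i
    using arg_cong[OF a[of i i], of Re] by simp
  show "Z $ i $ j = 0 $ i $ j"
  proof (cases i j rule: linorder_cases)
    case less
    then show ?thesis by (simp add: b)
  next
    case equal
    then show ?thesis by (simp add: complex_eq_iff c d)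
  next
    case greater
    then show ?thesis using a[of i j] b[of j i] by simp
  qed
qed

lemma antihermitian_diff: "A \<in> antihermitian \<Longrightarrow> B \<in> antihermitian \<Longrightarrow> A - B \<in> antihermitian"
  unfolding antihermitian_def mem_Collect_eq
  by (metis (no_types, lifting) complex_cnj_diff minus_diff_minus vector_minus_component)

lemma lower_real_diag_diff:
  "A \<in> lower_real_diag \<Longrightarrow> B \<in> lower_real_diag \<Longrightarrow> A - B \<in> lower_real_diag"
  by (simp add: lower_real_diag_def)

lemma decomposition_unique:
  assumes "A \<in> antihermitian" "X - A \<in> lower_real_diag" "B \<in> antihermitian" "X - B \<in> lower_real_diag"
  shows "A = B"
proof -
  have "A - B = (X - B) - (X - A)" by simp
  then have "A - B = 0"
    using assms by (metis antihermitian_Int_lower_real_diag antihermitian_diff lower_real_diag_diff)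
  then show ?thesis by simp
qed

text \<open>The strict upper triangle of \<open>X\<close> can only come from the antihermitian
  summand, which then fixes the strict lower one by reflection; on the diagonal it takes the
  imaginary part.\<close>

lemma proj_a_eq:
  "proj_a X = (\<chi> i j. if i < j then X $ i $ j else if j < i then - cnj (X $ j $ i)
     else \<i> * complex_of_real (Im (X $ i $ i)))" (is "_ = ?A")
proof -
  have "?A \<in> antihermitian" "X - ?A \<in> lower_real_diag"
    by (auto simp: antihermitian_def lower_real_diag_def complex_is_Real_iff)
  then show ?thesis unfolding proj_a_def using decomposition_unique[of _ X ?A]
    by (intro the_equality) blast+
qed

lemma proj_l_eq: "proj_l X = X - proj_a X"
proof -
  have a: "proj_a X \<in> antihermitian" "X - proj_a X \<in> lower_real_diag"
    by (auto simp: proj_a_eq antihermitian_def lower_real_diag_def complex_is_Real_iff)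
  have "P = X - proj_a X" if "P \<in> lower_real_diag" "X - P \<in> antihermitian" for P
  proof -
    have h: "X - P = proj_a X"
      using a that by (intro decomposition_unique) simp_all
    show ?thesis by (simp flip: h)
  qed
  moreover have "X - (X - proj_a X) \<in> antihermitian"
    using a(1) by simp
  ultimately show ?thesis unfolding proj_l_def using a(2) by (intro the_equality conjI) blast+
qed

lemma proj_a_antihermitian: "adj (proj_a X) = - proj_a X"
  by (rule cmat_eqI) (auto simp: proj_a_eq)

lemma R_op_eq: "R_op X = X - proj_a X - proj_a X"
  by (simp add: R_op_def proj_l_eq)

text \<open>Above the diagonal R is the negative identity, below it R adds twice the adjoint, and on
  the diagonal Re - i Im is conjugation. The block computations use R in this form.\<close>

lemma R_op_nth: "R_op X $ i $ j = (if i < j then - (X $ i $ j)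
    else if j < i then X $ i $ j + 2 * cnj (X $ j $ i) else cnj (X $ i $ i))"
  by (auto simp: R_op_eq proj_a_eq complex_eq_iff)

text \<open>The Hamiltonian vector field at \<open>B\<close> of a function with gradient \<open>X\<close>.\<close>

definition ham :: "'n::{finite,linorder} cmat \<Rightarrow> 'n cmat \<Rightarrow> 'n cmat" where
  "ham X B = mat (1/2) ** (B ** R_op (X ** B) - R_op (B ** X) ** B)"

lemma pairing_commute: "pairing X Y = pairing Y X"
  by (simp add: pairing_def trace_mult_commute)

lemma pairing_diff_left: "pairing (X - X') Y = pairing X Y - pairing X' Y"
  by (simp add: pairing_def matrix_ring_simps trace_sub)

lemma pairing_diff_right: "pairing X (Y - Y') = pairing X Y - pairing X Y'"
  by (simp add: pairing_commute[of X] pairing_diff_left)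

lemma pairing_mult_assoc: "pairing (A ** B) C = pairing A (B ** C)"
  by (simp add: pairing_def matrix_mul_assoc)

lemma trace_half: "trace (mat (1/2) ** A) = trace (A :: 'n::finite cmat) / 2"
  by (simp add: trace_def sum_divide_distrib)

text \<open>Cyclicity of the trace isolates \<open>Y\<close>, so the bracket becomes the derivative
  of the second function along a vector field.\<close>

lemma gd_bracket_eq_ham: "gd_bracket B X Y = pairing Y (ham X B)"
proof -
  have "pairing (R_op (X ** B)) (Y ** B) = pairing Y (B ** R_op (X ** B))"
    by (metis pairing_commute pairing_mult_assoc)
  moreover have "pairing (R_op (B ** X)) (B ** Y) = pairing Y (R_op (B ** X) ** B)"
    by (metis pairing_commute pairing_mult_assoc)
  moreover have "pairing Y (ham X B) = 1/2 * pairing Y (B ** R_op (X ** B) - R_op (B ** X) ** B)"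
    unfolding ham_def pairing_def by (simp add: mat_left_commute trace_half)
  ultimately show ?thesis
    by (simp add: gd_bracket_def pairing_diff_right)
qed

text \<open>Both summands of the decomposition are isotropic for the pairing.\<close>

lemma pairing_R_op: "pairing (R_op A) D = - pairing A (R_op D)"
proof -
  have a: "pairing (proj_a A) (proj_a D) = 0"
  proof -
    have "trace (proj_a A ** proj_a D) = trace (adj (proj_a D ** proj_a A))"
      by (simp add: adj_mult proj_a_antihermitian matrix_minus_mult)
    also have "\<dots> = cnj (trace (proj_a D ** proj_a A))"
      by (simp add: trace_def)
    finally show ?thesis
      by (simp add: pairing_def trace_mult_commute[of "proj_a D"] complex_eq_iff)
  qed
  have l: "pairing (A - proj_a A) (D - proj_a D) = 0"
  proof -
    have "trace ((A - proj_a A) ** (D - proj_a D)) =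
      (\<Sum>i\<in>UNIV. \<Sum>j\<in>UNIV. if i = j then complex_of_real (Re (A $ i $ i) * Re (D $ i $ i)) else 0)"
      unfolding trace_mult
      by (intro sum.cong refl) (auto simp: proj_a_eq complex_eq_iff)
    then show ?thesis by (simp add: pairing_def)
  qed
  \<comment> \<open>With A = l + a and D = l' + a', the mixed terms of (l - a)(l' + a') + (l + a)(l'
    - a') cancel.\<close>
  have "pairing (R_op A) D + pairing A (R_op D) =
      2 * pairing (A - proj_a A) (D - proj_a D) - 2 * pairing (proj_a A) (proj_a D)"
    unfolding R_op_eq pairing_diff_left pairing_diff_right by simp
  with a l show ?thesis by simp
qed

lemma gd_bracket_antisym: "gd_bracket B X Y = - gd_bracket B Y X"
  unfolding gd_bracket_def using pairing_R_op[of "X ** B" "Y ** B"] pairing_R_op[of "B ** X" "B ** Y"]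
  by (simp add: pairing_commute)

text \<open>A function of the product \<open>L ** M\<close> with gradient \<open>X\<close> has the
  gradient \<open>M ** X\<close> in \<open>L\<close> and \<open>X ** L\<close> in \<open>M\<close>.
  The terms containing \<open>L ** R_op (M ** X ** L) ** M\<close> occur with opposite signs and
  cancel.\<close>

lemma ham_mult: "ham X (L ** M) = ham (M ** X) L ** M + L ** ham (X ** L) M"
proof -
  have "ham X (L ** M) = mat (1/2) ** ((L ** R_op (M ** X ** L) - R_op (L ** (M ** X)) ** L) ** M +
      L ** (M ** R_op (X ** L ** M) - R_op (M ** (X ** L)) ** M))"
    unfolding ham_def by (simp add: matrix_ring_simps)
  also have "\<dots> = ham (M ** X) L ** M + L ** ham (X ** L) M"
    unfolding ham_def matrix_add_ldistrib mat_left_commute[of L] by (simp only: matrix_mul_assoc)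
  finally show ?thesis .
qed

text \<open>R is the identity minus twice the antihermitian projection; the identity part drops out
  because \<open>B\<close> commutes with \<open>B ** X\<close>. This is the Lax form.\<close>

lemma ham_commuting:
  assumes "X ** B = B ** X"
  shows "ham X B = proj_a (B ** X) ** B - B ** proj_a (B ** X)"
proof -
  let ?P = "proj_a (B ** X)"
  have c: "B ** (B ** X) = B ** X ** B"
    by (simp add: assms flip: matrix_mul_assoc)
  have "B ** R_op (B ** X) - R_op (B ** X) ** B = mat 2 ** (?P ** B - B ** ?P)"
    unfolding R_op_eq matrix_sub_ldistrib matrix_sub_rdistrib c
    by (rule cmat_eqI) (simp add: matrix_sub_ldistrib)
  then show ?thesis
    by (simp add: ham_def assms matrix_mul_assoc mat_mult_mat)
qed

text \<open>Riesz representation: the real scalar product is Re tr, and the factor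
  \<open>\<i>\<close> turns the real part into the imaginary part of the pairing.\<close>

lemma linear_as_pairing:
  fixes g :: "'n::{finite,linorder} cmat \<Rightarrow> real"
  assumes "linear g"
  shows "\<exists>Y. g = pairing Y"
proof -
  define y where "y = adjoint g 1"
  have "g D = D \<bullet> y" for D
    using adjoint_works[OF assms, of D 1] by (simp add: y_def)
  moreover have "D \<bullet> y = pairing (mat \<i> ** adj y) D" for D
    unfolding pairing_commute[of _ D] unfolding pairing_def trace_mult
    by (simp add: inner_vec_def inner_complex_def algebra_simps)
  ultimately have "g = pairing (mat \<i> ** adj y)"
    by (intro ext) simp
  then show ?thesis by blast
qed

subsection \<open>Unitary matrices\<close>

definition unitary :: "'n::finite cmat \<Rightarrow> bool" where
  "unitary A \<longleftrightarrow> adj A ** A = mat 1 \<and> A ** adj A = mat 1"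

lemma unitary_mult:
  assumes "unitary A" "unitary B" shows "unitary (A ** B)"
proof -
  have "adj (A ** B) ** (A ** B) = adj B ** (adj A ** A) ** B"
    by (simp add: adj_mult matrix_mul_assoc)
  moreover have "A ** B ** adj (A ** B) = A ** (B ** adj B) ** adj A"
    by (simp add: adj_mult matrix_mul_assoc)
  ultimately show ?thesis using assms by (simp add: unitary_def)
qed

text \<open>A nonzero column of \<open>M\<close> is an eigenvector, and an eigenvector repeated in
  all columns is such an \<open>M\<close>.\<close>

lemma eigenvalues_iff:
  fixes A :: "'n::finite cmat"
  shows "a \<in> eigenvalues A \<longleftrightarrow> (\<exists>M :: 'n cmat. M \<noteq> 0 \<and> A ** M = mat a ** M)"
proof
  assume "a \<in> eigenvalues A"
  then obtain v where v: "v \<noteq> 0" "A *v v = a *s v" by (auto simp: eigenvalues_def)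
  define M :: "'n cmat" where "M = (\<chi> i j. v $ i)"
  have "M \<noteq> 0" using v(1) by (auto simp: M_def vec_eq_iff)
  moreover have "A ** M = mat a ** M"
  proof (rule cmat_eqI)
    fix i j
    have "(A ** M) $ i $ j = (A *v v) $ i"
      by (simp add: mult_nth matrix_vector_mult_def M_def)
    then show "(A ** M) $ i $ j = (mat a ** M) $ i $ j"
      by (simp add: v(2)) (simp add: M_def)
  qed
  ultimately show "\<exists>M :: 'n cmat. M \<noteq> 0 \<and> A ** M = mat a ** M" by blast
next
  assume "\<exists>M :: 'n cmat. M \<noteq> 0 \<and> A ** M = mat a ** M"
  then obtain M :: "'n cmat" where M: "M \<noteq> 0" "A ** M = mat a ** M" by blast
  then obtain i j where ij: "M $ i $ j \<noteq> 0" by (auto simp: vec_eq_iff)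
  define v where "v = (\<chi> i. M $ i $ j)"
  have "v \<noteq> 0" using ij by (auto simp: v_def vec_eq_iff)
  moreover have "A *v v = a *s v"
  proof -
    have "(A *v v) $ i = (A ** M) $ i $ j" for i
      by (simp add: mult_nth matrix_vector_mult_def v_def)
    then show ?thesis using M(2) by (simp add: vec_eq_iff v_def)
  qed
  ultimately show "a \<in> eigenvalues A" by (auto simp: eigenvalues_def)
qed

lemma mat_mult_eq_0: "mat c ** M = 0 \<longleftrightarrow> c = 0 \<or> M = (0 :: 'n::finite cmat)"
  by (auto simp: vec_eq_iff)

lemma mat_mult_mat_mult:
  fixes X Y :: "'n::finite cmat"
  shows "(mat c ** X) ** (mat d ** Y) = mat (c * d) ** (X ** Y)"
proof -
  have "(mat c ** X) ** (mat d ** Y) = mat c ** (X ** (mat d ** Y))"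
    by (simp only: matrix_mul_assoc)
  also have "\<dots> = mat c ** (mat d ** (X ** Y))"
    by (simp only: mat_left_commute[of X])
  finally show ?thesis by (simp only: matrix_mul_assoc mat_mult_mat)
qed

text \<open>Taking adjoints gives \<open>adj x ** adj A = mat (cnj a) ** adj x\<close>. Inserting
  \<open>adj A ** A = mat 1\<close> yields \<open>cnj a * a = 1\<close>, and then that
  \<open>adj x\<close> is a left eigenvector for the same \<open>a\<close>.\<close>

lemma unitary_eigen:
  assumes A: "unitary A" and x: "A ** x = mat a ** x" "x \<noteq> 0"
  shows "cmod a = 1" "adj x ** A = mat a ** adj x"
proof -
  have x0: "adj x ** x \<noteq> 0"
    using x(2) by (simp add: adj_mult_self_eq_0)
  have 1: "adj x ** adj A = mat (cnj a) ** adj x"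
    using arg_cong[OF x(1), of adj] by (simp add: adj_mult adj_mat mat_commute)
  have "adj x ** x = adj x ** (adj A ** A) ** x"
    using A by (simp add: unitary_def)
  also have "\<dots> = (adj x ** adj A) ** (A ** x)"
    by (simp only: matrix_mul_assoc)
  also have "\<dots> = mat (cnj a * a) ** (adj x ** x)"
    unfolding 1 x(1) by (rule mat_mult_mat_mult)
  finally have "mat (cnj a * a - 1) ** (adj x ** x) = 0"
    by (simp add: vec_eq_iff algebra_simps)
  then have a: "cnj a * a = 1"
    using x0 by (simp add: mat_mult_eq_0)
  then show "cmod a = 1"
    by (metis complex_norm_square mult.commute norm_ge_zero of_real_eq_1_iff power2_eq_1_iff
        one_neq_neg_one neg_0_le_iff_le not_one_le_zero)
  have "adj x = adj x ** (adj A ** A)"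
    using A by (simp add: unitary_def)
  also have "\<dots> = mat (cnj a) ** (adj x ** A)"
    by (simp add: matrix_mul_assoc 1)
  finally have "mat a ** adj x = mat (a * cnj a) ** (adj x ** A)"
    by (metis mat_mult_mat matrix_mul_assoc)
  then show "adj x ** A = mat a ** adj x"
    using a by (simp add: mult.commute)
qed

text \<open>No Jordan blocks: if w = (A - a) y is killed by A - a, then \<open>adj w\<close> is a
  left eigenvector by \<open>unitary_eigen\<close>, so \<open>adj w ** w\<close>, which is
  \<open>adj w\<close> times (A - a) y, vanishes.\<close>

lemma unitary_semisimple:
  fixes A y :: "'n::finite cmat"
  assumes A: "unitary A" and y: "(A - mat a) ** ((A - mat a) ** y) = 0"
  shows "(A - mat a) ** y = 0"
proof (rule ccontr)
  let ?x = "(A - mat a) ** y"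
  assume x: "?x \<noteq> 0"
  have e: "A ** ?x = mat a ** ?x"
    using y by (simp add: matrix_sub_rdistrib)
  have "adj ?x ** ?x = (adj ?x ** A) ** y - adj ?x ** (mat a ** y)"
    by (simp add: matrix_sub_rdistrib matrix_sub_ldistrib matrix_mul_assoc)
  also have "\<dots> = 0"
    unfolding unitary_eigen(2)[OF A e x] by (simp add: mat_commute[of "adj ?x"] matrix_mul_assoc)
  finally show False using x by (simp only: adj_mult_self_eq_0)
qed

section \<open>Annihilating polynomials and interpolation on the spectrum\<close>

lemma poly_mat_monom: "poly_mat (monom c k) A = mat c ** mat_power A k"
  by (induction k) (simp_all add: monom_0 monom_Suc poly_mat_pCons mat_left_commute)

text \<open>The matrices form a space of finite real dimension, so sufficiently many powers are
  dependent. Dependence is a property of sets, hence coinciding powers, which would shrink the set,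
  form a separate case.\<close>

lemma ex_annihilating_poly: "\<exists>p. p \<noteq> 0 \<and> poly_mat p (A :: 'n::finite cmat) = 0"
proof (cases "inj_on (mat_power A) {..DIM('n cmat)}")
  case True
  let ?N = "DIM('n cmat)" let ?S = "mat_power A ` {..?N}"
  have "card ?S = Suc ?N" using card_image[OF True] by simp
  then have "dependent ?S" by (intro dependent_biggerset) auto
  then obtain u v where u: "v \<in> ?S" "u v \<noteq> 0" "(\<Sum>v\<in>?S. u v *\<^sub>R v) = 0"
    by (auto simp: dependent_finite)
  define p where "p = (\<Sum>k\<le>?N. monom (complex_of_real (u (mat_power A k))) k)"
  from u(1) obtain k where k: "k \<le> ?N" "v = mat_power A k" by auto
  have "coeff p k = complex_of_real (u (mat_power A k))"
    using k(1) by (simp add: p_def coeff_sum)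
  then have "p \<noteq> 0" using u(2) k by auto
  moreover have "poly_mat p A = (\<Sum>k\<le>?N. u (mat_power A k) *\<^sub>R mat_power A k)"
    unfolding p_def poly_mat_sum poly_mat_monom
    by (intro sum.cong refl cmat_eqI) (simp add: scaleR_conv_of_real[where 'a = complex])
  moreover have "\<dots> = (\<Sum>v\<in>?S. u v *\<^sub>R v)"
    by (subst sum.reindex[OF True]) simp
  ultimately show ?thesis using u(3) by auto
next
  case False
  then obtain k l where kl: "k \<noteq> l" "mat_power A k = mat_power A l"
    by (auto simp: inj_on_def)
  let ?p = "monom 1 k - monom 1 l :: complex poly"
  have "coeff ?p k = 1" using kl(1) by simp
  then have "?p \<noteq> 0" by (metis coeff_0 zero_neq_one)
  moreover have "poly_mat ?p A = 0"
    by (simp add: poly_mat_diff poly_mat_monom kl(2))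
  ultimately show ?thesis by blast
qed

lemma poly_mat_eigen:
  fixes A M :: "'n::finite cmat"
  assumes "A ** M = mat a ** M"
  shows "poly_mat p A ** M = mat (poly p a) ** M"
proof (induction p)
  case (pCons c p)
  have "A ** poly_mat p A ** M = A ** (poly_mat p A ** M)"
    by (simp add: matrix_mul_assoc)
  also have "\<dots> = mat (a * poly p a) ** M"
    unfolding pCons(2) mat_left_commute[of A] assms
    by (simp only: matrix_mul_assoc mat_mult_mat mult.commute)
  finally show ?case
    by (simp add: poly_mat_pCons matrix_add_rdistrib mat_add)
qed simp

lemma finite_eigenvalues: "finite (eigenvalues (A :: 'n::finite cmat))"
proof -
  obtain p where p: "p \<noteq> 0" "poly_mat p A = 0" using ex_annihilating_poly by blast
  have "eigenvalues A \<subseteq> {a. poly p a = 0}"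
  proof
    fix a assume "a \<in> eigenvalues A"
    then obtain M :: "'n cmat" where "M \<noteq> 0" "A ** M = mat a ** M" by (auto simp: eigenvalues_iff)
    then show "a \<in> {a. poly p a = 0}"
      using poly_mat_eigen[of A M a p] p(2) by (simp add: mat_mult_eq_0)
  qed
  then show ?thesis using poly_roots_finite[OF p(1)] finite_subset by blast
qed

definition nodal :: "('a \<Rightarrow> complex) \<Rightarrow> 'a set \<Rightarrow> complex poly" where
  "nodal z J = (\<Prod>k\<in>J. [:- z k, 1:])"

text \<open>Lagrange basis polynomials, with the normalization distributed over the linear factors
  so that inductions over the product treat one node at a time.\<close>

definition lagr :: "('a \<Rightarrow> complex) \<Rightarrow> 'a set \<Rightarrow> 'a \<Rightarrow> complex poly" where
  "lagr z J j = (\<Prod>k\<in>J - {j}. smult (1 / (z j - z k)) [:- z k, 1:])"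

text \<open>Semisimplicity means that simple roots suffice. If the product w(A) of all A - a were a
  nonzero \<open>u\<close>, a minimal polynomial of \<open>u\<close> would have a root
  \<open>a\<close>, and its cofactor q would give x = q(A) u with (A - a) x = 0. Then
  \<open>a\<close> is an eigenvalue, so w already contains the factor A - a; thus x lies in both the
  kernel and the range of A - a, which forces x = 0.\<close>

lemma unitary_nodal:
  assumes A: "unitary A"
  shows "poly_mat (nodal id (eigenvalues A)) A = 0"
proof (rule ccontr)
  let ?w = "nodal id (eigenvalues A)"
  define u where "u = poly_mat ?w A"
  assume "poly_mat ?w A \<noteq> 0"
  then have u: "u \<noteq> 0" by (simp add: u_def)
  \<comment> \<open>Minimality is taken relative to \<open>u\<close>, not to \<open>A\<close>: the
    cofactor of a root then fails to annihilate \<open>u\<close>, which is what makes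
    \<open>x\<close> nonzero.\<close>
  define Q where "Q p \<longleftrightarrow> p \<noteq> 0 \<and> poly_mat p A ** u = 0" for p
  have "\<exists>p. Q p" using ex_annihilating_poly[of A] by (auto simp: Q_def)
  then obtain p where p: "Q p" "\<And>q. Q q \<Longrightarrow> degree p \<le> degree q"
    using ex_has_least_nat[of Q _ degree] by blast
  have "degree p \<noteq> 0"
  proof
    assume "degree p = 0"
    then obtain c where c: "p = [:c:]" by (metis degree_eq_zeroE)
    then have "mat c ** u = 0" using p(1) by (simp add: Q_def poly_mat_pCons)
    then show False using u p(1) c by (simp add: mat_mult_eq_0 Q_def)
  qed
  then obtain a where "poly p a = 0"
    using fundamental_theorem_of_algebra[of p] by (auto simp: constant_degree)
  then obtain q where q: "p = [:- a, 1:] * q" by (auto simp: poly_eq_0_iff_dvd)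
  have q0: "q \<noteq> 0" using p(1) q by (auto simp: Q_def)
  have "degree p = Suc (degree q)"
    using q0 unfolding q by (subst degree_mult_eq) auto
  then have "\<not> Q q" using p(2) by fastforce
  define x where "x = poly_mat q A ** u"
  have x: "x \<noteq> 0" using \<open>\<not> Q q\<close> q0 by (simp add: Q_def x_def)
  have l: "poly_mat [:- a, 1:] A = A - mat a"
    by (rule cmat_eqI) (simp add: poly_mat_linear mat_nth)
  have e: "(A - mat a) ** x = 0"
    using p(1) unfolding Q_def q poly_mat_mult l x_def by (simp add: matrix_mul_assoc)
  then have "A ** x = mat a ** x" by (simp add: matrix_sub_rdistrib)
  with x have "a \<in> eigenvalues A" by (auto simp: eigenvalues_iff)
  then have "?w = [:- a, 1:] * nodal id (eigenvalues A - {a})"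
    unfolding nodal_def by (subst prod.remove[of _ a]) (simp_all add: finite_eigenvalues)
  then have "u = (A - mat a) ** poly_mat (nodal id (eigenvalues A - {a})) A"
    unfolding u_def by (simp only: poly_mat_mult l)
  then have "x = poly_mat q A ** poly_mat [:- a, 1:] A ** poly_mat (nodal id (eigenvalues A - {a})) A"
    unfolding x_def l by (simp add: matrix_mul_assoc)
  also have "\<dots> = (A - mat a) ** (poly_mat q A ** poly_mat (nodal id (eigenvalues A - {a})) A)"
    unfolding poly_mat_commute[of q A "[:- a, 1:]"] unfolding l by (simp add: matrix_mul_assoc)
  finally have "x = (A - mat a) ** (poly_mat q A ** poly_mat (nodal id (eigenvalues A - {a})) A)" .
  with e have "x = 0" using unitary_semisimple[OF A] by metis
  with x show False ..
qed

lemma nodal_dvd: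
  assumes "finite J" "inj_on z J" "\<And>k. k \<in> J \<Longrightarrow> poly p (z k) = 0"
  shows "nodal z J dvd p"
  using assms
proof (induction J arbitrary: p)
  case (insert j J)
  obtain q where q: "p = [:- z j, 1:] * q"
    using insert.prems(2)[of j] by (auto simp: poly_eq_0_iff_dvd)
  have "poly q (z k) = 0" if "k \<in> J" for k
  proof -
    have "z k \<noteq> z j" using insert.prems(1) insert.hyps(2) that by (auto simp: inj_on_def)
    then show ?thesis using insert.prems(2)[of k] that by (simp add: q)
  qed
  then have "nodal z J dvd q" using insert by (simp add: inj_on_def)
  then show ?case
    unfolding nodal_def q prod.insert[OF insert.hyps] by (rule mult_dvd_mono[OF dvd_refl])
qed (simp add: nodal_def)

lemma poly_lagr:
  assumes "finite J" "inj_on z J" "j \<in> J" "m \<in> J"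
  shows "poly (lagr z J j) (z m) = (if j = m then 1 else 0)"
proof (cases "j = m")
  case True
  have "poly (smult (1 / (z j - z k)) [:- z k, 1:]) (z m) = 1" if "k \<in> J - {j}" for k
    using that assms True by (auto simp: inj_on_def divide_simps)
  then show ?thesis using True unfolding lagr_def poly_prod by simp
next
  case False
  then have "\<exists>k\<in>J - {j}. poly (smult (1 / (z j - z k)) [:- z k, 1:]) (z m) = 0"
    using assms by (intro bexI[of _ m]) auto
  then show ?thesis using False assms by (simp add: lagr_def poly_prod del: poly_smult)
qed

subsection \<open>Spectral resolution of a unitary matrix\<close>

definition first :: "'n::{finite,linorder}" where
  "first = Min UNIV"

lemma pos_eq_0_iff: "pos i = 0 \<longleftrightarrow> i = first"
proof
  assume "pos i = 0"
  then have "\<not> k < i" for k by (auto simp: pos_def)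
  then show "i = first"
    by (metis Min_eqI UNIV_I finite first_def leI)
next
  assume "i = first"
  then have "{k. k < i} = {}" by (auto simp: first_def not_less)
  then show "pos i = 0" by (simp add: pos_def)
qed

lemma cinner_e1: "cinner e1 (A *v e1) = A $ first $ first"
  by (simp add: cinner_def e1_def matrix_vector_mult_def pos_eq_0_iff if_distrib if_distribR
      cong: if_cong)

text \<open>The index type is left open: indexed by itself through \<open>id\<close>, the spectrum
  can be counted, and indexed by \<open>{1..CARD('n)}\<close> it serves a given labelling.\<close>

locale unitary_spectrum =
  fixes A :: "'n::{finite,linorder} cmat" and J :: "'j set" and z :: "'j \<Rightarrow> complex"
  assumes unitary: "unitary A" and finite_J: "finite J" and inj: "inj_on z J"
    and eigenvalues: "eigenvalues A = z ` J"
begin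

text \<open>The eigenprojections. As polynomials in \<open>A\<close> they commute with it and with
  each other, and they can be differentiated.\<close>

definition P :: "'j \<Rightarrow> 'n cmat" where
  "P j = poly_mat (lagr z J j) A"

text \<open>Polynomials that agree on the spectrum differ by a multiple of the nodal polynomial,
  which annihilates \<open>A\<close>. The algebra of the projections thereby reduces to
  interpolation values.\<close>

lemma poly_mat_cong:
  assumes "\<And>k. k \<in> J \<Longrightarrow> poly p (z k) = poly q (z k)"
  shows "poly_mat p A = poly_mat q A"
proof -
  have "nodal z J = nodal id (eigenvalues A)"
    by (simp add: nodal_def eigenvalues prod.reindex[OF inj])
  then have "poly_mat (nodal z J) A = 0" by (simp add: unitary_nodal unitary)
  moreover have "nodal z J dvd p - q"
    using assms by (intro nodal_dvd finite_J inj) simp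
  ultimately have "poly_mat (p - q) A = 0"
    by (auto simp: dvd_def poly_mat_mult)
  then show ?thesis by (simp add: poly_mat_diff)
qed

lemma poly_mat_P: "j \<in> J \<Longrightarrow> poly_mat p A ** P j = mat (poly p (z j)) ** P j"
  unfolding P_def poly_mat_mult[symmetric] poly_mat_smult[symmetric]
  by (rule poly_mat_cong) (simp add: poly_lagr finite_J inj)

lemma A_P: "j \<in> J \<Longrightarrow> A ** P j = mat (z j) ** P j"
  using poly_mat_P[of j "[:0, 1:]"] by (simp add: poly_mat_X)

lemma P_commute: "P j ** poly_mat p A = poly_mat p A ** P j"
  unfolding P_def by (rule poly_mat_commute)

lemma P_P: "j \<in> J \<Longrightarrow> k \<in> J \<Longrightarrow> P k ** P j = (if j = k then P j else 0)"
  using poly_mat_P[of j "lagr z J k"] by (simp add: P_def[symmetric] poly_lagr finite_J inj)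

lemma poly_mat_sum_P: "poly_mat p A = (\<Sum>j\<in>J. mat (poly p (z j)) ** P j)"
proof -
  have "poly_mat p A = poly_mat (\<Sum>j\<in>J. smult (poly p (z j)) (lagr z J j)) A"
    by (rule poly_mat_cong)
      (simp add: poly_sum poly_lagr finite_J inj if_distrib cong: if_cong)
  then show ?thesis by (simp add: poly_mat_sum poly_mat_smult P_def)
qed

lemma sum_P: "(\<Sum>j\<in>J. P j) = mat 1"
  using poly_mat_sum_P[of 1] unfolding poly_mat_1 poly_1 matrix_mul_lid by (rule sym)

lemma eigenvector:
  assumes "j \<in> J"
  shows "\<exists>M :: 'n cmat. M \<noteq> 0 \<and> A ** M = mat (z j) ** M"
proof -
  have "z j \<in> eigenvalues A" using assms by (simp add: eigenvalues)
  then show ?thesis by (simp only: eigenvalues_iff)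
qed

lemma norm_z: "j \<in> J \<Longrightarrow> cmod (z j) = 1"
  using eigenvector[of j] unitary_eigen(1)[OF unitary] by blast

lemma P_nonzero: "j \<in> J \<Longrightarrow> P j \<noteq> 0"
proof
  assume j: "j \<in> J" "P j = 0"
  obtain M :: "'n cmat" where M: "M \<noteq> 0" "A ** M = mat (z j) ** M" using eigenvector[OF j(1)] by blast
  have "P j ** M = M"
    unfolding P_def poly_mat_eigen[OF M(2)] using j(1) by (simp add: poly_lagr finite_J inj)
  with M(1) j(2) show False by simp
qed

lemma P_orthogonal:
  assumes "j \<in> J" "k \<in> J" "j \<noteq> k"
  shows "adj (P j) ** P k = 0"
proof -
  have "mat (z j) ** (adj (P j) ** P k) = mat (z k) ** (adj (P j) ** P k)"
  proof -
    have "mat (z j) ** (adj (P j) ** P k) = adj (P j) ** (A ** P k)"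
      using unitary_eigen(2)[OF unitary A_P[OF assms(1)] P_nonzero[OF assms(1)]]
      by (simp add: matrix_mul_assoc)
    then show ?thesis by (simp add: A_P assms mat_left_commute)
  qed
  then have "mat (z j - z k) ** (adj (P j) ** P k) = 0"
    by (simp add: vec_eq_iff algebra_simps)
  moreover have "z j \<noteq> z k" using assms inj by (auto simp: inj_on_def)
  ultimately show ?thesis by (simp add: mat_mult_eq_0)
qed

text \<open>By orthogonality, multiplying \<open>adj (P j)\<close> by the resolution of the identity
  leaves only \<open>adj (P j) ** P j\<close>, which is its own adjoint.\<close>

lemma P_hermitian:
  assumes "j \<in> J" shows "adj (P j) = P j" "adj (P j) ** P j = P j"
proof -
  have "adj (P j) = adj (P j) ** (\<Sum>k\<in>J. P k)" by (simp add: sum_P)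
  also have "\<dots> = (\<Sum>k\<in>J. if k = j then adj (P j) ** P j else 0)"
    unfolding matrix_sum_ldistrib using assms by (intro sum.cong refl) (auto simp: P_orthogonal)
  finally have 1: "adj (P j) = adj (P j) ** P j" using assms finite_J by simp
  have "P j = adj (adj (P j) ** P j)"
    by (subst 1[symmetric]) simp
  also have "\<dots> = adj (P j)" by (subst (2) 1) (simp add: adj_mult)
  finally show "adj (P j) = P j" by simp
  with 1 show "adj (P j) ** P j = P j" by simp
qed

definition mass :: "'j \<Rightarrow> real" where
  "mass j = Re (P j $ first $ first)"

lemma P_first:
  assumes "j \<in> J"
  shows "P j $ first $ first = complex_of_real (mass j)"
    "mass j = (\<Sum>i\<in>UNIV. (cmod (P j $ i $ first))\<^sup>2)"
proof -
  have "P j $ first $ first = (adj (P j) ** P j) $ first $ first"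
    by (simp only: P_hermitian(2) assms)
  also have "\<dots> = complex_of_real (\<Sum>i\<in>UNIV. (cmod (P j $ i $ first))\<^sup>2)"
    unfolding mult_nth of_real_sum complex_norm_square by (simp add: mult.commute)
  finally show "P j $ first $ first = complex_of_real (mass j)"
    "mass j = (\<Sum>i\<in>UNIV. (cmod (P j $ i $ first))\<^sup>2)"
    by (simp_all add: mass_def)
qed

lemma mass_nonneg: "j \<in> J \<Longrightarrow> mass j \<ge> 0"
  by (simp add: P_first(2) sum_nonneg)

lemma sum_mass: "(\<Sum>j\<in>J. mass j) = 1"
proof -
  have "(\<Sum>j\<in>J. mass j) = Re ((\<Sum>j\<in>J. P j) $ first $ first)"
    by (simp add: mass_def)
  then show ?thesis by (simp add: sum_P mat_nth)
qed

lemma cinner_poly_mat: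
  "cinner e1 (poly_mat p A *v e1) = (\<Sum>j\<in>J. mass j *\<^sub>R poly p (z j))"
  unfolding cinner_e1 by (subst poly_mat_sum_P) (simp add: P_first scaleR_conv_of_real mult.commute)

text \<open>The spectral resolution gives the integral identity for the point masses. Uniqueness,
  which \<open>THE\<close> demands, comes from testing with indicator functions.\<close>

lemma spectral_measure_eq:
  "spectral_measure A e1 = distr (point_measure J mass) borel z" (is "_ = ?M")
proof -
  have meas: "z \<in> measurable (point_measure J mass) borel"
    by (simp add: point_measure_def)
  have fin: "finite_measure (point_measure J mass)"
    by (intro finite_measureI) (simp add: emeasure_point_measure_finite finite_J space_point_measure)
  have int: "(LINT x|?M. h x) = (\<Sum>j\<in>J. mass j *\<^sub>R h (z j))"
    if "h \<in> borel_measurable borel" for h :: "complex \<Rightarrow> complex"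
    using integral_distr[OF meas that]
    by (simp add: lebesgue_integral_point_measure_finite finite_J mass_nonneg)
  have fM: "finite_measure ?M" by (rule finite_measure.finite_measure_distr[OF fin meas])
  have M: "sets ?M = sets borel \<and> finite_measure ?M \<and>
     (\<forall>h\<in>borel_measurable borel. \<forall>p. (\<forall>z\<in>eigenvalues A. poly p z = h z) \<longrightarrow>
        cinner e1 (poly_mat p A *v e1) = (LINT z|?M. h z))"
    using fM by (auto simp: int cinner_poly_mat eigenvalues)
  have "N = ?M" if N: "sets N = sets borel \<and> finite_measure N \<and>
     (\<forall>h\<in>borel_measurable borel. \<forall>p. (\<forall>z\<in>eigenvalues A. poly p z = h z) \<longrightarrow>
        cinner e1 (poly_mat p A *v e1) = (LINT z|N. h z))" for N
  proof (rule measure_eqI)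
    show "sets N = sets ?M" using N by simp
    interpret N: finite_measure N using N by blast
    interpret M: finite_measure ?M by (rule fM)
    fix B assume "B \<in> sets N"
    then have B: "B \<in> sets borel" using N by simp
    let ?h = "indicator B :: complex \<Rightarrow> complex"
    \<comment> \<open>Interpolates the indicator of \<open>B\<close> on the spectrum, so that the
      defining identity of the measures can be applied to it.\<close>
    define p where "p = (\<Sum>j\<in>J. smult (?h (z j)) (lagr z J j))"
    have h: "?h \<in> borel_measurable borel" using B by simp
    have "\<forall>a\<in>eigenvalues A. poly p a = ?h a"
      by (auto simp: eigenvalues p_def poly_sum poly_lagr finite_J inj if_distrib cong: if_cong)
    then have "(LINT z|N. ?h z) = (LINT z|?M. ?h z)"
      using N M h by metis
    moreover have ind: "(LINT z|K. ?h z) = complex_of_real (measure K B)" if "space K = UNIV" for K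
    proof -
      have "?h = (\<lambda>x. complex_of_real (indicator B x))"
        by (simp add: fun_eq_iff indicator_def)
      then show ?thesis using that by (simp only: integral_complex_of_real) simp
    qed
    have "space N = UNIV" "space ?M = UNIV"
      using sets_eq_imp_space_eq[of N borel] N by simp_all
    note ind[OF this(1)] ind[OF this(2)]
    ultimately show "emeasure N B = emeasure ?M B"
      by (simp add: N.emeasure_eq_measure M.emeasure_eq_measure)
  qed
  with M show ?thesis unfolding spectral_measure_def by (intro the_equality) blast+
qed

lemma measure_spectral_measure:
  assumes "j \<in> J" shows "measure (spectral_measure A e1) {z j} = mass j"
proof -
  have "z -` {z j} \<inter> J = {j}" using assms inj by (auto simp: inj_on_def)
  moreover have "z \<in> measurable (point_measure J mass) borel"
    by (simp add: point_measure_def)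
  ultimately have "emeasure (spectral_measure A e1) {z j} = emeasure (point_measure J mass) {j}"
    by (simp add: spectral_measure_eq emeasure_distr space_point_measure)
  also have "\<dots> = ennreal (mass j)"
    using assms finite_J by (simp add: emeasure_point_measure_finite)
  finally show ?thesis using mass_nonneg[OF assms] by (simp add: measure_def)
qed

text \<open>The derivative of the masses along \<open>[proj_a G, \<cdot>]\<close> only sees the first row of \<open>G\<close>.\<close>

lemma commutator_first:
  assumes j: "j \<in> J"
  shows "Re ((proj_a (poly_mat g A) ** P j - P j ** proj_a (poly_mat g A)) $ first $ first) =
    (2 * Re (poly g (z j)) - (\<Sum>k\<in>J. 2 * Re (poly g (z k)) * mass k)) * mass j"
proof -
  let ?G = "poly_mat g A" let ?o = "first :: 'n"
  have lt: "?o < i" if "i \<noteq> ?o" for i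
    using that by (metis Min_le UNIV_I finite first_def order_le_imp_less_or_eq)
  have herm: "P j $ ?o $ i = cnj (P j $ i $ ?o)" for i
    using P_hermitian(1)[OF j] by (metis adj_nth)
  have "(proj_a ?G ** P j - P j ** proj_a ?G) $ ?o $ ?o =
    (\<Sum>i\<in>UNIV. proj_a ?G $ ?o $ i * P j $ i $ ?o - P j $ ?o $ i * proj_a ?G $ i $ ?o)"
    by (simp add: mult_nth sum_subtractf)
  \<comment> \<open>In its first row \<open>proj_a ?G\<close> agrees with \<open>?G\<close> off the
    diagonal, and its first column is minus the conjugate of that; hence each term is a number plus
    its conjugate. At \<open>i = ?o\<close> the two products cancel, which the subtracted correction
    records.\<close>
  also have "\<dots> = (\<Sum>i\<in>UNIV. (?G $ ?o $ i * P j $ i $ ?o + cnj (?G $ ?o $ i * P j $ i $ ?o)) -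
      (if i = ?o then ?G $ ?o $ ?o * P j $ ?o $ ?o + cnj (?G $ ?o $ ?o * P j $ ?o $ ?o) else 0))"
  proof (intro sum.cong refl)
    fix i
    show "proj_a ?G $ ?o $ i * P j $ i $ ?o - P j $ ?o $ i * proj_a ?G $ i $ ?o =
      (?G $ ?o $ i * P j $ i $ ?o + cnj (?G $ ?o $ i * P j $ i $ ?o)) -
      (if i = ?o then ?G $ ?o $ ?o * P j $ ?o $ ?o + cnj (?G $ ?o $ ?o * P j $ ?o $ ?o) else 0)"
    proof (cases "i = ?o")
      case False
      then have "?o < i" "\<not> i < ?o" using lt[of i] by auto
      then show ?thesis using False herm[of i] by (simp add: proj_a_eq)
    qed (simp add: proj_a_eq)
  qed
  also have "\<dots> = ((?G ** P j) $ ?o $ ?o + cnj ((?G ** P j) $ ?o $ ?o)) -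
      (?G $ ?o $ ?o * P j $ ?o $ ?o + cnj (?G $ ?o $ ?o * P j $ ?o $ ?o))"
    by (simp add: sum_subtractf sum.distrib mult_nth)
  finally have "Re ((proj_a ?G ** P j - P j ** proj_a ?G) $ ?o $ ?o) =
      2 * Re ((?G ** P j) $ ?o $ ?o) - 2 * Re (?G $ ?o $ ?o) * mass j"
    by (simp add: P_first j)
  moreover have "Re ((?G ** P j) $ ?o $ ?o) = Re (poly g (z j)) * mass j"
    by (simp add: poly_mat_P j P_first)
  moreover have "Re (?G $ ?o $ ?o) = (\<Sum>k\<in>J. Re (poly g (z k)) * mass k)"
    by (subst poly_mat_sum_P) (simp add: P_first)
  ultimately show ?thesis
    by (simp add: sum_distrib_left algebra_simps)
qed

end

subsection \<open>The factors of a CMV matrix\<close>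

lemma pos_less_iff: "pos i < pos j \<longleftrightarrow> i < (j :: 'n::{finite,linorder})"
proof -
  have less: "pos i < pos j" if "i < j" for i j :: 'n
    unfolding pos_def using that by (intro psubset_card_mono) auto
  show ?thesis using less[of i j] less[of j i]
    by (metis less_asym linorder_neqE)
qed

lemma pos_eq_iff: "pos i = pos j \<longleftrightarrow> i = j"
  by (metis less_irrefl linorder_neqE pos_less_iff)

lemma pos_less_card: "pos (i :: 'n::{finite,linorder}) < CARD('n)"
  unfolding pos_def by (intro psubset_card_mono) auto

lemma ex_pos: "k < CARD('n) \<Longrightarrow> \<exists>i :: 'n::{finite,linorder}. pos i = k"
proof -
  have "inj (pos :: 'n \<Rightarrow> nat)" by (simp add: inj_on_def pos_eq_iff)
  then have "card (range (pos :: 'n \<Rightarrow> nat)) = CARD('n)" by (rule card_image)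
  then have "range (pos :: 'n \<Rightarrow> nat) = {..<CARD('n)}"
    by (intro card_subset_eq) (auto simp: pos_less_card)
  then show "k < CARD('n) \<Longrightarrow> \<exists>i :: 'n. pos i = k"
    by (metis lessThan_iff rangeE)
qed

text \<open>\<open>fac Q \<alpha>\<close> has the blocks \<open>\<Xi>\<^sub>k\<close> with \<open>Q k\<close>: it is \<open>\<L>\<close> for \<open>Q = even\<close> and \<open>\<M>\<close> for \<open>Q = odd\<close>.\<close>

definition fac :: "(nat \<Rightarrow> bool) \<Rightarrow> (nat \<Rightarrow> complex) \<Rightarrow> 'n::{finite,linorder} cmat" where
  "fac Q \<alpha> = (\<chi> i j. (if \<not> Q 0 \<and> pos i = 0 \<and> pos j = 0 then 1 else 0) +
                    (\<Sum>k | k < CARD('n) \<and> Q k. Xi_at \<alpha> k (pos i) (pos j)))"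

definition alternating :: "(nat \<Rightarrow> bool) \<Rightarrow> bool" where
  "alternating Q \<longleftrightarrow> (\<forall>k. Q (Suc k) \<longleftrightarrow> \<not> Q k)"

lemma alternating_even: "alternating even" and alternating_odd: "alternating odd"
  by (simp_all add: alternating_def)

lemma cmv_eq_fac: "cmv \<alpha> = fac even \<alpha> ** (fac odd \<alpha> :: 'n::{finite,linorder} cmat)"
proof -
  have "cmv_L \<alpha> = (fac even \<alpha> :: 'n cmat)" by (simp add: cmv_L_def fac_def)
  moreover have "cmv_M \<alpha> = (fac odd \<alpha> :: 'n cmat)" by (simp add: cmv_M_def fac_def)
  ultimately show ?thesis by (simp add: cmv_def)
qed

definition pair :: "(nat \<Rightarrow> bool) \<Rightarrow> 'n::{finite,linorder} \<Rightarrow> 'n \<Rightarrow> bool" where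
  "pair Q i j \<longleftrightarrow> Q (pos i) \<and> pos j = Suc (pos i)"

text \<open>The blocks of size 1: the leading \<open>\<Xi>\<^sub>-\<^sub>1 = [1]\<close>, present
  when the blocks of \<open>Q\<close> start at 1, and the truncated last block.\<close>

definition single :: "(nat \<Rightarrow> bool) \<Rightarrow> 'n::{finite,linorder} \<Rightarrow> bool" where
  "single Q i \<longleftrightarrow> \<not> Q 0 \<and> pos i = 0 \<or> Q (pos i) \<and> Suc (pos i) = CARD('n)"

text \<open>Every index lies in some block; this is the case distinction behind the entrywise
  computations with a factor.\<close>

lemma block_cases:
  fixes i :: "'n::{finite,linorder}"
  assumes "alternating Q"
  obtains (first) j where "pair Q i j" | (second) j where "pair Q j i" | (single) "single Q i"
proof (cases "Q (pos i)")
  case True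
  show ?thesis
  proof (cases "Suc (pos i) = CARD('n)")
    case True
    with \<open>Q (pos i)\<close> that(3) show ?thesis by (simp add: single_def)
  next
    case False
    then have "Suc (pos i) < CARD('n)" using pos_less_card[of i] by simp
    then obtain j :: 'n where "pos j = Suc (pos i)" using ex_pos by blast
    with True that(1) show ?thesis by (simp add: pair_def)
  qed
next
  case False
  show ?thesis
  proof (cases "pos i")
    case 0
    with False that(3) show ?thesis by (simp add: single_def)
  next
    case (Suc m)
    then have "m < CARD('n)" using pos_less_card[of i] by simp
    then obtain j :: 'n where "pos j = m" using ex_pos by blast
    moreover have "Q m" using False Suc assms by (simp add: alternating_def)
    ultimately show ?thesis using Suc that(2)[of j] by (simp add: pair_def)
  qed
qed

lemma Xi_at_sym: "Xi_at \<alpha> k r s = Xi_at \<alpha> k s r"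
  by (cases "r = k"; cases "s = k"; cases "r = k + 1"; cases "s = k + 1") (simp_all add: Xi_at_def)

lemma fac_sym: "fac Q \<alpha> $ i $ j = fac Q \<alpha> $ j $ i"
proof -
  have "Xi_at \<alpha> k (pos i) (pos j) = Xi_at \<alpha> k (pos j) (pos i)" for k
    by (rule Xi_at_sym)
  then show ?thesis
    by (cases "pos i = 0"; cases "pos j = 0") (simp_all add: fac_def)
qed

lemma fac_cong:
  assumes "\<And>k. k < CARD('n) \<Longrightarrow> Q k \<Longrightarrow> \<alpha> k = \<beta> k"
  shows "fac Q \<alpha> = (fac Q \<beta> :: 'n::{finite,linorder} cmat)"
proof (rule cmat_eqI)
  fix i j :: 'n
  have "Xi_at \<alpha> k r s = Xi_at \<beta> k r s" if "k < CARD('n)" "Q k" for k r s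
    using assms[OF that] by (simp add: Xi_at_def rho_def)
  then show "fac Q \<alpha> $ i $ j = fac Q \<beta> $ i $ j"
    by (simp add: fac_def)
qed

text \<open>The factors are symmetric, so the adjoint only conjugates entries, and
  \<open>rho\<close> depends on the modulus alone.\<close>

lemma adj_fac: "adj (fac Q \<alpha>) = fac Q (\<lambda>k. cnj (\<alpha> k))"
proof (rule cmat_eqI)
  fix i j
  have "cnj (Xi_at \<alpha> k r s) = Xi_at (\<lambda>k. cnj (\<alpha> k)) k r s" for k r s
    by (simp add: Xi_at_def rho_def)
  moreover have "adj (fac Q \<alpha>) $ i $ j = cnj (fac Q \<alpha> $ i $ j)"
    by (simp add: fac_sym)
  ultimately show "adj (fac Q \<alpha>) $ i $ j = fac Q (\<lambda>k. cnj (\<alpha> k)) $ i $ j"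
    by (simp add: fac_def)
qed

lemma fac_row1:
  assumes "alternating Q" "Q (pos i)"
  shows "fac Q \<alpha> $ i $ j = Xi_at \<alpha> (pos i) (pos i) (pos (j :: 'n::{finite,linorder}))"
proof -
  let ?S = "{k. k < CARD('n) \<and> Q k}"
  have "pos i \<noteq> Suc k" if "Q k" for k using assms that by (metis alternating_def)
  then have "(\<Sum>k\<in>?S. Xi_at \<alpha> k (pos i) (pos j)) = (\<Sum>k\<in>{pos i}. Xi_at \<alpha> k (pos i) (pos j))"
    using assms pos_less_card[of i] by (intro sum.mono_neutral_right) (auto simp: Xi_at_def)
  moreover have "\<not> (\<not> Q 0 \<and> pos i = 0 \<and> pos j = 0)" using assms(2) by metis
  ultimately show ?thesis by (simp add: fac_def)
qed

lemma fac_row2: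
  assumes "alternating Q" "Q m" "pos i = Suc m"
  shows "fac Q \<alpha> $ i $ j = Xi_at \<alpha> m (Suc m) (pos (j :: 'n::{finite,linorder}))"
proof -
  let ?S = "{k. k < CARD('n) \<and> Q k}"
  have "\<not> Q (Suc m)" using assms by (simp add: alternating_def)
  then have "(\<Sum>k\<in>?S. Xi_at \<alpha> k (pos i) (pos j)) = (\<Sum>k\<in>{m}. Xi_at \<alpha> k (pos i) (pos j))"
    using assms pos_less_card[of i] by (intro sum.mono_neutral_right) (auto simp: Xi_at_def)
  then show ?thesis using assms by (simp add: fac_def)
qed

lemma fac_pair:
  fixes i j :: "'n::{finite,linorder}"
  assumes "alternating Q" "pair Q i j"
  shows "fac Q \<alpha> $ i $ s = (if s = i then cnj (\<alpha> (pos i)) else if s = j then complex_of_real (rho \<alpha> (pos i)) else 0)"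
    and "fac Q \<alpha> $ j $ s = (if s = i then complex_of_real (rho \<alpha> (pos i)) else if s = j then - \<alpha> (pos i) else 0)"
proof -
  have Q: "Q (pos i)" "pos j = Suc (pos i)" using assms(2) by (simp_all add: pair_def)
  have s: "s = i \<longleftrightarrow> pos s = pos i" "s = j \<longleftrightarrow> pos s = Suc (pos i)"
    using Q by (metis pos_eq_iff)+
  show "fac Q \<alpha> $ i $ s = (if s = i then cnj (\<alpha> (pos i)) else if s = j then complex_of_real (rho \<alpha> (pos i)) else 0)"
    unfolding fac_row1[OF assms(1) Q(1)] s by (simp add: Xi_at_def)
  show "fac Q \<alpha> $ j $ s = (if s = i then complex_of_real (rho \<alpha> (pos i)) else if s = j then - \<alpha> (pos i) else 0)"
    unfolding fac_row2[OF assms(1) Q] s by (simp add: Xi_at_def)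
qed

lemma fac_single:
  fixes i :: "'n::{finite,linorder}"
  assumes "alternating Q" "single Q i"
  shows "fac Q \<alpha> $ i $ s = (if s = i then if Q (pos i) then cnj (\<alpha> (CARD('n) - 1)) else 1 else 0)"
proof (cases "Q (pos i)")
  case True
  have n: "Suc (pos i) = CARD('n)" using assms(2) True by (auto simp: single_def)
  then have p: "CARD('n) - 1 = pos i" by linarith
  have "s = i \<longleftrightarrow> pos s = pos i" by (metis pos_eq_iff)
  moreover have "pos s \<noteq> Suc (pos i)" using n pos_less_card[of s] by simp
  ultimately show ?thesis
    unfolding fac_row1[OF assms(1) True] p using True by (simp add: Xi_at_def)
next
  case False
  then have i: "\<not> Q 0" "pos i = 0" using assms(2) by (auto simp: single_def)
  have "Xi_at \<alpha> k 0 (pos s) = 0" if "Q k" for k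
    using i that by (auto simp: Xi_at_def intro: gr0I)
  moreover have "s = i \<longleftrightarrow> pos s = 0" using i by (metis pos_eq_iff)
  ultimately show ?thesis using i by (simp add: fac_def)
qed

lemma pair_neq: "pair Q i j \<Longrightarrow> i \<noteq> j" "pair Q i j \<Longrightarrow> i < j"
  by (auto simp: pair_def simp flip: pos_less_iff)

lemma mult_row_supported:
  assumes "finite K" "\<And>k. k \<notin> K \<Longrightarrow> L $ i $ k = 0"
  shows "(L ** Z) $ i $ s = (\<Sum>k\<in>K. L $ i $ k * Z $ k $ s)"
  unfolding mult_nth using assms by (intro sum.mono_neutral_right) auto

lemma mult_col_supported:
  assumes "finite K" "\<And>k. k \<notin> K \<Longrightarrow> L $ k $ i = 0"
  shows "(Z ** L) $ s $ i = (\<Sum>k\<in>K. Z $ s $ k * L $ k $ i)"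
  unfolding mult_nth using assms by (intro sum.mono_neutral_right) auto

lemma fac_mult_pair:
  fixes Z :: "'n::{finite,linorder} cmat"
  assumes "alternating Q" "pair Q i j"
  shows "(fac Q \<alpha> ** Z) $ i $ s = cnj (\<alpha> (pos i)) * Z $ i $ s + rho \<alpha> (pos i) * Z $ j $ s"
    and "(fac Q \<alpha> ** Z) $ j $ s = rho \<alpha> (pos i) * Z $ i $ s - \<alpha> (pos i) * Z $ j $ s"
    and "(Z ** fac Q \<alpha>) $ s $ i = cnj (\<alpha> (pos i)) * Z $ s $ i + rho \<alpha> (pos i) * Z $ s $ j"
    and "(Z ** fac Q \<alpha>) $ s $ j = rho \<alpha> (pos i) * Z $ s $ i - \<alpha> (pos i) * Z $ s $ j"
proof -
  note f = fac_pair[OF assms] and n = pair_neq(1)[OF assms(2)]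
  have g: "fac Q \<alpha> $ s $ i = fac Q \<alpha> $ i $ s" "fac Q \<alpha> $ s $ j = fac Q \<alpha> $ j $ s" for s
    by (rule fac_sym)+
  show "(fac Q \<alpha> ** Z) $ i $ s = cnj (\<alpha> (pos i)) * Z $ i $ s + rho \<alpha> (pos i) * Z $ j $ s"
    using n by (subst mult_row_supported[of "{i, j}"]) (auto simp: f)
  show "(fac Q \<alpha> ** Z) $ j $ s = rho \<alpha> (pos i) * Z $ i $ s - \<alpha> (pos i) * Z $ j $ s"
    using n by (subst mult_row_supported[of "{i, j}"]) (auto simp: f)
  show "(Z ** fac Q \<alpha>) $ s $ i = cnj (\<alpha> (pos i)) * Z $ s $ i + rho \<alpha> (pos i) * Z $ s $ j"
    using n by (subst mult_col_supported[of "{i, j}"]) (auto simp: f g)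
  show "(Z ** fac Q \<alpha>) $ s $ j = rho \<alpha> (pos i) * Z $ s $ i - \<alpha> (pos i) * Z $ s $ j"
    using n by (subst mult_col_supported[of "{i, j}"]) (auto simp: f g)
qed

lemma fac_mult_single:
  fixes Z :: "'n::{finite,linorder} cmat"
  assumes "alternating Q" "single Q i"
  shows "(fac Q \<alpha> ** Z) $ i $ s = fac Q \<alpha> $ i $ i * Z $ i $ s"
    and "(Z ** fac Q \<alpha>) $ s $ i = Z $ s $ i * fac Q \<alpha> $ i $ i"
proof -
  note f = fac_single[OF assms]
  have g: "fac Q \<alpha> $ s $ i = fac Q \<alpha> $ i $ s" for s
    by (rule fac_sym)
  show "(fac Q \<alpha> ** Z) $ i $ s = fac Q \<alpha> $ i $ i * Z $ i $ s"
    by (subst mult_row_supported[of "{i}"]) (auto simp: f)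
  show "(Z ** fac Q \<alpha>) $ s $ i = Z $ s $ i * fac Q \<alpha> $ i $ i"
    by (subst mult_col_supported[of "{i}"]) (auto simp: f g)
qed

section \<open>Unitarity of the factors and first components of eigenvectors\<close>

definition admissible :: "'n::finite itself \<Rightarrow> (nat \<Rightarrow> complex) \<Rightarrow> bool" where
  "admissible _ \<alpha> \<longleftrightarrow> (\<forall>k < CARD('n) - 1. cmod (\<alpha> k) < 1) \<and> cmod (\<alpha> (CARD('n) - 1)) = 1"

lemma CMV_iff: "C \<in> CMV \<longleftrightarrow> (\<exists>\<alpha>. admissible TYPE('n) \<alpha> \<and> C = (cmv \<alpha> :: 'n::{finite,linorder} cmat))"
  by (auto simp: CMV_def admissible_def)

lemma pair_less_card: "pair Q i (j :: 'n::{finite,linorder}) \<Longrightarrow> pos i < CARD('n) - 1"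
  using pos_less_card[of j] by (simp add: pair_def)

lemma rho_pos: "cmod (\<alpha> k) < 1 \<Longrightarrow> rho \<alpha> k > 0"
  by (simp add: rho_def power_less_one_iff abs_square_less_1)

lemma rho_square:
  assumes "cmod (\<alpha> k) < 1"
  shows "complex_of_real (rho \<alpha> k) * complex_of_real (rho \<alpha> k) = 1 - \<alpha> k * cnj (\<alpha> k)"
proof -
  have "(rho \<alpha> k)\<^sup>2 = 1 - (cmod (\<alpha> k))\<^sup>2"
    using assms by (simp add: rho_def power_le_one)
  then have "complex_of_real ((rho \<alpha> k)\<^sup>2) = 1 - complex_of_real ((cmod (\<alpha> k))\<^sup>2)"
    by (metis of_real_1 of_real_diff)
  then show ?thesis unfolding complex_norm_square by (simp add: power2_eq_square)
qed

lemma unitary_fac: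
  assumes Q: "alternating Q" and \<alpha>: "admissible TYPE('n) \<alpha>"
  shows "unitary (fac Q \<alpha> :: 'n::{finite,linorder} cmat)"
proof -
  have 1: "fac Q \<alpha> ** fac Q (\<lambda>k. cnj (\<alpha> k)) = (mat 1 :: 'n cmat)"
    if \<alpha>: "admissible TYPE('n) \<alpha>" for \<alpha>
  proof (rule cmat_eqI)
    fix i s :: 'n
    have rho: "rho (\<lambda>k. cnj (\<alpha> k)) k = rho \<alpha> k" for k by (simp add: rho_def)
    show "(fac Q \<alpha> ** fac Q (\<lambda>k. cnj (\<alpha> k))) $ i $ s = (mat 1 :: 'n cmat) $ i $ s"
    proof (cases rule: block_cases[OF Q, of i, case_names first second single])
      case (first j)
      have "cmod (\<alpha> (pos i)) < 1" using \<alpha> pair_less_card[OF first] by (simp add: admissible_def)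
      note r = rho_square[of \<alpha>, OF this]
      show ?thesis using pair_neq(1)[OF first]
        by (cases "s = i"; cases "s = j")
          (simp_all add: fac_mult_pair[OF Q first] fac_pair[OF Q first] mat_nth rho r mult.commute)
    next
      case (second j)
      have "cmod (\<alpha> (pos j)) < 1" using \<alpha> pair_less_card[OF second] by (simp add: admissible_def)
      note r = rho_square[of \<alpha>, OF this]
      show ?thesis using pair_neq(1)[OF second]
        by (cases "s = i"; cases "s = j")
          (simp_all add: fac_mult_pair[OF Q second] fac_pair[OF Q second] mat_nth rho r mult.commute)
    next
      case single
      have "cnj (\<alpha> (CARD('n) - 1)) * \<alpha> (CARD('n) - 1) = 1"
        using \<alpha> complex_norm_square[of "\<alpha> (CARD('n) - 1)"] by (simp add: admissible_def mult.commute)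
      then show ?thesis
        by (simp add: fac_mult_single[OF Q single] fac_single[OF Q single] mat_nth)
    qed
  qed
  \<comment> \<open>The identity for the conjugated parameters is the product in the opposite
    order.\<close>
  have "admissible TYPE('n) (\<lambda>k. cnj (\<alpha> k))" using \<alpha> by (simp add: admissible_def)
  from 1[OF this] 1[OF \<alpha>] show ?thesis by (simp add: unitary_def adj_fac)
qed

lemma unitary_cmv: "admissible TYPE('n) \<alpha> \<Longrightarrow> unitary (cmv \<alpha> :: 'n::{finite,linorder} cmat)"
  unfolding cmv_eq_fac by (intro unitary_mult unitary_fac alternating_even alternating_odd)

text \<open>The vanishing of the first component propagates through the blocks, alternately of the two
  factors.\<close>

lemma cmv_eigen_vanish:
  fixes V :: "'n::{finite,linorder} cmat"
  assumes \<alpha>: "admissible TYPE('n) \<alpha>" and V: "cmv \<alpha> ** V = mat a ** V" "a \<noteq> 0"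
    and V0: "V $ first $ s = 0"
  shows "V $ i $ s = 0"
proof -
  define W where "W = fac odd \<alpha> ** V"
  have LW: "fac even \<alpha> ** W = mat a ** V"
    using V(1) by (simp add: W_def cmv_eq_fac matrix_mul_assoc)
  \<comment> \<open>Both \<open>V\<close> and \<open>W\<close> are carried along. For even
    \<open>m\<close> the block of the first factor yields the next entry of \<open>W\<close>, and
    then that of \<open>V\<close> because \<open>a\<close> is nonzero; for odd \<open>m\<close> the
    block of the second factor yields \<open>V\<close> first and then \<open>W\<close>.\<close>
  have "\<forall>i :: 'n. pos i = m \<longrightarrow> V $ i $ s = 0 \<and> W $ i $ s = 0" for m
  proof (induction m)
    case 0
    have "single odd (first :: 'n)" by (simp add: single_def pos_eq_0_iff)
    then have "W $ first $ s = 0"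
      unfolding W_def by (simp add: fac_mult_single alternating_odd V0)
    then show ?case by (simp add: pos_eq_0_iff V0)
  next
    case (Suc m)
    show ?case
    proof (intro allI impI)
      fix j :: 'n assume j: "pos j = Suc m"
      then have "m < CARD('n)" using pos_less_card[of j] by simp
      then obtain i :: 'n where i: "pos i = m" using ex_pos by blast
      then have 0: "V $ i $ s = 0" "W $ i $ s = 0" using Suc by auto
      have "m < CARD('n) - 1" using j pos_less_card[of j] by simp
      then have r: "rho \<alpha> m > 0" using \<alpha> by (auto simp: admissible_def intro: rho_pos)
      show "V $ j $ s = 0 \<and> W $ j $ s = 0"
      proof (cases "even m")
        case True
        then have p: "pair even i j" using i j by (simp add: pair_def)
        note f = fac_mult_pair[OF alternating_even p, where \<alpha> = \<alpha> and Z = W and s = s, unfolded LW]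
        have "W $ j $ s = 0" using f(1) 0 r by (simp add: i)
        with f(2) 0 V(2) show ?thesis by simp
      next
        case False
        then have p: "pair odd i j" using i j by (simp add: pair_def)
        note f = fac_mult_pair[OF alternating_odd p, where \<alpha> = \<alpha> and Z = V and s = s, folded W_def]
        have "V $ j $ s = 0" using f(1) 0 r by (simp add: i)
        with f(2) 0 show ?thesis by simp
      qed
    qed
  qed
  then show ?thesis by blast
qed

text \<open>\<open>eigen_vanish\<close> expresses that \<open>e1\<close> is cyclic: no eigenvector
  has vanishing first component. It is stated columnwise for eigenvector matrices.\<close>

locale cyclic_spectrum = unitary_spectrum A J z
  for A :: "'n::{finite,linorder} cmat" and J :: "'j set" and z :: "'j \<Rightarrow> complex" +
  assumes eigen_vanish: "\<And>(V :: 'n cmat) a s i. A ** V = mat a ** V \<Longrightarrow> a \<noteq> 0 \<Longrightarrow> V $ first $ s = 0 \<Longrightarrow> V $ i $ s = 0"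
begin

lemma z_nonzero: "j \<in> J \<Longrightarrow> z j \<noteq> 0"
  using norm_z by fastforce

text \<open>A zero mass kills the first column of \<open>P j\<close>, hence by hermitian symmetry
  its first row. Every column is then an eigenvector with vanishing first component, so
  \<open>P j = 0\<close>.\<close>

lemma mass_pos:
  assumes "j \<in> J" shows "mass j > 0"
proof (rule ccontr)
  assume "\<not> mass j > 0"
  then have "(\<Sum>i\<in>UNIV. (cmod (P j $ i $ first))\<^sup>2) = 0"
    using mass_nonneg[OF assms] P_first(2)[OF assms] by simp
  then have 0: "P j $ i $ first = 0" for i by (simp add: sum_nonneg_eq_0_iff)
  have "P j $ first $ s = 0" for s
    using P_hermitian(1)[OF assms] 0[of s] by (metis adj_nth complex_cnj_zero)
  then have "P j $ i $ s = 0" for i s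
    using eigen_vanish[OF A_P z_nonzero] assms by blast
  then have "P j = 0" by (intro cmat_eqI) simp
  with P_nonzero[OF assms] show False ..
qed

text \<open>By \<open>eigen_vanish\<close> an eigenvector is determined by its first component, so \<open>P j\<close> has rank one.\<close>

lemma trace_P:
  assumes "j \<in> J" shows "trace (P j) = 1"
proof -
  let ?p = "P j $ first $ first"
  have rank1: "?p * P j $ i $ s = P j $ i $ first * P j $ first $ s" for i s
  proof -
    \<comment> \<open>\<open>P j ** Z\<close> is the outer product of the first column and the first
      row of \<open>P j\<close>. Thus \<open>V\<close> compares \<open>P j\<close> with a matrix of
      rank one, and its first row vanishes by construction.\<close>
    define Z :: "'n cmat" where "Z = (\<chi> k s. if k = first then P j $ first $ s else 0)"
    define V where "V = mat ?p ** P j - P j ** Z"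
    have PZ: "(P j ** Z) $ i $ s = P j $ i $ first * P j $ first $ s" for i s
      unfolding mult_nth Z_def by (simp add: if_distrib cong: if_cong)
    have "A ** V = mat (z j) ** V"
    proof -
      have "A ** V = mat ?p ** (A ** P j) - (A ** P j) ** Z"
        unfolding V_def matrix_sub_ldistrib mat_left_commute[of A] by (simp only: matrix_mul_assoc)
      then show ?thesis
        by (simp only: A_P[OF assms] V_def)
          (rule cmat_eqI, simp add: matrix_sub_ldistrib algebra_simps flip: matrix_mul_assoc)
    qed
    moreover have "V $ first $ s = 0" by (simp add: V_def PZ)
    ultimately have "V $ i $ s = 0" using eigen_vanish z_nonzero[OF assms] by blast
    then show ?thesis by (simp add: V_def PZ)
  qed
  have "?p * trace (P j) = (P j ** P j) $ first $ first"
    unfolding trace_def sum_distrib_left rank1 mult_nth by (simp add: mult.commute)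
  then have "?p * trace (P j) = ?p" by (simp add: P_P assms)
  moreover have "?p \<noteq> 0" using mass_pos[OF assms] by (simp add: P_first(1) assms)
  ultimately show ?thesis by simp
qed

text \<open>Taking traces in the resolution of the identity counts the projections.\<close>

lemma card_J: "card J = CARD('n)"
proof -
  have "trace (\<Sum>j\<in>J. P j) = (\<Sum>j\<in>J. trace (P j))"
    unfolding trace_def by (simp add: sum.swap[of _ J])
  then have "of_nat CARD('n) = (of_nat (card J) :: complex)"
    by (simp add: sum_P trace_P trace_I)
  then show ?thesis by simp
qed

end

lemma CMV_cyclic_spectrum:
  fixes C :: "'n::{finite,linorder} cmat"
  assumes "C \<in> CMV" "finite J" "inj_on z J" "eigenvalues C = z ` J"
  shows "cyclic_spectrum C J z"
proof -
  obtain \<alpha> where \<alpha>: "admissible TYPE('n) \<alpha>" "C = cmv \<alpha>" using assms(1) by (auto simp: CMV_iff)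
  show ?thesis
  proof unfold_locales
    show "unitary C" using \<alpha> by (simp add: unitary_cmv)
    show "V $ i $ s = 0" if "C ** V = mat a ** V" "a \<noteq> 0" "V $ first $ s = 0" for V :: "'n cmat" and a s i
      using cmv_eigen_vanish[OF \<alpha>(1), of V a] that \<alpha>(2) by blast
  qed (use assms in auto)
qed

text \<open>A labelling only provides a surjection onto the spectrum. Counting the spectrum, indexed
  by itself, shows that it has \<open>CARD('n)\<close> elements, which makes the surjection
  injective.\<close>

lemma CMV_labelled_spectrum:
  fixes C :: "'n::{finite,linorder} cmat"
  assumes "C \<in> CMV" "eigenvalues C = z ` {1..CARD('n)}"
  shows "cyclic_spectrum C {1..CARD('n)} z"
proof -
  have "cyclic_spectrum C (eigenvalues C) id"
    by (rule CMV_cyclic_spectrum[OF assms(1)]) (simp_all add: finite_eigenvalues)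
  then have "card (z ` {1..CARD('n)}) = CARD('n)"
    using cyclic_spectrum.card_J assms(2) by metis
  then have "inj_on z {1..CARD('n)}" by (intro eq_card_imp_inj_on) auto
  then show ?thesis by (intro CMV_cyclic_spectrum assms) auto
qed

subsection \<open>Hamiltonian vector fields are tangent to the CMV matrices\<close>

lemma has_derivative_cmatI:
  fixes f :: "'x::real_normed_vector \<Rightarrow> 'n::finite cmat"
  assumes "\<And>i j. ((\<lambda>x. f x $ i $ j) has_derivative (\<lambda>h. f' h $ i $ j)) (at x within S)"
  shows "(f has_derivative f') (at x within S)"
proof -
  have "((\<lambda>x. f x \<bullet> b) has_derivative (\<lambda>h. f' h \<bullet> b)) (at x within S)" if bB: "b \<in> Basis" for b
  proof -
    from bB obtain i v where iv: "b = axis i v" "v \<in> Basis"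
      unfolding Basis_vec_def by blast
    from iv(2) obtain j u where "v = axis j u"
      unfolding Basis_vec_def by blast
    with iv(1) have b: "b = axis i (axis j u)" by simp
    have e: "M \<bullet> b = (M $ i $ j) \<bullet> u" for M :: "'n cmat"
      by (simp add: b inner_axis)
    show ?thesis unfolding e
      by (intro has_derivative_inner_left assms)
  qed
  then show ?thesis by (subst has_derivative_componentwise_within) blast
qed

lemma has_vector_derivative_cmatI:
  fixes f :: "real \<Rightarrow> 'n::finite cmat"
  assumes "\<And>i j. ((\<lambda>x. f x $ i $ j) has_vector_derivative f' $ i $ j) (at x within S)"
  shows "(f has_vector_derivative f') (at x within S)"
  using assms unfolding has_vector_derivative_def by (intro has_derivative_cmatI) simp

text \<open>Write \<open>L\<close> for the factor. Above the diagonal, R acts as -1 on all entries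
  involved and the two copies of \<open>L ** X ** L\<close> cancel. Below it, R Y = Y + 2 adj Y, and
  unitarity turns both \<open>L ** adj (X ** L)\<close> and \<open>adj (L ** X) ** L\<close> into
  \<open>adj X\<close>.\<close>

lemma ham_off_block:
  fixes i j :: "'n::{finite,linorder}"
  assumes Q: "alternating Q" and \<alpha>: "admissible TYPE('n) \<alpha>"
    and ij: "i \<noteq> j" "\<not> pair Q i j" "\<not> pair Q j i"
  shows "ham X (fac Q \<alpha>) $ i $ j = 0"
proof -
  let ?L = "fac Q \<alpha> :: 'n cmat"
  have U: "?L ** adj ?L = mat 1" "adj ?L ** ?L = mat 1"
    using unitary_fac[OF Q \<alpha>] by (simp_all add: unitary_def)
  have supp: "k = i' \<or> pair Q i' k \<or> pair Q k i'" if nz: "?L $ i' $ k \<noteq> 0" for i' k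
  proof (cases rule: block_cases[OF Q, of i', case_names first second single])
    case (first l)
    then show ?thesis using nz fac_pair[OF Q first, of \<alpha> k] by (auto split: if_splits)
  next
    case (second l)
    then show ?thesis using nz fac_pair[OF Q second, of \<alpha> k] by (auto split: if_splits)
  next
    case single
    then show ?thesis using nz fac_single[OF Q single, of \<alpha> k] by (auto split: if_splits)
  qed
  \<comment> \<open>Blocks consist of consecutive indices, so moving \<open>i'\<close> within its
    block cannot carry it past an index of another block.\<close>
  have order: "k < j' \<longleftrightarrow> i' < j'" "j' < k \<longleftrightarrow> j' < i'"
    if "i' \<noteq> j'" "\<not> pair Q i' j'" "\<not> pair Q j' i'" "?L $ i' $ k \<noteq> 0" for i' j' k
  proof -
    have 0: "pos i' \<noteq> pos j'" using that(1) by (simp add: pos_eq_iff)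
    have "k = i' \<or> pair Q i' k \<or> pair Q k i'" using supp that(4) by blast
    then have "(pos k < pos j' \<longleftrightarrow> pos i' < pos j') \<and> (pos j' < pos k \<longleftrightarrow> pos j' < pos i')"
    proof (elim disjE)
      assume k: "pair Q i' k"
      then have "pos j' \<noteq> Suc (pos i')" using that(2) by (simp add: pair_def)
      with 0 k show ?thesis unfolding pair_def by linarith
    next
      assume k: "pair Q k i'"
      then have "pos j' \<noteq> pos k" using that(3) by (metis pair_def)
      with 0 k show ?thesis unfolding pair_def by linarith
    qed simp
    then show "k < j' \<longleftrightarrow> i' < j'" "j' < k \<longleftrightarrow> j' < i'" by (simp_all only: pos_less_iff)
  qed
  have row: "k < j \<longleftrightarrow> i < j" "j < k \<longleftrightarrow> j < i" if "?L $ i $ k \<noteq> 0" for k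
    using order[OF ij that] .
  have col: "k < i \<longleftrightarrow> j < i" "i < k \<longleftrightarrow> i < j" if "?L $ k $ j \<noteq> 0" for k
  proof -
    have "?L $ j $ k \<noteq> 0" using that by (simp add: fac_sym)
    then show "k < i \<longleftrightarrow> j < i" "i < k \<longleftrightarrow> i < j"
      using order[of j i k] ij by blast+
  qed
  consider "i < j" | "j < i" using ij(1) by (metis linorder_neqE)
  then show ?thesis
  proof cases
    case 1
    have "(?L ** R_op Y) $ i $ j = (?L ** (- Y)) $ i $ j" for Y
      unfolding mult_nth
    proof (intro sum.cong refl)
      fix k show "?L $ i $ k * R_op Y $ k $ j = ?L $ i $ k * (- Y) $ k $ j"
        using row[of k] 1 by (cases "?L $ i $ k = 0") (auto simp: R_op_nth)
    qed
    moreover have "(R_op Y ** ?L) $ i $ j = ((- Y) ** ?L) $ i $ j" for Y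
      unfolding mult_nth
    proof (intro sum.cong refl)
      fix k show "R_op Y $ i $ k * ?L $ k $ j = (- Y) $ i $ k * ?L $ k $ j"
        using col[of k] 1 by (cases "?L $ k $ j = 0") (auto simp: R_op_nth)
    qed
    ultimately show ?thesis by (simp add: ham_def matrix_minus_mult matrix_mul_assoc)
  next
    case 2
    then have 3: "\<not> i < j" by simp
    have "(?L ** R_op Y) $ i $ j = (?L ** (Y + mat 2 ** adj Y)) $ i $ j" for Y
      unfolding mult_nth
    proof (intro sum.cong refl)
      fix k show "?L $ i $ k * R_op Y $ k $ j = ?L $ i $ k * (Y + mat 2 ** adj Y) $ k $ j"
        using row[of k] 2 3 by (cases "?L $ i $ k = 0") (auto simp: R_op_nth)
    qed
    moreover have "(R_op Y ** ?L) $ i $ j = ((Y + mat 2 ** adj Y) ** ?L) $ i $ j" for Y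
      unfolding mult_nth
    proof (intro sum.cong refl)
      fix k show "R_op Y $ i $ k * ?L $ k $ j = (Y + mat 2 ** adj Y) $ i $ k * ?L $ k $ j"
        using col[of k] 2 3 by (cases "?L $ k $ j = 0") (auto simp: R_op_nth)
    qed
    moreover have "?L ** (X ** ?L + mat 2 ** adj (X ** ?L)) = ?L ** X ** ?L + mat 2 ** adj X"
      unfolding matrix_add_ldistrib mat_left_commute[of ?L] adj_mult by (simp add: matrix_mul_assoc U)
    moreover have "(?L ** X + mat 2 ** adj (?L ** X)) ** ?L = ?L ** X ** ?L + mat 2 ** adj X"
    proof -
      have "mat 2 ** (adj X ** adj ?L) ** ?L = mat 2 ** (adj X ** (adj ?L ** ?L))"
        by (simp only: matrix_mul_assoc)
      then show ?thesis unfolding matrix_add_rdistrib adj_mult U(2) by simp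
    qed
    ultimately show ?thesis by (simp add: ham_def)
  qed
qed

text \<open>The velocity \<open>\<delta>\<close> of \<open>\<alpha> (pos i)\<close> under the Hamiltonian vector field of \<open>X\<close>.\<close>

definition velocity :: "'n::{finite,linorder} cmat \<Rightarrow> (nat \<Rightarrow> complex) \<Rightarrow> 'n \<Rightarrow> 'n \<Rightarrow> complex" where
  "velocity X \<alpha> i j = (let r = complex_of_real (rho \<alpha> (pos i)) in
     r * r * (X $ i $ i + cnj (X $ j $ j)) -
       \<i> * r * \<alpha> (pos i) * Im (X $ i $ j + X $ j $ i))"

text \<open>The entries on the right are those of the derivative of \<open>\<Xi>\<^sub>k\<close>
  when its parameter has velocity \<open>\<delta>\<close>, with \<open>r\<close> the resulting
  derivative of \<open>rho\<close>. So the field is tangent to the set of such blocks.\<close>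

lemma ham_pair:
  fixes X :: "'n::{finite,linorder} cmat"
  assumes Q: "alternating Q" and p: "pair Q i j" and \<alpha>: "cmod (\<alpha> (pos i)) < 1"
  defines "\<delta> \<equiv> velocity X \<alpha> i j"
  defines "r \<equiv> complex_of_real (- Re (cnj (\<alpha> (pos i)) * \<delta>) / rho \<alpha> (pos i))"
  shows "ham X (fac Q \<alpha>) $ i $ i = cnj \<delta>" "ham X (fac Q \<alpha>) $ i $ j = r"
    "ham X (fac Q \<alpha>) $ j $ i = r" "ham X (fac Q \<alpha>) $ j $ j = - \<delta>"
proof -
  have lt: "i < j" "\<not> j < i" using pair_neq(2)[OF p] by auto
  define \<rho> where "\<rho> = rho \<alpha> (pos i)"
  define a where "a = \<alpha> (pos i)"
  have \<rho>: "\<rho> \<noteq> 0" using rho_pos[of \<alpha>, OF \<alpha>] by (simp add: \<rho>_def)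
  have R: "R_op Y $ i $ i = cnj (Y $ i $ i)" "R_op Y $ i $ j = - (Y $ i $ j)"
    "R_op Y $ j $ i = Y $ j $ i + 2 * cnj (Y $ i $ j)" "R_op Y $ j $ j = cnj (Y $ j $ j)" for Y
    using lt by (simp_all add: R_op_nth)
  note s = ham_def mat_mult_nth vector_minus_component fac_mult_pair[OF Q p] R
  \<comment> \<open>The last term of \<open>velocity\<close> contributes only an imaginary number to
    \<open>cnj a * \<delta>\<close>, and the rest carries the square of \<open>\<rho>\<close>, so
    the division cancels.\<close>
  have r: "r = complex_of_real (- \<rho> * Re (cnj a * X $ i $ i + a * X $ j $ j))"
  proof -
    have "Re (cnj a * \<delta>) = (\<rho> * \<rho>) * Re (cnj a * X $ i $ i + a * X $ j $ j)"
      by (simp add: \<delta>_def velocity_def \<rho>_def[symmetric] a_def[symmetric] Let_def algebra_simps)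
    then show ?thesis using \<rho> by (simp add: r_def \<rho>_def[symmetric] a_def[symmetric])
  qed
  show "ham X (fac Q \<alpha>) $ i $ i = cnj \<delta>"
    unfolding s \<rho>_def[symmetric] a_def[symmetric] \<delta>_def velocity_def Let_def
    by (simp add: complex_eq_iff field_simps)
  show "ham X (fac Q \<alpha>) $ i $ j = r"
    unfolding s \<rho>_def[symmetric] a_def[symmetric] r
    by (simp add: complex_eq_iff field_simps)
  show "ham X (fac Q \<alpha>) $ j $ i = r"
    unfolding s \<rho>_def[symmetric] a_def[symmetric] r
    by (simp add: complex_eq_iff field_simps)
  show "ham X (fac Q \<alpha>) $ j $ j = - \<delta>"
    unfolding s \<rho>_def[symmetric] a_def[symmetric] \<delta>_def velocity_def Let_def
    by (simp add: complex_eq_iff field_simps)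
qed

text \<open>On a block of size 1 the products in both orders have the same diagonal entry, and the
  two terms cancel. This is why the last parameter stays fixed on the unit circle.\<close>

lemma ham_single:
  fixes X :: "'n::{finite,linorder} cmat"
  assumes Q: "alternating Q" and p: "single Q i"
  shows "ham X (fac Q \<alpha>) $ i $ i = 0"
  by (simp add: ham_def fac_mult_single[OF Q p] R_op_nth)

lemma rho_has_derivative:
  assumes "cmod (\<alpha> k) < 1"
  shows "((\<lambda>t. rho (\<lambda>k. \<alpha> k + complex_of_real t * \<delta> k) k) has_real_derivative
    - Re (cnj (\<alpha> k) * \<delta> k) / rho \<alpha> k) (at 0)"
proof -
  have 1: "1 - ((Re (\<alpha> k))\<^sup>2 + (Im (\<alpha> k))\<^sup>2) > 0"
    using assms by (simp add: cmod_def)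
  show ?thesis unfolding rho_def cmod_power2
    using 1 by (auto intro!: derivative_eq_intros simp: field_simps)
qed

text \<open>Only the first order at 0 matters, so the parameters may move along straight
  lines.\<close>

lemma fac_tangent:
  fixes X :: "'n::{finite,linorder} cmat"
  assumes Q: "alternating Q" and \<alpha>: "admissible TYPE('n) \<alpha>"
  shows "\<exists>\<delta>. \<delta> (CARD('n) - 1) = 0 \<and>
    ((\<lambda>t. fac Q (\<lambda>k. \<alpha> k + complex_of_real t * \<delta> k)) has_vector_derivative ham X (fac Q \<alpha>)) (at 0)"
proof -
  \<comment> \<open>\<open>inv pos\<close> is arbitrary outside the range of positions; the guard
    \<open>k < CARD('n) - 1\<close> in \<open>\<delta>\<close> keeps both \<open>k\<close> and
    \<open>Suc k\<close> in range and freezes the last parameter.\<close>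
  define ix :: "nat \<Rightarrow> 'n" where "ix k = inv pos k" for k
  have ix: "ix (pos i) = i" for i
    unfolding ix_def by (rule inv_f_f) (simp add: inj_on_def pos_eq_iff)
  define \<delta> where "\<delta> k = (if k < CARD('n) - 1 then velocity X \<alpha> (ix k) (ix (Suc k)) else 0)" for k
  have \<delta>: "\<delta> (pos i) = velocity X \<alpha> i j" if "pair Q i j" for i j
  proof -
    have "ix (Suc (pos i)) = j" using that ix[of j] by (simp add: pair_def)
    then show ?thesis using pair_less_card[OF that] by (simp add: \<delta>_def ix)
  qed
  define g where "g t = (fac Q (\<lambda>k. \<alpha> k + complex_of_real t * \<delta> k) :: 'n cmat)" for t
  have "(g has_vector_derivative ham X (fac Q \<alpha>)) (at 0)"
  proof (rule has_vector_derivative_cmatI)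
    fix i j :: 'n
    have pair_case: "((\<lambda>t. g t $ i $ i) has_vector_derivative ham X (fac Q \<alpha>) $ i $ i) (at 0)"
      "((\<lambda>t. g t $ i $ j) has_vector_derivative ham X (fac Q \<alpha>) $ i $ j) (at 0)"
      "((\<lambda>t. g t $ j $ i) has_vector_derivative ham X (fac Q \<alpha>) $ j $ i) (at 0)"
      "((\<lambda>t. g t $ j $ j) has_vector_derivative ham X (fac Q \<alpha>) $ j $ j) (at 0)"
      if p: "pair Q i j" for i j
    proof -
      have \<alpha>1: "cmod (\<alpha> (pos i)) < 1" using \<alpha> pair_less_card[OF p] by (simp add: admissible_def)
      note h = ham_pair[OF Q p, where \<alpha> = \<alpha> and X = X, OF \<alpha>1, folded \<delta>[OF p]] and f = fac_pair[OF Q p] and n = pair_neq(1)[OF p]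
      have r: "((\<lambda>t. complex_of_real (rho (\<lambda>k. \<alpha> k + complex_of_real t * \<delta> k) (pos i))) has_vector_derivative
        complex_of_real (- Re (cnj (\<alpha> (pos i)) * \<delta> (pos i)) / rho \<alpha> (pos i))) (at 0)"
        using rho_has_derivative[of \<alpha> "pos i" \<delta>, OF \<alpha>1]
        by (intro has_vector_derivative_of_real) (simp add: has_real_derivative_iff_has_vector_derivative)
      have lin: "((\<lambda>t. \<alpha> (pos i) + complex_of_real t * \<delta> (pos i)) has_vector_derivative \<delta> (pos i)) (at 0)"
        by (auto intro!: derivative_eq_intros)
      show "((\<lambda>t. g t $ i $ i) has_vector_derivative ham X (fac Q \<alpha>) $ i $ i) (at 0)"
        using has_vector_derivative_cnj[OF lin] by (simp add: g_def f h)
      show "((\<lambda>t. g t $ i $ j) has_vector_derivative ham X (fac Q \<alpha>) $ i $ j) (at 0)"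
        using r n by (simp add: g_def f h)
      show "((\<lambda>t. g t $ j $ i) has_vector_derivative ham X (fac Q \<alpha>) $ j $ i) (at 0)"
        using r n by (simp add: g_def f h)
      show "((\<lambda>t. g t $ j $ j) has_vector_derivative ham X (fac Q \<alpha>) $ j $ j) (at 0)"
        using has_vector_derivative_minus[OF lin] n by (simp add: g_def f h)
    qed
    show "((\<lambda>t. g t $ i $ j) has_vector_derivative ham X (fac Q \<alpha>) $ i $ j) (at 0)"
    proof (cases "pair Q i j \<or> pair Q j i")
      case True
      then show ?thesis using pair_case by blast
    next
      case np: False
      show ?thesis
      proof (cases "i = j")
        case True
        show ?thesis
        proof (cases rule: block_cases[OF Q, of i, case_names first second single])
          case single
          have "\<delta> (CARD('n) - 1) = 0" by (simp add: \<delta>_def)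
          then have "g t $ i $ i = g 0 $ i $ i" for t
            by (simp add: g_def fac_single[OF Q single] del: One_nat_def)
          then have "(\<lambda>t. g t $ i $ i) = (\<lambda>t. g 0 $ i $ i)" by blast
          then show ?thesis
            by (simp add: True[symmetric] ham_single[OF Q single])
        qed (use True pair_case in blast)+
      next
        case False
        have "fac Q \<beta> $ i $ j = 0" for \<beta>
        proof (cases rule: block_cases[OF Q, of i, case_names first second single])
          case (first l)
          then show ?thesis using np False by (auto simp: fac_pair[OF Q first])
        next
          case (second l)
          then show ?thesis using np False by (auto simp: fac_pair[OF Q second])
        next
          case single
          then show ?thesis using False by (simp add: fac_single[OF Q single])
        qed
        then show ?thesis
          using np False by (simp add: g_def ham_off_block[OF Q \<alpha>])
      qed
    qed
  qed
  moreover have "\<delta> (CARD('n) - 1) = 0" by (simp add: \<delta>_def)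
  ultimately show ?thesis unfolding g_def by blast
qed

text \<open>The symplectic form \<open>J\<close> on the \<open>2 \<times> 2\<close> blocks. Since
  \<open>\<Xi>\<^sup>T J \<Xi> = (det \<Xi>) J\<close>, it gives the determinant of a factor up to sign, and continuity fixes
  the sign along a curve.\<close>

definition symp :: "(nat \<Rightarrow> bool) \<Rightarrow> 'n::{finite,linorder} cmat" where
  "symp Q = (\<chi> i j. if pair Q i j then 1 else if pair Q j i then - 1
     else if i = j \<and> single Q i then 1 else 0)"

lemma symp_mult_pair:
  fixes Z :: "'n::{finite,linorder} cmat"
  assumes Q: "alternating Q" and p: "pair Q i j"
  shows "(symp Q ** Z) $ i $ s = Z $ j $ s" "(symp Q ** Z) $ j $ s = - Z $ i $ s"
proof -
  have q: "Q (pos i)" "\<not> Q (pos j)" "pos j = Suc (pos i)" "pos i < CARD('n) - 1"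
    using p Q pair_less_card[OF p] by (simp_all add: pair_def alternating_def)
  have i: "pair Q i k \<longleftrightarrow> k = j" "\<not> pair Q k i" "\<not> single Q i" for k
  proof -
    show "pair Q i k \<longleftrightarrow> k = j"
      unfolding pair_def pos_eq_iff[of k j, symmetric] by (simp add: q)
    show "\<not> pair Q k i" using q(1) Q by (metis pair_def alternating_def)
    show "\<not> single Q i" using q(1,4) unfolding single_def by (metis One_nat_def diff_Suc_1 less_irrefl)
  qed
  have j: "pair Q k j \<longleftrightarrow> k = i" "\<not> pair Q j k" "\<not> single Q j" for k
  proof -
    show "pair Q k j \<longleftrightarrow> k = i"
      using q(1,3) unfolding pair_def by (metis Suc_inject pos_eq_iff)
    show "\<not> pair Q j k" using q(2) by (simp add: pair_def)
    show "\<not> single Q j" using q(2,3) by (simp add: single_def)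
  qed
  show "(symp Q ** Z) $ i $ s = Z $ j $ s"
    by (subst mult_row_supported[of "{j}"]) (simp_all add: symp_def i)
  show "(symp Q ** Z) $ j $ s = - Z $ i $ s"
    by (subst mult_row_supported[of "{i}"]) (simp_all add: symp_def j)
qed

lemma symp_mult_single:
  fixes Z :: "'n::{finite,linorder} cmat"
  assumes Q: "alternating Q" and s: "single Q i"
  shows "(symp Q ** Z) $ i $ s = Z $ i $ s"
proof -
  have i: "\<not> pair Q i k" "\<not> pair Q k i" for k
  proof -
    show "\<not> pair Q i k"
      using s pos_less_card[of k] unfolding pair_def single_def by (metis less_irrefl)
    show "\<not> pair Q k i"
      using s Q unfolding pair_def single_def by (metis alternating_def nat.distinct(1))
  qed
  show ?thesis
    by (subst mult_row_supported[of "{i}"]) (auto simp: symp_def i s)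
qed

text \<open>\<open>symp Q\<close> squares to -1 on the pairs and is 1 on the singles, so its fourth
  power is the identity.\<close>

lemma det_symp_nonzero:
  assumes Q: "alternating Q"
  shows "det (symp Q :: 'n::{finite,linorder} cmat) \<noteq> 0"
proof -
  let ?J = "symp Q :: 'n cmat"
  have "?J ** (?J ** (?J ** (?J ** mat 1))) = mat 1"
  proof (rule cmat_eqI)
    fix i s
    show "(?J ** (?J ** (?J ** (?J ** mat 1)))) $ i $ s = mat 1 $ i $ s"
    proof (cases rule: block_cases[OF Q, of i, case_names first second single])
      case (first j)
      then show ?thesis by (simp only: symp_mult_pair[OF Q first] minus_minus)
    next
      case (second j)
      then show ?thesis by (simp only: symp_mult_pair[OF Q second] minus_minus)
    next
      case single
      then show ?thesis by (simp only: symp_mult_single[OF Q single])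
    qed
  qed
  then have "det (?J ** (?J ** (?J ** (?J ** mat 1)))) = 1" by (simp only: det_I)
  then show ?thesis unfolding det_mul by auto
qed

text \<open>The factor is symmetric, so \<open>fac Q \<alpha> ** (symp Q ** fac Q \<alpha>)\<close>
  is the transposed congruence. Each block of size 2 has determinant -1 whatever its parameter, so
  the product depends only on the last parameter.\<close>

lemma det_fac_square:
  assumes Q: "alternating Q" and \<alpha>: "admissible TYPE('n) \<alpha>" and \<beta>: "admissible TYPE('n) \<beta>"
    and eq: "\<alpha> (CARD('n) - 1) = \<beta> (CARD('n) - 1)"
  shows "(det (fac Q \<alpha> :: 'n::{finite,linorder} cmat))\<^sup>2 = (det (fac Q \<beta> :: 'n cmat))\<^sup>2"
proof -
  let ?J = "symp Q :: 'n cmat"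
  have "(fac Q \<alpha> ** (?J ** fac Q \<alpha>)) $ i $ s = (fac Q \<beta> ** (?J ** fac Q \<beta>)) $ i $ s" for i s
  proof (cases rule: block_cases[OF Q, of i, case_names first second single])
    case (first j)
    have "cmod (\<alpha> (pos i)) < 1" "cmod (\<beta> (pos i)) < 1"
      using \<alpha> \<beta> pair_less_card[OF first] by (simp_all add: admissible_def)
    note r = rho_square[of \<alpha>, OF this(1)] rho_square[of \<beta>, OF this(2)]
    show ?thesis using pair_neq(1)[OF first]
      by (cases "s = i"; cases "s = j")
        (simp_all add: fac_mult_pair(1,2)[OF Q first] symp_mult_pair[OF Q first] fac_pair[OF Q first] r mult.commute)
  next
    case (second j)
    have "cmod (\<alpha> (pos j)) < 1" "cmod (\<beta> (pos j)) < 1"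
      using \<alpha> \<beta> pair_less_card[OF second] by (simp_all add: admissible_def)
    note r = rho_square[of \<alpha>, OF this(1)] rho_square[of \<beta>, OF this(2)]
    show ?thesis using pair_neq(1)[OF second]
      by (cases "s = i"; cases "s = j")
        (simp_all add: fac_mult_pair(1,2)[OF Q second] symp_mult_pair[OF Q second] fac_pair[OF Q second] r mult.commute)
  next
    case single
    then show ?thesis
      by (simp add: fac_mult_single(1)[OF Q single] symp_mult_single[OF Q single] fac_single[OF Q single] eq
          del: One_nat_def)
  qed
  then have "det (fac Q \<alpha> ** (?J ** fac Q \<alpha>)) = det (fac Q \<beta> ** (?J ** fac Q \<beta>))"
    by (intro arg_cong[where f = det] cmat_eqI)
  then show ?thesis
    using det_symp_nonzero[OF Q, where 'n = 'n] by (simp add: det_mul power2_eq_square)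
qed

lemma continuous_det_fac:
  "continuous_on S (\<lambda>t. det (fac Q (\<lambda>k. \<alpha> k + complex_of_real t * \<delta> k) :: 'n::{finite,linorder} cmat))"
proof -
  have "continuous_on S (\<lambda>t. Xi_at (\<lambda>k. \<alpha> k + complex_of_real t * \<delta> k) k r s)" for k r s
    unfolding Xi_at_def rho_def
    by (cases "r = k"; cases "s = k"; cases "r = k + 1"; cases "s = k + 1")
      (auto intro!: continuous_intros)
  then show ?thesis
    unfolding det_def fac_def by (auto intro!: continuous_intros)
qed

lemma det_fac_curve:
  assumes Q: "alternating Q" and \<delta>: "\<delta> (CARD('n) - 1) = 0"
    and adm: "\<And>t. \<bar>t\<bar> < e \<Longrightarrow> admissible TYPE('n) (\<lambda>k. \<alpha> k + complex_of_real t * \<delta> k)"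
    and t: "\<bar>t\<bar> < e"
  shows "det (fac Q (\<lambda>k. \<alpha> k + complex_of_real t * \<delta> k) :: 'n::{finite,linorder} cmat) = det (fac Q \<alpha> :: 'n cmat)"
proof -
  define D where "D t = det (fac Q (\<lambda>k. \<alpha> k + complex_of_real t * \<delta> k) :: 'n cmat)" for t
  let ?I = "{-e<..<e}"
  have "(D t)\<^sup>2 = (D 0)\<^sup>2" if "t \<in> ?I" for t
    unfolding D_def using that \<delta>
    by (intro det_fac_square[OF Q] adm) auto
  then have "D t = D 0 \<or> D t = - D 0" if "t \<in> ?I" for t
    using that power2_eq_iff by blast
  then have "D ` ?I \<subseteq> {D 0, - D 0}" by blast
  then have "finite (D ` ?I)" by (rule finite_subset) simp
  moreover have "continuous_on ?I D" unfolding D_def by (rule continuous_det_fac)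
  ultimately have "D constant_on ?I"
    by (intro continuous_finite_range_constant) auto
  then have "D t = D 0" using t unfolding constant_on_def by (auto simp: abs_less_iff)
  then show ?thesis by (simp add: D_def)
qed

lemma bounded_bilinear_matrix_mult:
  "bounded_bilinear ((**) :: 'n::finite cmat \<Rightarrow> 'n cmat \<Rightarrow> 'n cmat)"
proof -
  have "bilinear ((**) :: 'n cmat \<Rightarrow> 'n cmat \<Rightarrow> 'n cmat)"
    unfolding bilinear_def
    by (auto intro!: linearI cmat_eqI simp: mult_nth algebra_simps sum.distrib scaleR_sum_right)
  then show ?thesis by (simp add: bilinear_conv_bounded_bilinear)
qed

lemma CMV_tangent:
  fixes C X :: "'n::{finite,linorder} cmat"
  assumes "C \<in> CMV"
  shows "\<exists>\<gamma>. \<gamma> 0 = C \<and> (\<gamma> has_vector_derivative ham X C) (at 0) \<and>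
    (\<forall>\<^sub>F t in at (0::real). \<gamma> t \<in> CMV \<and> det (\<gamma> t) = det C)"
proof -
  obtain \<alpha> where \<alpha>: "admissible TYPE('n) \<alpha>" and C: "C = cmv \<alpha>" using assms by (auto simp: CMV_iff)
  let ?L = "fac even \<alpha> :: 'n cmat" and ?M = "fac odd \<alpha> :: 'n cmat"
  obtain \<delta>1 where \<delta>1: "\<delta>1 (CARD('n) - 1) = 0"
    "((\<lambda>t. fac even (\<lambda>k. \<alpha> k + complex_of_real t * \<delta>1 k)) has_vector_derivative ham (?M ** X) ?L) (at 0)"
    using fac_tangent[OF alternating_even \<alpha>] by blast
  obtain \<delta>2 where \<delta>2: "\<delta>2 (CARD('n) - 1) = 0"
    "((\<lambda>t. fac odd (\<lambda>k. \<alpha> k + complex_of_real t * \<delta>2 k)) has_vector_derivative ham (X ** ?L) ?M) (at 0)"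
    using fac_tangent[OF alternating_odd \<alpha>] by blast
  \<comment> \<open>The first factor reads the even parameters and the second the odd ones, so the
    two independently found velocities fit into one curve.\<close>
  define \<delta> where "\<delta> k = (if even k then \<delta>1 k else \<delta>2 k)" for k
  define a where "a t k = \<alpha> k + complex_of_real t * \<delta> k" for t k
  define \<gamma> where "\<gamma> t = (cmv (a t) :: 'n cmat)" for t
  have \<delta>: "\<delta> (CARD('n) - 1) = 0" using \<delta>1(1) \<delta>2(1) by (simp add: \<delta>_def)
  have fac: "fac even (\<lambda>k. \<alpha> k + complex_of_real t * \<delta>1 k) = (fac even (a t) :: 'n cmat)"
    "fac odd (\<lambda>k. \<alpha> k + complex_of_real t * \<delta>2 k) = (fac odd (a t) :: 'n cmat)" for t
    by (intro fac_cong; simp add: a_def \<delta>_def)+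
  have a0: "a 0 = \<alpha>" by (simp add: a_def fun_eq_iff)
  have "(\<gamma> has_vector_derivative ham X C) (at 0)"
  proof -
    have "((\<lambda>t. (fac even (a t) :: 'n cmat) ** (fac odd (a t))) has_vector_derivative
        (fac even (a 0) :: 'n cmat) ** ham (X ** ?L) ?M + ham (?M ** X) ?L ** fac odd (a 0)) (at 0)"
      using \<delta>1(2) \<delta>2(2) unfolding fac
      by (intro bounded_bilinear.has_vector_derivative[OF bounded_bilinear_matrix_mult])
    then show ?thesis
      unfolding \<gamma>_def C cmv_eq_fac ham_mult a0 by (simp add: add.commute)
  qed
  moreover have "\<exists>e>0. \<forall>t. \<bar>t\<bar> < e \<longrightarrow> admissible TYPE('n) (a t)"
  proof -
    have "\<forall>\<^sub>F t in nhds 0. cmod (a t k) < 1" if "k < CARD('n) - 1" for k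
    proof -
      have "((\<lambda>t. cmod (a t k)) \<longlongrightarrow> cmod (a 0 k)) (nhds 0)"
        unfolding a_def by (intro tendsto_intros filterlim_ident)
      then show ?thesis using \<alpha> that by (intro order_tendstoD) (auto simp: a0 admissible_def)
    qed
    then have "\<forall>\<^sub>F t in nhds 0. \<forall>k\<in>{..<CARD('n) - 1}. cmod (a t k) < 1"
      by (intro eventually_ball_finite) auto
    then obtain e where "e > 0" "\<And>t. dist t 0 < e \<Longrightarrow> \<forall>k\<in>{..<CARD('n) - 1}. cmod (a t k) < 1"
      by (auto simp: eventually_nhds_metric)
    moreover have "cmod (a t (CARD('n) - 1)) = 1" for t
      using \<alpha> \<delta> by (simp add: a_def admissible_def)
    ultimately show ?thesis by (intro exI[of _ e]) (auto simp: admissible_def dist_norm)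
  qed
  then obtain e where e: "e > 0" "\<And>t. \<bar>t\<bar> < e \<Longrightarrow> admissible TYPE('n) (a t)" by blast
  have "\<gamma> t \<in> CMV \<and> det (\<gamma> t) = det C" if "\<bar>t\<bar> < e" for t
  proof
    show "\<gamma> t \<in> CMV" using e(2)[OF that] by (auto simp: CMV_iff \<gamma>_def)
    have "det (fac Q (a t) :: 'n cmat) = det (fac Q \<alpha> :: 'n cmat)" if Q: "alternating Q" for Q
      using det_fac_curve[of Q \<delta> e \<alpha> t, OF Q \<delta> e(2)[unfolded a_def] \<open>\<bar>t\<bar> < e\<close>]
      by (simp add: a_def[abs_def])
    then show "det (\<gamma> t) = det C"
      by (simp add: \<gamma>_def C cmv_eq_fac det_mul alternating_even alternating_odd)
  qed
  then have "\<forall>\<^sub>F t in at 0. \<gamma> t \<in> CMV \<and> det (\<gamma> t) = det C"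
    using e(1) by (auto simp: eventually_at intro!: exI[of _ e])
  moreover have "\<gamma> 0 = C" by (simp add: \<gamma>_def C a0)
  ultimately show ?thesis by blast
qed

subsection \<open>Independence of the bracket from the extension\<close>

text \<open>Derivatives within \<open>S\<close> need not be unique as linear maps, but the chain
  rule along a curve in \<open>S\<close> determines them on its tangent.\<close>

lemma tangent_derivative_unique:
  fixes f :: "'x::real_normed_vector \<Rightarrow> real"
  assumes f: "(f has_derivative f1) (at C within S)" "(f has_derivative f2) (at C within S)"
    and C: "C \<in> S" and \<gamma>: "\<gamma> 0 = C" "(\<gamma> has_vector_derivative V) (at 0)"
    "\<forall>\<^sub>F t in at (0::real). \<gamma> t \<in> S"
  shows "f1 V = f2 V"
proof -
  obtain e where e: "e > 0" "\<And>t. t \<noteq> 0 \<Longrightarrow> dist t 0 < e \<Longrightarrow> \<gamma> t \<in> S"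
    using \<gamma>(3) by (auto simp: eventually_at)
  have sub: "\<gamma> ` ball 0 e \<subseteq> S"
  proof
    fix y assume "y \<in> \<gamma> ` ball 0 e"
    then obtain t where "y = \<gamma> t" "dist t 0 < e" by (auto simp: dist_commute)
    then show "y \<in> S" using e(2)[of t] C \<gamma>(1) by (cases "t = 0") auto
  qed
  have at: "at 0 within ball 0 e = at (0::real)" using e(1) by (intro at_within_open) auto
  have d: "((f \<circ> \<gamma>) has_vector_derivative g V) (at 0)" if "(f has_derivative g) (at C within S)" for g
    using vector_derivative_diff_chain_within[of \<gamma> V 0 "ball 0 e" f g] \<gamma>(1,2)
      has_derivative_subset[OF that sub] by (simp add: at)
  show ?thesis using d[OF f(1)] d[OF f(2)] by (rule vector_derivative_unique_at)
qed

text \<open>Reduces a bracket to one gradient of \<phi> and one derivative of \<psi>, provided that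
  all Hamiltonian fields at the point are tangent to \<open>S\<close>.\<close>

lemma has_bracket_onI:
  fixes S :: "('n::{finite,linorder} cmat) set"
  assumes C: "C \<in> S"
    and tangent: "\<And>X. \<exists>\<gamma>. \<gamma> 0 = C \<and> (\<gamma> has_vector_derivative ham X C) (at 0) \<and>
      (\<forall>\<^sub>F t in at (0::real). \<gamma> t \<in> S)"
    and \<phi>: "has_gradient_on \<phi> X0 C S"
    and \<psi>: "(\<psi> has_derivative \<psi>') (at C within S)" "\<psi>' (ham X0 C) = c"
  shows "has_bracket_on S \<phi> \<psi> C c"
  unfolding has_bracket_on_def
proof (intro conjI allI impI)
  show "\<exists>X. has_gradient_on \<phi> X C S" using \<phi> by blast
  obtain Y where "\<psi>' = pairing Y"
    using linear_as_pairing has_derivative_linear[OF \<psi>(1)] by blast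
  then show "\<exists>Y. has_gradient_on \<psi> Y C S" using \<psi>(1) by (auto simp: has_gradient_on_def)
  fix X Y assume X: "has_gradient_on \<phi> X C S" and Y: "has_gradient_on \<psi> Y C S"
  have unique: "f1 (ham Z C) = f2 (ham Z C)"
    if "(f has_derivative f1) (at C within S)" "(f has_derivative f2) (at C within S)"
    for f :: "'n cmat \<Rightarrow> real" and f1 f2 Z
    using tangent[of Z] tangent_derivative_unique[OF that C] by blast
  \<comment> \<open>Antisymmetry puts the freedom in \<open>X\<close> into a derivative of \<phi>
    along the tangent vector \<open>ham Y C\<close>, where \<open>X\<close> and \<open>X0\<close>
    agree; turning back, the freedom in \<open>Y\<close> disappears along
    \<open>ham X0 C\<close>.\<close>
  have "gd_bracket C X Y = - pairing X (ham Y C)"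
    using gd_bracket_antisym gd_bracket_eq_ham by metis
  also have "pairing X (ham Y C) = pairing X0 (ham Y C)"
    using X \<phi> unique unfolding has_gradient_on_def by blast
  also have "- \<dots> = gd_bracket C X0 Y"
    using gd_bracket_antisym gd_bracket_eq_ham by metis
  also have "\<dots> = \<psi>' (ham X0 C)"
    using Y \<psi>(1) unique unfolding has_gradient_on_def gd_bracket_eq_ham by blast
  finally show "gd_bracket C X Y = c" using \<psi>(2) by simp
qed

subsection \<open>Derivatives of spectral data\<close>

lemma bounded_linear_mat: "bounded_linear (mat :: complex \<Rightarrow> 'n::finite cmat)"
proof -
  have "linear (mat :: complex \<Rightarrow> 'n cmat)"
    by (intro linearI cmat_eqI) (simp_all add: mat_nth)
  then show ?thesis by (simp add: linear_conv_bounded_linear)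
qed

lemma bounded_linear_trace: "bounded_linear (trace :: 'n::finite cmat \<Rightarrow> complex)"
proof -
  have "linear (trace :: 'n cmat \<Rightarrow> complex)"
    by (intro linearI) (simp_all add: trace_def scaleR_sum_right sum.distrib)
  then show ?thesis by (simp add: linear_conv_bounded_linear)
qed

lemmas has_derivative_matrix_mult = bounded_bilinear.FDERIV[OF bounded_bilinear_matrix_mult]
lemmas tendsto_matrix_mult = bounded_bilinear.tendsto[OF bounded_bilinear_matrix_mult]
lemmas has_derivative_mat = bounded_linear.has_derivative[OF bounded_linear_mat]
lemmas tendsto_mat = bounded_linear.tendsto[OF bounded_linear_mat]
lemmas has_derivative_trace = bounded_linear.has_derivative[OF bounded_linear_trace]
lemmas tendsto_trace = bounded_linear.tendsto[OF bounded_linear_trace]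

text \<open>The projection of \<open>unitary_spectrum\<close> with nodes and matrix as free
  variables, so that it can be differentiated jointly in both.\<close>

definition eproj :: "('a \<Rightarrow> complex) \<Rightarrow> 'a set \<Rightarrow> 'a \<Rightarrow> 'n::finite cmat \<Rightarrow> 'n cmat" where
  "eproj z J j A = poly_mat (lagr z J j) A"

lemma poly_mat_lagr_factor:
  "poly_mat (smult c [:- w, 1:]) A = mat c ** (A - mat w)"
proof -
  have "mat (- w) + A = A - mat w" by (rule cmat_eqI) (simp add: mat_nth)
  then show ?thesis by (simp only: poly_mat_smult poly_mat_linear)
qed

lemma tendsto_eproj:
  fixes B :: "'x \<Rightarrow> 'n::finite cmat"
  assumes J: "finite J" "inj_on z0 J" "j \<in> J" and B: "(B \<longlongrightarrow> B0) F"
    and z: "\<And>k. k \<in> J \<Longrightarrow> (z k \<longlongrightarrow> z0 k) F"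
  shows "((\<lambda>x. eproj (\<lambda>k. z k x) J j (B x)) \<longlongrightarrow> eproj z0 J j B0) F"
proof -
  have "((\<lambda>x. poly_mat (\<Prod>k\<in>K. smult (1 / (z j x - z k x)) [:- z k x, 1:]) (B x)) \<longlongrightarrow>
      poly_mat (\<Prod>k\<in>K. smult (1 / (z0 j - z0 k)) [:- z0 k, 1:]) B0) F"
    if "finite K" "K \<subseteq> J - {j}" for K
    using that
  proof (induction K)
    case (insert a K)
    have "z0 j - z0 a \<noteq> 0" using J insert.prems by (auto simp: inj_on_def)
    then show ?case using insert J
      unfolding prod.insert[OF insert.hyps] poly_mat_mult poly_mat_lagr_factor
      by (intro tendsto_matrix_mult tendsto_mat tendsto_intros B z) auto
  qed simp
  then show ?thesis unfolding eproj_def lagr_def using J(1) by blast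
qed

text \<open>The commutator with \<open>A\<close> is a derivation. In a direction where the nodes are
  stationary each linear factor moves by that commutator, hence so does the product.\<close>

lemma has_derivative_eproj:
  fixes B :: "'x::real_normed_vector \<Rightarrow> 'n::finite cmat"
  assumes J: "finite J" "inj_on (\<lambda>k. z k x) J" "j \<in> J"
    and B: "(B has_derivative B') (at x within S)" "B' v = A ** B x - B x ** A"
    and z: "\<And>k. k \<in> J \<Longrightarrow> (z k has_derivative z' k) (at x within S)"
      "\<And>k. k \<in> J \<Longrightarrow> z' k v = 0"
  shows "\<exists>P'. ((\<lambda>x. eproj (\<lambda>k. z k x) J j (B x)) has_derivative P') (at x within S) \<and>
    P' v = A ** eproj (\<lambda>k. z k x) J j (B x) - eproj (\<lambda>k. z k x) J j (B x) ** A"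
proof -
  define p where "p K y = poly_mat (\<Prod>k\<in>K. smult (1 / (z j y - z k y)) [:- z k y, 1:]) (B y)" for K y
  have "\<exists>P'. (p K has_derivative P') (at x within S) \<and> P' v = A ** p K x - p K x ** A"
    if "finite K" "K \<subseteq> J - {j}" for K
    using that
  proof (induction K)
    case empty
    have "p {} = (\<lambda>y. mat 1)" by (simp add: p_def fun_eq_iff)
    then show ?case by (auto intro!: exI[of _ "\<lambda>_. 0"])
  next
    case (insert a K)
    then obtain P' where P': "(p K has_derivative P') (at x within S)" "P' v = A ** p K x - p K x ** A"
      by auto
    define c where "c y = inverse (z j y - z a y)" for y
    have nz: "z j x - z a x \<noteq> 0" using J insert.prems by (auto simp: inj_on_def)
    have "(c has_derivative (\<lambda>h. - (inverse (z j x - z a x) * (z' j h - z' a h) * inverse (z j x - z a x))))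
        (at x within S)"
      unfolding c_def
    proof (rule Deriv.has_derivative_inverse)
      show "z j x - z a x \<noteq> 0" by (rule nz)
      show "((\<lambda>y. z j y - z a y) has_derivative (\<lambda>h. z' j h - z' a h)) (at x within S)"
        using insert.prems J(3) by (intro has_derivative_diff z(1)) auto
    qed
    then obtain c' where c': "(c has_derivative c') (at x within S)" "c' v = 0"
      using z(2) insert.prems J(3) by force
    let ?g = "\<lambda>y. mat (c y) ** (B y - mat (z a y))"
    have g: "(?g has_derivative (\<lambda>h. mat (c x) ** (B' h - mat (z' a h)) + mat (c' h) ** (B x - mat (z a x))))
        (at x within S)"
      using insert.prems by (intro has_derivative_matrix_mult has_derivative_mat has_derivative_diff c' B z) auto
    have p: "p (insert a K) = (\<lambda>y. ?g y ** p K y)"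
      unfolding p_def prod.insert[OF insert.hyps] poly_mat_mult poly_mat_lagr_factor c_def
      by (simp add: divide_inverse)
    have "z' a v = 0" using z(2) insert.prems by auto
    then have gv: "mat (c x) ** (B' v - mat (z' a v)) + mat (c' v) ** (B x - mat (z a x)) =
        A ** ?g x - ?g x ** A"
      unfolding c' B(2) mat_left_commute[of A]
      by (simp add: matrix_sub_rdistrib matrix_sub_ldistrib mat_commute[of A] flip: matrix_mul_assoc)
    show ?case
      unfolding p
      by (intro exI conjI, rule has_derivative_matrix_mult[OF g P'(1)])
        (simp only: gv P'(2), simp only: matrix_ring_simps, simp)
  qed
  then show ?thesis unfolding eproj_def lagr_def p_def using J(1) by blast
qed

text \<open>Caratheodory's criterion: an exact factorization of the increment with a slope
  \<open>K\<close> continuous at \<open>C\<close>. It works within any set \<open>S\<close>.\<close>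

lemma has_derivative_caratheodory:
  fixes f :: "'n::finite cmat \<Rightarrow> complex"
  assumes f: "\<forall>\<^sub>F B in at C within S. f B - f C = trace (K B ** (B - C))"
    and K: "(K \<longlongrightarrow> K0) (at C within S)"
  shows "(f has_derivative (\<lambda>D. trace (K0 ** D))) (at C within S)"
proof -
  have bb: "bounded_bilinear (\<lambda>K D. trace ((K :: 'n cmat) ** (D :: 'n cmat)))"
  proof -
    note c = bounded_linear_compose[OF bounded_linear_trace]
    have "bilinear (\<lambda>K D. trace ((K :: 'n cmat) ** (D :: 'n cmat)))"
      unfolding bilinear_def
      by (intro allI conjI bounded_linear.linear
          c[OF bounded_bilinear.bounded_linear_right[OF bounded_bilinear_matrix_mult]]
          c[OF bounded_bilinear.bounded_linear_left[OF bounded_bilinear_matrix_mult]])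
    then show ?thesis by (simp add: bilinear_conv_bounded_bilinear)
  qed
  obtain M where M: "\<And>(K :: 'n cmat) (D :: 'n cmat). norm (trace (K ** D)) \<le> norm K * norm D * M"
    using bounded_bilinear.bounded[OF bb] by blast
  show ?thesis
    unfolding has_derivative_within
  proof
    show "bounded_linear (\<lambda>D. trace (K0 ** D))"
      by (rule bounded_bilinear.bounded_linear_right[OF bb])
    show "((\<lambda>B. (1 / norm (B - C)) *\<^sub>R (f B - (f C + trace (K0 ** (B - C))))) \<longlongrightarrow> 0) (at C within S)"
    proof (rule Lim_null_comparison)
      show "((\<lambda>B. norm (K B - K0) * M) \<longlongrightarrow> 0) (at C within S)"
        using tendsto_norm_zero[OF LIM_zero[OF K]] by (rule tendsto_mult_left_zero)
      have "\<forall>\<^sub>F B in at C within S. B \<noteq> C" by (simp add: eventually_at_filter)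
      with f show "\<forall>\<^sub>F B in at C within S.
          norm ((1 / norm (B - C)) *\<^sub>R (f B - (f C + trace (K0 ** (B - C))))) \<le> norm (K B - K0) * M"
      proof eventually_elim
        case (elim B)
        then have "f B - (f C + trace (K0 ** (B - C))) = trace ((K B - K0) ** (B - C))"
          by (simp add: matrix_sub_rdistrib trace_sub algebra_simps)
        moreover have "norm (trace ((K B - K0) ** (B - C))) \<le> norm (K B - K0) * M * norm (B - C)"
          using M[of "K B - K0" "B - C"] by (simp add: mult_ac)
        ultimately show ?case using elim by (simp add: divide_simps mult_ac)
      qed
    qed
  qed
qed

lemma poly_mat_commute_right:
  fixes W C :: "'n::finite cmat"
  assumes "W ** C = C ** W" shows "W ** poly_mat p C = poly_mat p C ** W"
proof (induction p)
  case (pCons a p)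
  have "W ** (C ** poly_mat p C) = C ** (W ** poly_mat p C)"
    by (simp add: matrix_mul_assoc assms)
  then show ?case
    by (simp add: poly_mat_pCons matrix_add_ldistrib matrix_add_rdistrib mat_commute[of W] pCons
        matrix_mul_assoc)
qed simp

text \<open>The derivative of a polynomial of a matrix is not a plain product, but under a trace
  against anything commuting with \<open>C\<close> it acts like one. The test matrix
  \<open>W\<close> is needed for the induction, where it turns into \<open>W ** C\<close>.\<close>

lemma has_derivative_poly_mat:
  fixes C :: "'n::finite cmat"
  shows "\<exists>M'. (poly_mat p has_derivative M') (at C within S) \<and>
    (\<forall>W D. W ** C = C ** W \<longrightarrow> trace (W ** M' D) = trace (W ** poly_mat (pderiv p) C ** D))"
proof (induction p)
  case 0
  show ?case by (intro exI[of _ "\<lambda>_. 0"]) (auto simp: poly_mat_0[abs_def] simp flip: trace_0)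
next
  case (pCons a p)
  then obtain M' where M': "(poly_mat p has_derivative M') (at C within S)"
    "\<And>W D. W ** C = C ** W \<Longrightarrow> trace (W ** M' D) = trace (W ** poly_mat (pderiv p) C ** D)"
    by blast
  have "((\<lambda>B. mat a + B ** poly_mat p B) has_derivative (\<lambda>D. 0 + (C ** M' D + D ** poly_mat p C)))
      (at C within S)"
    by (intro has_derivative_add has_derivative_const has_derivative_matrix_mult has_derivative_ident M')
  moreover have "trace (W ** (0 + (C ** M' D + D ** poly_mat p C))) =
      trace (W ** poly_mat (pderiv (pCons a p)) C ** D)" if W: "W ** C = C ** W" for W D
  proof -
    have "(W ** C) ** C = C ** (W ** C)"
      by (metis W matrix_mul_assoc)
    then have "trace (W ** C ** M' D) = trace (W ** C ** poly_mat (pderiv p) C ** D)"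
      by (rule M'(2))
    moreover have "trace (W ** (D ** poly_mat p C)) = trace (W ** poly_mat p C ** D)"
    proof -
      have "trace (W ** (D ** poly_mat p C)) = trace ((W ** D) ** poly_mat p C)"
        by (simp only: matrix_mul_assoc)
      also have "\<dots> = trace (poly_mat p C ** (W ** D))" by (rule trace_mult_commute)
      finally show ?thesis by (simp add: matrix_mul_assoc poly_mat_commute_right[OF W])
    qed
    ultimately show ?thesis
      by (simp add: pderiv_pCons poly_mat_add poly_mat_pCons matrix_ring_simps trace_add)
  qed
  ultimately show ?case unfolding poly_mat_pCons[abs_def] by blast
qed

lemma has_gradient_hamiltonian:
  "has_gradient_on (hamiltonian f) (poly_mat (pderiv f) C) C (S :: ('n::{finite,linorder} cmat) set)"
proof -
  obtain M' where M': "(poly_mat f has_derivative M') (at C within S)"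
    "\<And>W D. W ** C = C ** W \<Longrightarrow> trace (W ** M' D) = trace (W ** poly_mat (pderiv f) C ** D)"
    using has_derivative_poly_mat by blast
  have "trace (M' D) = trace (poly_mat (pderiv f) C ** D)" for D
    using M'(2)[of "mat 1" D] by simp
  then show ?thesis
    unfolding has_gradient_on_def hamiltonian_def pairing_def
    using has_derivative_Im[OF has_derivative_trace[OF M'(1)]] by simp
qed

subsection \<open>Labelled spectra of families of CMV matrices\<close>

declare One_nat_def [simp del]

text \<open>Removes the measure: from here on masses are corner entries of projections.\<close>

lemma labelled_first:
  fixes A :: "'x::topological_space \<Rightarrow> 'n::{finite,linorder} cmat"
  assumes lab: "spectral_labelling A S \<theta> \<mu>" and x: "x \<in> S"
    and spec: "unitary_spectrum (A x) {1..CARD('n)} (\<lambda>j. cis (\<theta> j x))" and j: "j \<in> {1..CARD('n)}"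
  shows "\<mu> j x = unitary_spectrum.mass (A x) {1..CARD('n)} (\<lambda>j. cis (\<theta> j x)) j"
    "\<mu> j x = Re (eproj (\<lambda>j. cis (\<theta> j x)) {1..CARD('n)} j (A x) $ first $ first)"
proof -
  interpret unitary_spectrum "A x" "{1..CARD('n)}" "\<lambda>j. cis (\<theta> j x)" by (rule spec)
  show "\<mu> j x = mass j"
    using lab x j measure_spectral_measure[OF j] by (simp add: spectral_labelling_def)
  then show "\<mu> j x = Re (eproj (\<lambda>j. cis (\<theta> j x)) {1..CARD('n)} j (A x) $ first $ first)"
    by (simp add: mass_def P_def eproj_def)
qed

text \<open>\<open>S\<close> is kept general to cover both open pieces of the CMV matrices and open
  pieces of a leaf of fixed determinant.\<close>

locale labelled_CMV =
  fixes S :: "('n::{finite,linorder} cmat) set" and C \<theta> \<mu>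
  assumes S: "S \<subseteq> CMV" and C: "C \<in> S" and lab: "spectral_labelling (\<lambda>B. B) S \<theta> \<mu>"
begin

abbreviation z :: "nat \<Rightarrow> 'n cmat \<Rightarrow> complex" where "z j B \<equiv> cis (\<theta> j B)"

definition E :: "nat \<Rightarrow> 'n cmat \<Rightarrow> 'n cmat" where
  "E j B = eproj (\<lambda>k. z k B) {1..CARD('n)} j B"

lemma spec: "B \<in> S \<Longrightarrow> cyclic_spectrum B {1..CARD('n)} (\<lambda>j. z j B)"
  using S lab by (intro CMV_labelled_spectrum) (auto simp: spectral_labelling_def)

lemma E_eq_P:
  assumes "B \<in> S" shows "E j B = unitary_spectrum.P B {1..CARD('n)} (\<lambda>j. z j B) j"
proof -
  interpret cyclic_spectrum B "{1..CARD('n)}" "\<lambda>j. z j B" by (rule spec[OF assms])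
  show ?thesis by (simp add: E_def eproj_def P_def)
qed

sublocale at_C: cyclic_spectrum C "{1..CARD('n)}" "\<lambda>j. z j C"
  by (rule spec[OF C])

lemma mass_eq:
  assumes "B \<in> S" "j \<in> {1..CARD('n)}"
  shows "\<mu> j B = Re (E j B $ first $ first)" "\<mu> j B > 0"
proof -
  interpret cyclic_spectrum B "{1..CARD('n)}" "\<lambda>j. z j B" by (rule spec[OF assms(1)])
  note l = labelled_first[OF lab assms(1) unitary_spectrum_axioms assms(2)]
  show "\<mu> j B = Re (E j B $ first $ first)" using l(2) by (simp add: E_def)
  show "\<mu> j B > 0" using l(1) mass_pos[OF assms(2)] by simp
qed

lemma tendsto_z: "j \<in> {1..CARD('n)} \<Longrightarrow> (z j \<longlongrightarrow> z j C) (at C within S)"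
  using lab C unfolding spectral_labelling_def continuous_on_def by (intro tendsto_cis) blast

lemma tendsto_E: "j \<in> {1..CARD('n)} \<Longrightarrow> (E j \<longlongrightarrow> E j C) (at C within S)"
  unfolding E_def[abs_def]
  by (rule tendsto_eproj) (auto intro: tendsto_z at_C.inj tendsto_ident_at)

text \<open>First-order perturbation theory: \<open>tr (E\<^sub>j(C) (B - C) E\<^sub>j(B)) = (z\<^sub>j(B) - z\<^sub>j(C)) tr (E\<^sub>j(C) E\<^sub>j(B))\<close>.\<close>

lemma has_derivative_z:
  assumes j: "j \<in> {1..CARD('n)}"
  shows "(z j has_derivative (\<lambda>D. trace (E j C ** D))) (at C within S)"
proof -
  let ?T = "\<lambda>B. trace (E j C ** E j B)"
  \<comment> \<open>The slope in the perturbation identity, divided by the overlap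
    \<open>?T B\<close> of the two projections. The overlap tends to the trace 1 of a rank one
    projection, so it is nonzero near \<open>C\<close>.\<close>
  define K where "K B = mat (1 / ?T B) ** (E j B ** E j C)" for B
  have EE: "E j C ** E j C = E j C" using at_C.P_P[OF j j] by (simp add: E_eq_P[OF C])
  have t1: "trace (E j C) = 1" using at_C.trace_P[OF j] by (simp add: E_eq_P[OF C])
  have T: "(?T \<longlongrightarrow> 1) (at C within S)"
    using tendsto_trace[OF tendsto_matrix_mult[OF tendsto_const[of "E j C"] tendsto_E[OF j]]]
    by (simp add: EE t1)
  have "(K \<longlongrightarrow> mat (1 / 1) ** (E j C ** E j C)) (at C within S)"
    unfolding K_def[abs_def] using T
    by (intro tendsto_matrix_mult tendsto_mat tendsto_divide tendsto_const tendsto_E j) auto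
  then have K: "(K \<longlongrightarrow> E j C) (at C within S)" by (simp add: EE)
  have "\<forall>\<^sub>F B in at C within S. ?T B \<noteq> 0"
    using T by (rule tendsto_imp_eventually_ne) simp
  moreover have "\<forall>\<^sub>F B in at C within S. B \<in> S" by (simp add: eventually_at_filter)
  ultimately have "\<forall>\<^sub>F B in at C within S. z j B - z j C = trace (K B ** (B - C))"
  proof eventually_elim
    case (elim B)
    interpret B: cyclic_spectrum B "{1..CARD('n)}" "\<lambda>j. z j B" by (rule spec[OF elim(2)])
    have 1: "B ** E j B = mat (z j B) ** E j B" using B.A_P[OF j] by (simp add: E_eq_P[OF elim(2)])
    have 2: "E j C ** C = mat (z j C) ** E j C"
      using at_C.A_P[OF j] at_C.P_commute[of j "[:0, 1:]"] by (simp add: E_eq_P[OF C] poly_mat_X)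
    have "trace (K B ** (B - C)) = trace (mat (1 / ?T B) ** ((E j B ** E j C) ** (B - C)))"
      unfolding K_def by (simp only: matrix_mul_assoc)
    also have "\<dots> = trace ((E j B ** E j C) ** (B - C)) / ?T B"
      by (simp add: trace_def sum_divide_distrib)
    also have "trace ((E j B ** E j C) ** (B - C)) = trace (E j C ** (B - C) ** E j B)"
      by (metis matrix_mul_assoc trace_mult_commute)
    also have "E j C ** (B - C) ** E j B = E j C ** (B ** E j B) - (E j C ** C) ** E j B"
      by (simp add: matrix_ring_simps)
    also have "\<dots> = mat (z j B - z j C) ** (E j C ** E j B)"
      unfolding 1 2 mat_left_commute[of "E j C"]
      by (rule cmat_eqI) (simp add: algebra_simps flip: matrix_mul_assoc)
    also have "trace \<dots> = (z j B - z j C) * ?T B"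
      by (simp add: trace_def sum_distrib_left)
    finally show ?case using elim(1) by simp
  qed
  then show ?thesis using K by (rule has_derivative_caratheodory)
qed

lemma E_commute: "E j C ** C = C ** E j C"
  using at_C.P_commute[of j "[:0, 1:]"] by (simp add: E_eq_P[OF C] poly_mat_X)

text \<open>A general polynomial \<open>g\<close> serves both brackets: \<open>pderiv f\<close> for
  the Hamiltonian, and a scaled Lagrange polynomial for an angle.\<close>

lemma has_derivative_log_mass:
  assumes j: "j \<in> {1..CARD('n)}"
  shows "\<exists>\<psi>'. ((\<lambda>B. ln (\<mu> j B)) has_derivative \<psi>') (at C within S) \<and>
    \<psi>' (ham (poly_mat g C) C) =
      2 * Re (z j C * poly g (z j C)) - (\<Sum>k\<in>{1..CARD('n)}. 2 * Re (z k C * poly g (z k C)) * \<mu> k C)"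
proof -
  let ?G = "poly_mat ([:0, 1:] * g) C"
  have G: "?G = C ** poly_mat g C" by (simp only: poly_mat_mult poly_mat_X)
  have V: "ham (poly_mat g C) C = proj_a ?G ** C - C ** proj_a ?G"
    unfolding G using poly_mat_commute[of g C "[:0, 1:]"] by (intro ham_commuting) (simp add: poly_mat_X)
  \<comment> \<open>The eigenvalues are stationary: a commutator with \<open>C\<close> has zero
    trace against a matrix commuting with \<open>C\<close>.\<close>
  have z0: "trace (E k C ** ham (poly_mat g C) C) = 0" if "k \<in> {1..CARD('n)}" for k
  proof -
    have "trace (E k C ** (proj_a ?G ** C)) = trace (C ** (E k C ** proj_a ?G))"
      by (metis matrix_mul_assoc trace_mult_commute)
    also have "C ** (E k C ** proj_a ?G) = E k C ** (C ** proj_a ?G)"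
      by (simp add: matrix_mul_assoc E_commute)
    finally show ?thesis unfolding V by (simp add: matrix_sub_ldistrib trace_sub)
  qed
  obtain P' where P': "(E j has_derivative P') (at C within S)"
    "P' (ham (poly_mat g C) C) = proj_a ?G ** E j C - E j C ** proj_a ?G"
    using has_derivative_eproj[where B = "\<lambda>B. B" and B' = "\<lambda>D. D" and z = z and x = C and S = S and
        J = "{1..CARD('n)}" and j = j and v = "ham (poly_mat g C) C" and A = "proj_a ?G", OF _ _ j _ V has_derivative_z z0]
      at_C.inj unfolding E_def[abs_def] by auto
  have "((\<lambda>B. Re (E j B $ first $ first)) has_derivative (\<lambda>D. Re (P' D $ first $ first))) (at C within S)"
    by (intro has_derivative_Re bounded_linear.has_derivative[OF bounded_linear_vec_nth] P')
  then have "(\<mu> j has_derivative (\<lambda>D. Re (P' D $ first $ first))) (at C within S)"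
    using mass_eq(1) j C by (elim has_derivative_transform_within[where d = 1]) auto
  then have "((\<lambda>B. ln (\<mu> j B)) has_derivative (\<lambda>D. Re (P' D $ first $ first) * inverse (\<mu> j C))) (at C within S)"
    using mass_eq(2)[OF C j] by (intro has_derivative_ln)
  moreover have "Re (P' (ham (poly_mat g C) C) $ first $ first) * inverse (\<mu> j C) =
      2 * Re (z j C * poly g (z j C)) - (\<Sum>k\<in>{1..CARD('n)}. 2 * Re (z k C * poly g (z k C)) * \<mu> k C)"
  proof -
    have m: "\<mu> k C = at_C.mass k" if "k \<in> {1..CARD('n)}" for k
      using labelled_first(1)[OF lab C at_C.unitary_spectrum_axioms that] .
    have "(\<Sum>k\<in>{1..CARD('n)}. 2 * Re (z k C * poly g (z k C)) * at_C.mass k) =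
        (\<Sum>k\<in>{1..CARD('n)}. 2 * Re (z k C * poly g (z k C)) * \<mu> k C)"
      by (intro sum.cong refl) (simp add: m)
    then show ?thesis
      using at_C.commutator_first[OF j, of "[:0, 1:] * g"] at_C.mass_pos[OF j]
      by (simp add: P'(2) E_eq_P[OF C] m[OF j])
  qed
  ultimately show ?thesis by blast
qed

text \<open>Near \<open>C\<close> the angle is its value there plus Im Ln of the eigenvalue divided
  by its value at \<open>C\<close>. That quotient is close to 1, away from the branch cut.\<close>

lemma has_gradient_angle:
  assumes l: "l \<in> {1..CARD('n)}"
  shows "has_gradient_on (\<theta> l) (poly_mat (smult (1 / z l C) (lagr (\<lambda>k. z k C) {1..CARD('n)} l)) C) C S"
proof -
  let ?w = "\<lambda>B. z l B / z l C"
  have "(?w has_derivative (\<lambda>D. trace (E l C ** D) / z l C)) (at C within S)"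
    using has_derivative_z[OF l] by (rule bounded_linear.has_derivative[OF bounded_linear_divide])
  moreover have "(Ln has_derivative (\<lambda>h. h)) (at (?w C))"
  proof -
    have "(*) 1 = (\<lambda>h :: complex. h)" by auto
    then show ?thesis using has_field_derivative_Ln[of 1] by (simp add: has_field_derivative_def)
  qed
  ultimately have "((\<lambda>B. Ln (?w B)) has_derivative (\<lambda>D. trace (E l C ** D) / z l C)) (at C within S)"
    by (rule has_derivative_compose)
  then have d: "((\<lambda>B. \<theta> l C + Im (Ln (?w B))) has_derivative (\<lambda>D. 0 + Im (trace (E l C ** D) / z l C))) (at C within S)"
    by (intro has_derivative_add has_derivative_const has_derivative_Im)
  have "continuous_on S (\<theta> l)" using lab l by (auto simp: spectral_labelling_def)
  \<comment> \<open>A difference below pi keeps the exponent in the principal strip, so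
    \<open>Ln\<close> recovers the labelled angle without a jump by 2 pi.\<close>
  then obtain d where d0: "d > 0" "\<And>B. B \<in> S \<Longrightarrow> dist B C < d \<Longrightarrow> dist (\<theta> l B) (\<theta> l C) < pi"
    using C pi_gt_zero unfolding continuous_on_iff by meson
  have "\<theta> l C + Im (Ln (?w B)) = \<theta> l B" if "B \<in> S" "dist B C < d" for B
  proof -
    have "\<bar>\<theta> l B - \<theta> l C\<bar> < pi" using d0(2)[OF that] by (simp add: dist_norm)
    then have "Ln (exp (\<i> * complex_of_real (\<theta> l B - \<theta> l C))) = \<i> * complex_of_real (\<theta> l B - \<theta> l C)"
      by (intro Ln_exp) auto
    moreover have "?w B = exp (\<i> * complex_of_real (\<theta> l B - \<theta> l C))"
      by (simp add: cis_divide) (simp add: cis_conv_exp)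
    ultimately show ?thesis by simp
  qed
  then have "(\<theta> l has_derivative (\<lambda>D. 0 + Im (trace (E l C ** D) / z l C))) (at C within S)"
    by (intro has_derivative_transform_within[OF d d0(1) C]) (auto simp: dist_commute)
  moreover have "0 + Im (trace (E l C ** D) / z l C) =
      pairing (poly_mat (smult (1 / z l C) (lagr (\<lambda>k. z k C) {1..CARD('n)} l)) C) D" for D
  proof -
    have "trace (mat (1 / z l C) ** E l C ** D) = trace (mat (1 / z l C) ** (E l C ** D))"
      by (simp only: matrix_mul_assoc)
    also have "\<dots> = trace (E l C ** D) / z l C" by (simp add: trace_def sum_divide_distrib)
    finally show ?thesis by (simp add: pairing_def poly_mat_smult E_def eproj_def)
  qed
  ultimately show ?thesis by (simp add: has_gradient_on_def)
qed

end

section \<open>The brackets on the CMV matrices and on their leaves\<close>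

lemma tangent_open:
  assumes "\<exists>\<gamma>. \<gamma> 0 = C \<and> (\<gamma> has_vector_derivative V) (at 0) \<and> (\<forall>\<^sub>F t in at (0::real). \<gamma> t \<in> S)"
    and "open U" "C \<in> U"
  shows "\<exists>\<gamma>. \<gamma> 0 = C \<and> (\<gamma> has_vector_derivative V) (at 0) \<and> (\<forall>\<^sub>F t in at (0::real). \<gamma> t \<in> U \<inter> S)"
proof -
  obtain \<gamma> where \<gamma>: "\<gamma> 0 = C" "(\<gamma> has_vector_derivative V) (at 0)" "\<forall>\<^sub>F t in at (0::real). \<gamma> t \<in> S"
    using assms(1) by blast
  have "(\<gamma> \<longlongrightarrow> C) (at 0)"
    using has_vector_derivative_continuous[OF \<gamma>(2)] \<gamma>(1) by (simp add: continuous_within)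
  then have "\<forall>\<^sub>F t in at 0. \<gamma> t \<in> U" using assms(2,3) by (rule topological_tendstoD)
  then have "\<forall>\<^sub>F t in at (0::real). \<gamma> t \<in> U \<inter> S" using \<gamma>(3) by eventually_elim blast
  with \<gamma>(1,2) show ?thesis by blast
qed

lemma CMV_bracket_hamiltonian:
  fixes U :: "('n::{finite,linorder} cmat) set"
  assumes "open U" "C \<in> U \<inter> CMV" "spectral_labelling (\<lambda>B. B) (U \<inter> CMV) \<theta> \<mu>"
    and j: "j \<in> {1..CARD('n)}"
  shows "has_bracket_on (U \<inter> CMV) (hamiltonian f) (\<lambda>B. ln (\<mu> j B)) C
    (F_fun f (cis (\<theta> j C)) - (\<Sum>l=1..CARD('n). F_fun f (cis (\<theta> l C)) * \<mu> l C))"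
proof -
  interpret labelled_CMV "U \<inter> CMV" C \<theta> \<mu>
    using assms by unfold_locales auto
  obtain \<psi>' where "((\<lambda>B. ln (\<mu> j B)) has_derivative \<psi>') (at C within U \<inter> CMV)"
    "\<psi>' (ham (poly_mat (pderiv f) C) C) =
      F_fun f (cis (\<theta> j C)) - (\<Sum>l=1..CARD('n). F_fun f (cis (\<theta> l C)) * \<mu> l C)"
    using has_derivative_log_mass[OF j, of "pderiv f"] unfolding F_fun_def by blast
  moreover have "\<exists>\<gamma>. \<gamma> 0 = C \<and> (\<gamma> has_vector_derivative ham X C) (at 0) \<and>
      (\<forall>\<^sub>F t in at (0::real). \<gamma> t \<in> U \<inter> CMV)" for X
  proof (rule tangent_open)
    show "\<exists>\<gamma>. \<gamma> 0 = C \<and> (\<gamma> has_vector_derivative ham X C) (at 0) \<and> (\<forall>\<^sub>F t in at (0::real). \<gamma> t \<in> CMV)"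
      using CMV_tangent[of C X] assms(2) by (auto elim!: eventually_mono)
  qed (use assms in auto)
  ultimately show ?thesis
    using C has_gradient_hamiltonian by (intro has_bracket_onI)
qed

lemma CMV_bracket_angle:
  fixes U :: "('n::{finite,linorder} cmat) set"
  assumes "open U" and C: "C \<in> U \<inter> {B \<in> CMV. det B = d}"
    and lab: "spectral_labelling (\<lambda>B. B) (U \<inter> {B \<in> CMV. det B = d}) \<theta> \<mu>"
    and j: "j \<in> {1..CARD('n) - 1}" and l: "l \<in> {1..CARD('n) - 1}"
  shows "has_bracket_on (U \<inter> {B \<in> CMV. det B = d}) (\<theta> l)
    (\<lambda>B. 1/2 * ln (\<mu> j B / \<mu> CARD('n) B)) C (if j = l then 1 else 0)"
proof -
  let ?S = "U \<inter> {B \<in> CMV. det B = d}"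
  interpret labelled_CMV ?S C \<theta> \<mu>
    using assms by unfold_locales auto
  have J: "j \<in> {1..CARD('n)}" "l \<in> {1..CARD('n)}" "CARD('n) \<in> {1..CARD('n)}" "CARD('n) \<noteq> l"
    using j l by auto
  \<comment> \<open>This is the gradient of the angle: z g(z) is 1 at the \<open>l\<close>-th
    eigenvalue and 0 at the others. The common sum \<open>s\<close> cancels in the quotient of
    masses, and the index \<open>CARD('n)\<close> differs from \<open>l\<close>, so the factor 1/2
    leaves the Kronecker delta.\<close>
  define g where "g = smult (1 / z l C) (lagr (\<lambda>k. z k C) {1..CARD('n)} l)"
  have g: "2 * Re (z k C * poly g (z k C)) = (if k = l then 2 else 0)" if "k \<in> {1..CARD('n)}" for k
    using poly_lagr[OF at_C.finite_J at_C.inj J(2) that] by (auto simp: g_def)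
  define s where "s = (\<Sum>k=1..CARD('n). 2 * Re (z k C * poly g (z k C)) * \<mu> k C)"
  have log: "\<exists>\<psi>'. ((\<lambda>B. ln (\<mu> k B)) has_derivative \<psi>') (at C within ?S) \<and>
      \<psi>' (ham (poly_mat g C) C) = (if k = l then 2 else 0) - s" if "k \<in> {1..CARD('n)}" for k
    using has_derivative_log_mass[OF that, of g] unfolding g[OF that] s_def .
  obtain \<psi>1 where \<psi>1: "((\<lambda>B. ln (\<mu> j B)) has_derivative \<psi>1) (at C within ?S)"
    "\<psi>1 (ham (poly_mat g C) C) = (if j = l then 2 else 0) - s"
    using log[OF J(1)] by blast
  obtain \<psi>2 where \<psi>2: "((\<lambda>B. ln (\<mu> CARD('n) B)) has_derivative \<psi>2) (at C within ?S)"
    "\<psi>2 (ham (poly_mat g C) C) = - s"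
    using log[OF J(3)] J(4) by auto
  have "((\<lambda>B. 1/2 * (ln (\<mu> j B) - ln (\<mu> CARD('n) B))) has_derivative (\<lambda>D. 1/2 * (\<psi>1 D - \<psi>2 D))) (at C within ?S)"
    by (intro has_derivative_mult_right has_derivative_diff \<psi>1 \<psi>2)
  then have "((\<lambda>B. 1/2 * ln (\<mu> j B / \<mu> CARD('n) B)) has_derivative (\<lambda>D. 1/2 * (\<psi>1 D - \<psi>2 D))) (at C within ?S)"
  proof (rule has_derivative_transform_within[where d = 1])
    show "1/2 * (ln (\<mu> j B) - ln (\<mu> CARD('n) B)) = 1/2 * ln (\<mu> j B / \<mu> CARD('n) B)" if "B \<in> ?S" for B
      using mass_eq(2)[OF that J(1)] mass_eq(2)[OF that J(3)] by (simp add: ln_div)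
  qed (use C in auto)
  moreover have "1/2 * (\<psi>1 (ham (poly_mat g C) C) - \<psi>2 (ham (poly_mat g C) C)) = (if j = l then 1 else 0)"
    by (simp add: \<psi>1(2) \<psi>2(2))
  moreover have "\<exists>\<gamma>. \<gamma> 0 = C \<and> (\<gamma> has_vector_derivative ham X C) (at 0) \<and>
      (\<forall>\<^sub>F t in at (0::real). \<gamma> t \<in> ?S)" for X
  proof (rule tangent_open)
    show "\<exists>\<gamma>. \<gamma> 0 = C \<and> (\<gamma> has_vector_derivative ham X C) (at 0) \<and>
        (\<forall>\<^sub>F t in at (0::real). \<gamma> t \<in> {B \<in> CMV. det B = d})"
      using CMV_tangent[of C X] C by auto
  qed (use assms in auto)
  ultimately show ?thesis
    using C has_gradient_angle[OF J(2)] unfolding g_def[symmetric] by (intro has_bracket_onI)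
qed

subsection \<open>The flow\<close>

lemma bounded_linear_pairing: "bounded_linear (pairing (Y :: 'n::{finite,linorder} cmat))"
proof -
  have "linear (pairing Y)"
    by (intro linearI) (simp_all add: pairing_def trace_mult algebra_simps sum.distrib sum_distrib_left)
  then show ?thesis by (simp add: linear_conv_bounded_linear)
qed

text \<open>The flow is given through scalar functions; testing it with the linear coordinate
  functions recovers the matrix equation in Lax form.\<close>

lemma flow_curve_derivative:
  fixes B :: "real \<Rightarrow> 'n::{finite,linorder} cmat"
  assumes flow: "flow_curve (hamiltonian f) B T" and t: "t \<in> T"
  defines "A \<equiv> proj_a (poly_mat ([:0, 1:] * pderiv f) (B t))"
  shows "(B has_vector_derivative A ** B t - B t ** A) (at t within T)"
proof -
  define X where "X = poly_mat (pderiv f) (B t)"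
  have V: "ham X (B t) = A ** B t - B t ** A"
    unfolding A_def X_def poly_mat_mult poly_mat_X
    using poly_mat_commute[of "pderiv f" "B t" "[:0, 1:]"]
    by (intro ham_commuting) (simp add: poly_mat_X)
  \<comment> \<open>In the space of all matrices every direction is tangent, along a straight
    line.\<close>
  have tangent: "\<exists>\<gamma>. \<gamma> 0 = B t \<and> (\<gamma> has_vector_derivative W) (at 0) \<and>
      (\<forall>\<^sub>F s in at (0::real). \<gamma> s \<in> UNIV)" for W
    by (intro exI[of _ "\<lambda>s. B t + s *\<^sub>R W"]) (auto intro!: derivative_eq_intros)
  have "((\<lambda>s. B s \<bullet> b) has_derivative (\<lambda>h. (h *\<^sub>R ham X (B t)) \<bullet> b)) (at t within T)" for b
  proof -
    have "linear (\<lambda>D. D \<bullet> b)" by (intro linearI) (simp_all add: inner_add_left)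
    then obtain Y where Y: "(\<lambda>D. D \<bullet> b) = pairing Y" using linear_as_pairing by blast
    have "has_bracket_on UNIV (hamiltonian f) (pairing Y) (B t) (pairing Y (ham X (B t)))"
      by (rule has_bracket_onI[OF UNIV_I tangent, where ?X0.0 = X and \<psi>' = "pairing Y"])
        (auto simp: X_def has_gradient_hamiltonian intro: bounded_linear_imp_has_derivative bounded_linear_pairing)
    then have "((\<lambda>s. pairing Y (B s)) has_real_derivative pairing Y (ham X (B t))) (at t within T)"
      using flow t unfolding flow_curve_def by blast
    then show ?thesis
      unfolding fun_cong[OF Y, symmetric] by (simp add: has_field_derivative_def mult_commute_abs)
  qed
  then show ?thesis
    unfolding V[symmetric] has_vector_derivative_def
    by (subst has_derivative_componentwise_within) blast
qed

lemma inner_cmat: "X \<bullet> Y = Re (trace (adj X ** (Y :: 'n::finite cmat)))"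
  unfolding trace_mult inner_vec_def by (simp add: inner_complex_def) (rule sum.swap)

text \<open>For antihermitian \<open>A\<close> the derivative of the squared norm of
  \<open>M\<close> is twice the real part of tr (adj M [A, M]), and both terms are traces of
  antihermitian matrices. A conserved norm that starts at zero stays zero.\<close>

lemma isospectral_zero:
  fixes M :: "real \<Rightarrow> 'n::finite cmat"
  assumes T: "is_interval T" "t0 \<in> T" "t \<in> T" and M0: "M t0 = 0"
    and A: "\<And>t. t \<in> T \<Longrightarrow> adj (A t) = - A t"
    and M: "\<And>t. t \<in> T \<Longrightarrow> (M has_vector_derivative A t ** M t - M t ** A t) (at t within T)"
  shows "M t = 0"
proof -
  have "((\<lambda>t. M t \<bullet> M t) has_vector_derivative 0) (at t within T)" if t: "t \<in> T" for t
  proof -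
    have re: "Re (trace Z) = 0" if "adj Z = - Z" for Z :: "'n cmat"
    proof -
      have "trace (adj Z) = cnj (trace Z)" by (simp add: trace_def)
      with that have "cnj (trace Z) = - trace Z" by (simp add: trace_def sum_negf)
      then show ?thesis by (simp add: complex_eq_iff)
    qed
    have 1: "Re (trace (adj (M t) ** (A t ** M t))) = 0"
      by (rule re) (simp add: adj_mult A t matrix_minus_mult matrix_mul_assoc)
    have "trace (adj (M t) ** (M t ** A t)) = trace (M t ** A t ** adj (M t))"
      by (rule trace_mult_commute)
    moreover have "Re (trace (M t ** A t ** adj (M t))) = 0"
      by (rule re) (simp add: adj_mult A t matrix_minus_mult matrix_mul_assoc)
    ultimately have "M t \<bullet> (A t ** M t - M t ** A t) = 0"
      using 1 by (simp add: inner_cmat matrix_sub_ldistrib trace_sub)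
    then show ?thesis
      using bounded_bilinear.has_vector_derivative[OF bounded_bilinear_inner M[OF t] M[OF t]]
      by (simp add: inner_commute)
  qed
  then obtain c where c: "\<And>x. x \<in> T \<Longrightarrow> M x \<bullet> M x = c"
    using has_vector_derivative_zero_constant[OF is_interval_convex[OF T(1)], of "\<lambda>t. M t \<bullet> M t"]
    by blast
  have "M t \<bullet> M t = M t0 \<bullet> M t0" using c[OF T(2)] c[OF T(3)] by simp
  then show ?thesis by (simp add: M0)
qed

lemma has_vector_derivative_poly_mat:
  fixes B :: "real \<Rightarrow> 'n::finite cmat"
  assumes "(B has_vector_derivative A ** B t - B t ** A) (at t within T)"
  shows "((\<lambda>s. poly_mat p (B s)) has_vector_derivative
    A ** poly_mat p (B t) - poly_mat p (B t) ** A) (at t within T)"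
proof (induction p)
  case (pCons a p)
  have "((\<lambda>s. mat a + B s ** poly_mat p (B s)) has_vector_derivative
      0 + (B t ** (A ** poly_mat p (B t) - poly_mat p (B t) ** A) +
        (A ** B t - B t ** A) ** poly_mat p (B t))) (at t within T)"
    by (intro has_vector_derivative_add has_vector_derivative_const
        bounded_bilinear.has_vector_derivative[OF bounded_bilinear_matrix_mult] assms pCons)
  moreover have "0 + (B t ** (A ** poly_mat p (B t) - poly_mat p (B t) ** A) +
      (A ** B t - B t ** A) ** poly_mat p (B t)) =
      A ** poly_mat (pCons a p) (B t) - poly_mat (pCons a p) (B t) ** A"
    by (simp add: poly_mat_pCons matrix_ring_simps mat_commute[of A])
  ultimately show ?case by (simp add: poly_mat_pCons)
qed simp

lemma bounded_linear_adj: "bounded_linear (adj :: 'n::finite cmat \<Rightarrow> 'n cmat)"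
proof -
  have "linear (adj :: 'n cmat \<Rightarrow> 'n cmat)"
    by (intro linearI cmat_eqI) simp_all
  then show ?thesis by (simp add: linear_conv_bounded_linear)
qed

lemma flow_unitary:
  fixes B :: "real \<Rightarrow> 'n::finite cmat"
  assumes T: "is_interval T" "t0 \<in> T" "t \<in> T" and U: "unitary (B t0)"
    and A: "\<And>t. t \<in> T \<Longrightarrow> adj (A t) = - A t"
    and B: "\<And>t. t \<in> T \<Longrightarrow> (B has_vector_derivative A t ** B t - B t ** A t) (at t within T)"
  shows "unitary (B t)"
proof -
  have "adj (B t) ** B t - mat 1 = 0"
  proof (rule isospectral_zero[OF T _ A])
    show "adj (B t0) ** B t0 - mat 1 = 0" using U by (simp add: unitary_def)
    fix t assume t: "t \<in> T"
    have "((\<lambda>t. adj (B t) ** B t - mat 1) has_vector_derivative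
        (adj (B t) ** (A t ** B t - B t ** A t) + adj (A t ** B t - B t ** A t) ** B t) - 0) (at t within T)"
      by (intro has_vector_derivative_diff has_vector_derivative_const
          bounded_bilinear.has_vector_derivative[OF bounded_bilinear_matrix_mult]
          bounded_linear.has_vector_derivative[OF bounded_linear_adj] B t)
    moreover have "(adj (B t) ** (A t ** B t - B t ** A t) + adj (A t ** B t - B t ** A t) ** B t) - 0 =
        A t ** (adj (B t) ** B t - mat 1) - (adj (B t) ** B t - mat 1) ** A t"
      by (simp add: adj_diff adj_mult A[OF t] matrix_ring_simps)
    ultimately show "((\<lambda>t. adj (B t) ** B t - mat 1) has_vector_derivative
        A t ** (adj (B t) ** B t - mat 1) - (adj (B t) ** B t - mat 1) ** A t) (at t within T)" by simp
  qed
  then show ?thesis by (simp add: unitary_def matrix_left_right_inverse)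
qed

text \<open>The masses solve \<open>m\<^sub>j' = (F\<^sub>j - s) m\<^sub>j\<close> with a common \<open>s\<close>, so they are proportional to
  \<open>exp (F\<^sub>j t) m\<^sub>j(0)\<close>; the factor is found from \<open>\<Sum> m\<^sub>j = 1\<close>.\<close>

lemma normalized_exponential_ode:
  fixes m :: "'j \<Rightarrow> real \<Rightarrow> real"
  assumes T: "is_interval T" "0 \<in> T" "t \<in> T" and J: "finite J" "j \<in> J"
    and m: "\<And>j t. j \<in> J \<Longrightarrow> t \<in> T \<Longrightarrow>
      (m j has_real_derivative (F j - (\<Sum>k\<in>J. F k * m k t)) * m j t) (at t within T)"
    and sum1: "\<And>t. t \<in> T \<Longrightarrow> (\<Sum>k\<in>J. m k t) = 1"
  shows "m j t = exp (F j * t) * m j 0 / (\<Sum>k\<in>J. exp (F k * t) * m k 0)"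
    and "m j 0 > 0 \<Longrightarrow> m j t > 0"
proof -
  define s where "s x = (\<Sum>k\<in>J. F k * m k x)" for x
  \<comment> \<open>The compact interval between 0 and \<open>t\<close>, for either sign of
    \<open>t\<close>; the common rate \<open>s\<close> is continuous on it and has an antiderivative
    \<open>G\<close>, which is the same for all \<open>k\<close>.\<close>
  let ?I = "{min 0 t..max 0 t}"
  have I: "?I \<subseteq> T"
  proof
    fix x assume "x \<in> ?I"
    then show "x \<in> T"
      using T mem_is_interval_1_I[of T 0 t x] mem_is_interval_1_I[of T t 0 x] by (cases "0 \<le> t") auto
  qed
  have m': "(m k has_real_derivative (F k - s x) * m k x) (at x within ?I)" if "k \<in> J" "x \<in> ?I" for k x
    using m[of k x] that I unfolding s_def by (blast intro: has_field_derivative_subset)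
  have "continuous_on ?I (m k)" if "k \<in> J" for k
    by (rule DERIV_continuous_on) (rule m'[OF that])
  then have "continuous_on ?I s"
    unfolding s_def by (intro continuous_on_sum continuous_on_mult continuous_on_const)
  then obtain G where G: "\<And>x. x \<in> ?I \<Longrightarrow> (G has_vector_derivative s x) (at x within ?I)"
    using antiderivative_continuous by blast
  have scaled: "m k t = exp (G 0 - G t) * (exp (F k * t) * m k 0)" if k: "k \<in> J" for k
  proof -
    have "((\<lambda>x. m k x * exp (G x - F k * x)) has_field_derivative 0) (at x within ?I)" if x: "x \<in> ?I" for x
      using G[OF x] m'[OF k x] unfolding has_real_derivative_iff_has_vector_derivative[symmetric]
      by (auto intro!: derivative_eq_intros simp: algebra_simps)
    then obtain c where c: "\<forall>x\<in>?I. m k x * exp (G x - F k * x) = c"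
      using has_field_derivative_zero_constant[of ?I] by fastforce
    have "t \<in> ?I" "0 \<in> ?I" by auto
    from bspec[OF c this(1)] bspec[OF c this(2)]
    have "m k t * exp (G t - F k * t) = m k 0 * exp (G 0 - F k * 0)" by (rule trans[OF _ sym])
    then show ?thesis by (simp add: exp_diff field_simps)
  qed
  have "1 = (\<Sum>k\<in>J. m k t)" using sum1 T by simp
  also have "\<dots> = exp (G 0 - G t) * (\<Sum>k\<in>J. exp (F k * t) * m k 0)"
    unfolding sum_distrib_left by (intro sum.cong refl scaled)
  finally have "exp (G 0 - G t) = 1 / (\<Sum>k\<in>J. exp (F k * t) * m k 0)"
    by (metis mult_zero_right nonzero_eq_divide_eq zero_neq_one)
  then show "m j t = exp (F j * t) * m j 0 / (\<Sum>k\<in>J. exp (F k * t) * m k 0)"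
    using scaled[OF J(2)] by simp
  show "m j t > 0" if "m j 0 > 0"
    using scaled[OF J(2)] that by simp
qed

lemma lagr_cong: "j \<in> J \<Longrightarrow> (\<And>k. k \<in> J \<Longrightarrow> z k = z' k) \<Longrightarrow> lagr z J j = lagr z' J j"
  unfolding lagr_def by (intro prod.cong) auto

lemma flow_masses:
  fixes B :: "real \<Rightarrow> 'n::{finite,linorder} cmat"
  assumes T: "is_interval T" "0 \<in> T" and CMV: "B 0 \<in> CMV"
    and flow: "flow_curve (hamiltonian f) B T" and lab: "spectral_labelling B T \<theta> \<mu>"
    and j: "j \<in> {1..CARD('n)}" and t: "t \<in> T"
  shows "((\<lambda>s. ln (\<mu> j s)) has_real_derivative
      (F_fun f (cis (\<theta> j t)) - (\<Sum>l=1..CARD('n). F_fun f (cis (\<theta> l t)) * \<mu> l t))) (at t within T)"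
    and "\<mu> j t = exp (F_fun f (cis (\<theta> j 0)) * t) * \<mu> j 0 /
      (\<Sum>l=1..CARD('n). exp (F_fun f (cis (\<theta> l 0)) * t) * \<mu> l 0)"
proof -
  let ?J = "{1..CARD('n)}"
  define z where "z k = cis (\<theta> k 0)" for k
  define A where "A t = proj_a (poly_mat ([:0, 1:] * pderiv f) (B t))" for t
  \<comment> \<open>The nodes are frozen at time 0, so \<open>m\<close> comes from a fixed
    polynomial of \<open>B t\<close> and is differentiated by the commutator alone; that it gives
    the labelled masses is shown below.\<close>
  define m where "m j t = Re (poly_mat (lagr z ?J j) (B t) $ first $ first)" for j t
  interpret at_0: cyclic_spectrum "B 0" ?J z
    using CMV_labelled_spectrum[OF CMV, of z] lab T(2) by (auto simp: spectral_labelling_def z_def)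
  have B: "(B has_vector_derivative A t ** B t - B t ** A t) (at t within T)" if "t \<in> T" for t
    unfolding A_def by (rule flow_curve_derivative[OF flow that])
  have A: "adj (A t) = - A t" for t unfolding A_def by (rule proj_a_antihermitian)
  have U: "unitary (B t)" if "t \<in> T" for t
    by (rule flow_unitary[OF T that at_0.unitary A B])
  \<comment> \<open>Every polynomial of \<open>B t\<close> evolves by the commutator, so the one
    that annihilates \<open>B 0\<close> annihilates \<open>B t\<close>, and no eigenvalue can leave
    the initial spectrum.\<close>
  have nodal: "poly_mat (nodal z ?J) (B t) = 0" if "t \<in> T" for t
  proof (rule isospectral_zero[OF T that, where A = A])
    have "poly (nodal z ?J) (z k) = poly 0 (z k)" if "k \<in> ?J" for k
      using that by (auto simp: nodal_def poly_prod)
    from at_0.poly_mat_cong[OF this] show "poly_mat (nodal z ?J) (B 0) = 0" by simp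
  qed (auto intro: A has_vector_derivative_poly_mat B)
  have eig: "eigenvalues (B t) = (\<lambda>j. cis (\<theta> j t)) ` ?J" if "t \<in> T" for t
    using lab that by (simp add: spectral_labelling_def)
  have sub: "eigenvalues (B t) \<subseteq> z ` ?J" if t: "t \<in> T" for t
  proof
    fix a assume "a \<in> eigenvalues (B t)"
    then obtain M :: "'n cmat" where M: "M \<noteq> 0" "B t ** M = mat a ** M" by (auto simp: eigenvalues_iff)
    have "poly (nodal z ?J) a = 0"
      using poly_mat_eigen[OF M(2), of "nodal z ?J"] nodal[OF t] M(1) by (simp add: mat_mult_eq_0)
    then show "a \<in> z ` ?J" by (auto simp: nodal_def poly_prod)
  qed
  \<comment> \<open>A continuous label with values in the finite initial spectrum is constant on an
    interval, so eigenvalues keep their labels.\<close>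
  have const: "cis (\<theta> k t) = z k" if k: "k \<in> ?J" and t: "t \<in> T" for k t
  proof -
    have "(\<lambda>t. cis (\<theta> k t)) ` T \<subseteq> z ` ?J" using sub eig k by blast
    then have "finite ((\<lambda>t. cis (\<theta> k t)) ` T)" by (rule finite_subset) simp
    moreover have "continuous_on T (\<lambda>t. cis (\<theta> k t))"
      using lab k by (auto simp: spectral_labelling_def intro: continuous_on_cis)
    ultimately have "(\<lambda>t. cis (\<theta> k t)) constant_on T"
      using T(1) by (intro continuous_finite_range_constant) (auto simp: is_interval_connected)
    then show ?thesis using t T(2) unfolding constant_on_def z_def by metis
  qed
  have inj_t: "inj_on (\<lambda>j. cis (\<theta> j t)) ?J" if "t \<in> T" for t
  proof -
    have "inj_on (\<lambda>j. cis (\<theta> j t)) ?J \<longleftrightarrow> inj_on z ?J"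
      by (rule inj_on_cong) (rule const[OF _ that])
    then show ?thesis using at_0.inj by blast
  qed
  have eig_z: "eigenvalues (B t) = z ` ?J" if "t \<in> T" for t
    unfolding eig[OF that] by (rule image_cong[OF refl]) (rule const[OF _ that])
  have spec: "unitary_spectrum (B t) ?J z" if "t \<in> T" for t
    using U[OF that] eig_z[OF that] at_0.inj by unfold_locales auto
  have \<mu>: "\<mu> k t = m k t" if k: "k \<in> ?J" and t: "t \<in> T" for k t
  proof -
    have "unitary_spectrum (B t) ?J (\<lambda>j. cis (\<theta> j t))"
      using U[OF t] eig[OF t] inj_t[OF t] by unfold_locales auto
    from labelled_first(2)[OF lab t this k] show ?thesis
      using lagr_cong[OF k, of "\<lambda>j. cis (\<theta> j t)" z] const t by (simp add: m_def eproj_def)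
  qed
  define F where "F k = F_fun f (z k)" for k
  have m: "(m k has_real_derivative (F k - (\<Sum>l\<in>?J. F l * m l t)) * m k t) (at t within T)"
    and sum1: "(\<Sum>k\<in>?J. m k t) = 1" if t: "t \<in> T" and k: "k \<in> ?J" for k t
  proof -
    interpret unitary_spectrum "B t" ?J z by (rule spec[OF t])
    have mass: "mass k = m k t" for k by (simp add: mass_def P_def m_def)
    show "(\<Sum>k\<in>?J. m k t) = 1" using sum_mass by (simp add: mass)
    have "((\<lambda>s. Re (poly_mat (lagr z ?J k) (B s) $ first $ first)) has_vector_derivative
        Re ((A t ** P k - P k ** A t) $ first $ first)) (at t within T)"
      unfolding P_def
      by (intro bounded_linear.has_vector_derivative[OF bounded_linear_Re]
          bounded_linear.has_vector_derivative[OF bounded_linear_vec_nth]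
          has_vector_derivative_poly_mat B t)
    then show "(m k has_real_derivative (F k - (\<Sum>l\<in>?J. F l * m l t)) * m k t) (at t within T)"
      unfolding has_real_derivative_iff_has_vector_derivative m_def[abs_def] A_def commutator_first[OF k]
      by (simp add: mass F_def F_fun_def m_def)
  qed
  have pos0: "m k 0 > 0" if "k \<in> ?J" for k
    using at_0.mass_pos[OF that] by (simp add: at_0.mass_def at_0.P_def m_def)
  note ode = normalized_exponential_ode[OF T _ finite_atLeastAtMost _ m sum1[OF _ j]]
  have pos: "m j t > 0"
    using ode(2)[OF t j] pos0[OF j] by blast
  have "((\<lambda>s. ln (m j s)) has_real_derivative F j - (\<Sum>l\<in>?J. F l * m l t)) (at t within T)"
    using pos by (auto intro!: derivative_eq_intros m t j)
  then have "((\<lambda>s. ln (\<mu> j s)) has_real_derivative F j - (\<Sum>l\<in>?J. F l * m l t)) (at t within T)"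
    using \<mu>[OF j] t by (elim has_field_derivative_transform_within[where d = 1]) auto
  moreover have "(\<Sum>l=1..CARD('n). F_fun f (cis (\<theta> l t)) * \<mu> l t) = (\<Sum>l\<in>?J. F l * m l t)"
    by (intro sum.cong refl) (simp add: F_def const t \<mu>)
  ultimately show "((\<lambda>s. ln (\<mu> j s)) has_real_derivative
      (F_fun f (cis (\<theta> j t)) - (\<Sum>l=1..CARD('n). F_fun f (cis (\<theta> l t)) * \<mu> l t))) (at t within T)"
    by (simp add: F_def const[OF j t])
  have "(\<Sum>l=1..CARD('n). exp (F_fun f (cis (\<theta> l 0)) * t) * \<mu> l 0) = (\<Sum>l\<in>?J. exp (F l * t) * m l 0)"
    by (intro sum.cong refl) (simp add: F_def z_def \<mu> T)
  then show "\<mu> j t = exp (F_fun f (cis (\<theta> j 0)) * t) * \<mu> j 0 /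
      (\<Sum>l=1..CARD('n). exp (F_fun f (cis (\<theta> l 0)) * t) * \<mu> l 0)"
    using ode(1)[OF t j] by (simp add: F_def z_def \<mu>[OF j t] \<mu>[OF j T(2)])
qed

theorem corollary6p5:
  fixes f :: "complex poly"
  shows
    "(\<forall>(U :: ('n::{finite,linorder} cmat) set) C \<theta> \<mu>.
        open U \<longrightarrow> C \<in> U \<inter> CMV \<longrightarrow> spectral_labelling (\<lambda>B. B) (U \<inter> CMV) \<theta> \<mu> \<longrightarrow>
        (\<forall>j\<in>{1..CARD('n)}.
           has_bracket_on (U \<inter> CMV) (hamiltonian f) (\<lambda>B. ln (\<mu> j B)) C
             (F_fun f (cis (\<theta> j C)) - (\<Sum>l=1..CARD('n). F_fun f (cis (\<theta> l C)) * \<mu> l C))))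
     \<and>
     (\<forall>(B :: real \<Rightarrow> 'n cmat) T \<theta> \<mu>.
        is_interval T \<longrightarrow> 0 \<in> T \<longrightarrow> B 0 \<in> CMV \<longrightarrow> flow_curve (hamiltonian f) B T \<longrightarrow>
        spectral_labelling B T \<theta> \<mu> \<longrightarrow>
        (\<forall>j\<in>{1..CARD('n)}. \<forall>t\<in>T.
           ((\<lambda>s. ln (\<mu> j s)) has_real_derivative
             (F_fun f (cis (\<theta> j t)) - (\<Sum>l=1..CARD('n). F_fun f (cis (\<theta> l t)) * \<mu> l t)))
             (at t within T) \<and>
           \<mu> j t = exp (F_fun f (cis (\<theta> j 0)) * t) * \<mu> j 0 /
                   (\<Sum>l=1..CARD('n). exp (F_fun f (cis (\<theta> l 0)) * t) * \<mu> l 0)))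
     \<and>
     (\<forall>(U :: ('n cmat) set) d C \<theta> \<mu>.
        open U \<longrightarrow> C \<in> U \<inter> {B \<in> CMV. det B = d} \<longrightarrow>
        spectral_labelling (\<lambda>B. B) (U \<inter> {B \<in> CMV. det B = d}) \<theta> \<mu> \<longrightarrow>
        (\<forall>j\<in>{1..CARD('n) - 1}. \<forall>l\<in>{1..CARD('n) - 1}.
           has_bracket_on (U \<inter> {B \<in> CMV. det B = d}) (\<theta> l)
             (\<lambda>B. 1/2 * ln (\<mu> j B / \<mu> CARD('n) B)) C (if j = l then 1 else 0)))"
proof (intro conjI allI impI ballI)
  fix U :: "('n cmat) set" and C \<theta> \<mu> j
  assume "open U" "C \<in> U \<inter> CMV" "spectral_labelling (\<lambda>B. B) (U \<inter> CMV) \<theta> \<mu>" "j \<in> {1..CARD('n)}"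
  then show "has_bracket_on (U \<inter> CMV) (hamiltonian f) (\<lambda>B. ln (\<mu> j B)) C
      (F_fun f (cis (\<theta> j C)) - (\<Sum>l=1..CARD('n). F_fun f (cis (\<theta> l C)) * \<mu> l C))"
    by (rule CMV_bracket_hamiltonian)
next
  fix B :: "real \<Rightarrow> 'n cmat" and T \<theta> \<mu> j t
  assume "is_interval T" "0 \<in> T" "B 0 \<in> CMV" "flow_curve (hamiltonian f) B T"
    "spectral_labelling B T \<theta> \<mu>" "j \<in> {1..CARD('n)}" "t \<in> T"
  note * = flow_masses[OF this]
  show "((\<lambda>s. ln (\<mu> j s)) has_real_derivative
      (F_fun f (cis (\<theta> j t)) - (\<Sum>l=1..CARD('n). F_fun f (cis (\<theta> l t)) * \<mu> l t))) (at t within T)"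
    by (rule *(1))
  show "\<mu> j t = exp (F_fun f (cis (\<theta> j 0)) * t) * \<mu> j 0 /
      (\<Sum>l=1..CARD('n). exp (F_fun f (cis (\<theta> l 0)) * t) * \<mu> l 0)"
    by (rule *(2))
next
  fix U :: "('n cmat) set" and d C \<theta> \<mu> j l
  assume "open U" "C \<in> U \<inter> {B \<in> CMV. det B = d}"
    "spectral_labelling (\<lambda>B. B) (U \<inter> {B \<in> CMV. det B = d}) \<theta> \<mu>"
    "j \<in> {1..CARD('n) - 1}" "l \<in> {1..CARD('n) - 1}"
  then show "has_bracket_on (U \<inter> {B \<in> CMV. det B = d}) (\<theta> l)
      (\<lambda>B. 1/2 * ln (\<mu> j B / \<mu> CARD('n) B)) C (if j = l then 1 else 0)"
    by (rule CMV_bracket_angle)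
qed

end
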